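(* Let $\mathcal V$ be a braided strict monoidal category. There are 2-functors $$K:{}_{\mathcal C(\mathcal V)}\mathrm{gr}\to{}_{\mathcal C(\mathcal V)}\mathrm{Cat}\qquad\text{and}\qquad K:{}^{\mathcal A(\mathcal V)}\mathrm{gr}\to{}^{\mathcal A(\mathcal V)}\mathrm{Cat},$$ given on 0-cells by $K(G,A)_{\sigma,\tau}=A_{\sigma^{-1}\tau}$, respectively $K(G,C)_{\sigma,\tau}=C_{\sigma^{-1}\tau}$, for $\sigma,\tau\in G$ (the underlying class being $G$). The first functor sends Hopf group algebras to Hopf $\mathcal V$-categories, and the second one sends Hopf group coalgebras to dual Hopf $\mathcal V$-categories.
   Context: $\mathcal C(\mathcal V)$, $\mathcal A(\mathcal V)$: monoidal categories of coalgebras, algebras in $\mathcal V$. Let $(\mathcal W,\otimes,k)$ be a strict monoidal category; below one takes $\mathcal W=\mathcal C(\mathcal V)$ or $\mathcal W=\mathcal A(\mathcal V)$. **${}_{\mathcal W}\mathrm{Cat}$.** 0-cells: classes $X$ with objects $A_{x,y}$ and morphisms $m_{x,y,z}:A_{x,y}\otimes A_{y,z}\to A_{x,z}$, $\eta_x:k\to A_{x,x}$, associative and unital. 1-cells $f:A\to B$: a map $f:X\to Y$ and morphisms $f_{x,y}:A_{x,y}\to B_{f(x),f(y)}$ compatible with $m,\eta$. 2-cells $\alpha:f\Rightarrow g$: morphisms $\alpha_x:k\to B_{g(x),f(x)}$ with $m\circ(g_{x,y}\otimes\alpha_y)=m\circ(\alpha_x\otimes f_{x,y})$. Composition of 1-cells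 is componentwise, vertical composition is $(\beta\circ\alpha)_x=m\circ(\beta_x\otimes\alpha_x)$, horizontal composition of $\alpha:f\Rightarrow f'$, $\beta:g\Rightarrow g'$ is $(\alpha*\beta)_x=m\circ((g'_{f'(x),f(x)}\circ\alpha_x)\otimes\beta_{f(x)})$. **${}^{\mathcal W}\mathrm{Cat}$.** 0-cells (dual $\mathcal W$-categories): classes $X$ with objects $C_{x,y}$ and coassociative, counital morphisms $\Delta_{x,y,z}:C_{x,z}\to C_{x,y}\otimes C_{y,z}$, $\varepsilon_x:C_{x,x}\to k$. 1-cells $f:C\to D$: a map $f:X\to Y$ and morphisms $f_{x,y}:D_{f(x),f(y)}\to C_{x,y}$ compatible with $\Delta,\varepsilon$. 2-cells $\alpha:f\Rightarrow g$: morphisms $\alpha_x:D_{f(x),g(x)}\to k$ with $(f_{x,y}\otimes\alpha_y)\circ\Delta_{f(x),f(y),g(y)}=(\alpha_x\otimes g_{x,y})\circ\Delta_{f(x),g(x),g(y)}$. Compositions: $(g\circ f)_{x,y}=f_{x,y}\circ g_{f(x),f(y)}$, $(\beta\circ\alpha)_x=(\alpha_x\otimes\beta_x)\circ\Delta_{f(x),g(x),h(x)}$, $(\alpha*\beta)_x=(\beta_{f(x)}\otimes(\alpha_x\circ g'_{f(x),f'(x)}))\circ\Delta$. **${}_{\mathcal W}\mathrm{gr}$.** 0-cells $(G,A)$ (group graded algebras): a group $G$ with unit $e$, objects $A_\sigma$ ($\sigma\in G$), and morphisms $m_{\sigma,\tau}:A_\sigma\otimes A_\tau\to A_{\sigma\tau}$,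 $\eta:k\to A_e$, associative and unital. 1-cells $(G,A)\to(H,B)$: a group morphism $f:G\to H$ and morphisms $f_\sigma:A_\sigma\to B_{f(\sigma)}$ compatible with $m$ and $\eta$. 2-cells $\alpha:f\Rightarrow g$: morphisms $\alpha_\sigma:k\to B_{g(\sigma)^{-1}f(\sigma)}$ with $m\circ(g_{\sigma^{-1}\tau}\otimes\alpha_\tau)=m\circ(\alpha_\sigma\otimes f_{\sigma^{-1}\tau})$ for all $\sigma,\tau\in G$. **${}^{\mathcal W}\mathrm{gr}$.** 0-cells $(G,C)$ (group graded coalgebras): a group $G$, objects $C_\sigma$, and coassociative, counital morphisms $\Delta_{\sigma,\tau}:C_{\sigma\tau}\to C_\sigma\otimes C_\tau$, $\varepsilon:C_e\to k$. 1-cells $(G,C)\to(H,D)$: a group morphism $f$ and morphisms $f_\sigma:D_{f(\sigma)}\to C_\sigma$ compatible with $\Delta,\varepsilon$. 2-cells $\alpha:f\Rightarrow g$: morphisms $\alpha_\sigma:D_{f(\sigma)^{-1}g(\sigma)}\to k$ with $(f_{\sigma^{-1}\tau}\otimes\alpha_\tau)\circ\Delta_{f(\sigma)^{-1}f(\tau),f(\tau)^{-1}g(\tau)}=(\alpha_\sigma\otimes g_{\sigma^{-1}\tau})\circ\Delta_{f(\sigma)^{-1}g(\sigma),g(\sigma)^{-1}g(\tau)}$. Compositions in ${}_{\mathcal W}\mathrm{gr}$ and ${}^{\mathcal W}\mathrm{gr}$ are given by the same formulas as in ${}_{\mathcal W}\mathrm{Cat}$ and ${}^{\mathcal W}\mathrm{Cat}$.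 On 0-cells, $K(G,A)$ has multiplications $m_{\sigma,\rho,\tau}=m_{\sigma^{-1}\rho,\rho^{-1}\tau}$ and units $\eta_\sigma=\eta$; $K(G,C)$ has $\Delta_{\sigma,\rho,\tau}=\Delta_{\sigma^{-1}\rho,\rho^{-1}\tau}$ and $\varepsilon_\sigma=\varepsilon$. On 1-cells $K(f)_{\sigma,\tau}=f_{\sigma^{-1}\tau}$, on 2-cells $K(\alpha)_\sigma=\alpha_\sigma$. A Hopf group algebra is a 0-cell $(G,A)$ of ${}_{\mathcal C(\mathcal V)}\mathrm{gr}$ (each $A_\sigma$ a coalgebra with $\Delta_\sigma,\varepsilon_\sigma$) for which there exist morphisms $S_\sigma:A_\sigma\to A_{\sigma^{-1}}$ in $\mathcal V$ with $m_{\sigma,\sigma^{-1}}\circ(\mathrm{id}\otimes S_\sigma)\circ\Delta_\sigma=m_{\sigma^{-1},\sigma}\circ(S_\sigma\otimes\mathrm{id})\circ\Delta_\sigma=\eta\circ\varepsilon_\sigma$. A Hopf group coalgebra is a 0-cell $(G,C)$ of ${}^{\mathcal A(\mathcal V)}\mathrm{gr}$ (each $C_\sigma$ an algebra with $m_\sigma,\eta_\sigma$) for which there exist morphisms $S_\sigma:C_{\sigma^{-1}}\to C_\sigma$ with $m_\sigma\circ(\mathrm{id}\otimes S_\sigma)\circ\Delta_{\sigma,\sigma^{-1}}=m_\sigma\circ(S_\sigma\otimes\mathrm{id})\circ\Delta_{\sigma^{-1},\sigma}=\eta_\sigma\circ\varepsilon$. A Hopf $\mathcal V$-category is a $\mathcal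 C(\mathcal V)$-category $A$ with morphisms $S_{x,y}:A_{x,y}\to A_{y,x}$ in $\mathcal V$ such that $m_{x,y,x}\circ(\mathrm{id}\otimes S_{x,y})\circ\Delta_{x,y}=\eta_x\circ\varepsilon_{x,y}$ and $m_{y,x,y}\circ(S_{x,y}\otimes\mathrm{id})\circ\Delta_{x,y}=\eta_y\circ\varepsilon_{x,y}$. A dual Hopf $\mathcal V$-category is a dual $\mathcal A(\mathcal V)$-category $C$ with morphisms $S_{x,y}:C_{y,x}\to C_{x,y}$ in $\mathcal V$ such that $m_{x,y}\circ(\mathrm{id}\otimes S_{x,y})\circ\Delta_{x,y,x}=\eta_{x,y}\circ\varepsilon_x$ and $m_{y,x}\circ(S_{y,x}\otimes\mathrm{id})\circ\Delta_{x,y,x}=\eta_{y,x}\circ\varepsilon_x$, where $m_{x,y},\eta_{x,y}$ is the algebra structure of $C_{x,y}$. *)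

theory Defs
  imports "HOL-Algebra.Group" "HOL-Library.FuncSet"
begin

section \<open>Strict monoidal categories\<close>

text \<open>
  A category is given by a family of hom-sets indexed by pairs of objects. The hom-sets need not
  be disjoint: a coalgebra morphism is literally a morphism of the underlying category.
  \<open>g \<cdot> f\<close> is ``\<open>g\<close> after \<open>f\<close>''; \<open>\<boxtimes>\<close> is the tensor product of objects and \<open>\<boxdot>\<close> that of
  morphisms.
\<close>

record ('o, 'a) moncat =
  Obj :: "'o set"
  Hom :: "'o \<Rightarrow> 'o \<Rightarrow> 'a set"
  Idn :: "'o \<Rightarrow> 'a" ("\<i>\<index>")
  Cmp :: "'a \<Rightarrow> 'a \<Rightarrow> 'a" (infixl "\<cdot>\<index>" 65)
  Unt :: "'o" ("\<k>\<index>")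
  TenO :: "'o \<Rightarrow> 'o \<Rightarrow> 'o" (infixl "\<boxtimes>\<index>" 70)
  TenM :: "'a \<Rightarrow> 'a \<Rightarrow> 'a" (infixl "\<boxdot>\<index>" 70)

locale strict_monoidal_category =
  fixes W :: "('o, 'a, 'm) moncat_scheme" (structure)
  assumes id_hom: "A \<in> Obj W \<Longrightarrow> \<i> A \<in> Hom W A A"
    and comp_hom: "\<lbrakk>A \<in> Obj W; B \<in> Obj W; C \<in> Obj W; f \<in> Hom W A B; g \<in> Hom W B C\<rbrakk>
      \<Longrightarrow> g \<cdot> f \<in> Hom W A C"
    and comp_id_left: "\<lbrakk>A \<in> Obj W; B \<in> Obj W; f \<in> Hom W A B\<rbrakk> \<Longrightarrow> \<i> B \<cdot> f = f"
    and comp_id_right: "\<lbrakk>A \<in> Obj W; B \<in> Obj W; f \<in> Hom W A B\<rbrakk> \<Longrightarrow> f \<cdot> \<i> A = f"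
    and comp_assoc: "\<lbrakk>A \<in> Obj W; B \<in> Obj W; C \<in> Obj W; D \<in> Obj W;
        f \<in> Hom W A B; g \<in> Hom W B C; h \<in> Hom W C D\<rbrakk> \<Longrightarrow> (h \<cdot> g) \<cdot> f = h \<cdot> (g \<cdot> f)"
    and unit_obj: "\<k> \<in> Obj W"
    and tensor_obj: "\<lbrakk>A \<in> Obj W; B \<in> Obj W\<rbrakk> \<Longrightarrow> A \<boxtimes> B \<in> Obj W"
    and tensor_hom: "\<lbrakk>A \<in> Obj W; A' \<in> Obj W; B \<in> Obj W; B' \<in> Obj W;
        f \<in> Hom W A A'; g \<in> Hom W B B'\<rbrakk> \<Longrightarrow> f \<boxdot> g \<in> Hom W (A \<boxtimes> B) (A' \<boxtimes> B')"
    and tensor_id: "\<lbrakk>A \<in> Obj W; B \<in> Obj W\<rbrakk> \<Longrightarrow> \<i> A \<boxdot> \<i> B = \<i> (A \<boxtimes> B)"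
    and interchange: "\<lbrakk>A \<in> Obj W; A' \<in> Obj W; A'' \<in> Obj W; B \<in> Obj W; B' \<in> Obj W; B'' \<in> Obj W;
        f \<in> Hom W A A'; f' \<in> Hom W A' A''; g \<in> Hom W B B'; g' \<in> Hom W B' B''\<rbrakk>
      \<Longrightarrow> (f' \<cdot> f) \<boxdot> (g' \<cdot> g) = (f' \<boxdot> g') \<cdot> (f \<boxdot> g)"
    and tensor_obj_assoc: "\<lbrakk>A \<in> Obj W; B \<in> Obj W; C \<in> Obj W\<rbrakk>
      \<Longrightarrow> (A \<boxtimes> B) \<boxtimes> C = A \<boxtimes> (B \<boxtimes> C)"
    and unit_tensor_obj: "A \<in> Obj W \<Longrightarrow> \<k> \<boxtimes> A = A"
    and tensor_unit_obj: "A \<in> Obj W \<Longrightarrow> A \<boxtimes> \<k> = A"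
    and tensor_hom_assoc: "\<lbrakk>A \<in> Obj W; A' \<in> Obj W; B \<in> Obj W; B' \<in> Obj W; C \<in> Obj W; C' \<in> Obj W;
        f \<in> Hom W A A'; g \<in> Hom W B B'; h \<in> Hom W C C'\<rbrakk>
      \<Longrightarrow> (f \<boxdot> g) \<boxdot> h = f \<boxdot> (g \<boxdot> h)"
    and unit_tensor_hom: "\<lbrakk>A \<in> Obj W; B \<in> Obj W; f \<in> Hom W A B\<rbrakk> \<Longrightarrow> \<i> \<k> \<boxdot> f = f"
    and tensor_unit_hom: "\<lbrakk>A \<in> Obj W; B \<in> Obj W; f \<in> Hom W A B\<rbrakk> \<Longrightarrow> f \<boxdot> \<i> \<k> = f"

record ('o, 'a) brmoncat = "('o, 'a) moncat" +
  Br :: "'o \<Rightarrow> 'o \<Rightarrow> 'a" ("\<c>\<index>")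

locale braided_strict_monoidal_category = strict_monoidal_category V
  for V :: "('o, 'a, 'm) brmoncat_scheme" (structure) +
  assumes braid_hom: "\<lbrakk>A \<in> Obj V; B \<in> Obj V\<rbrakk> \<Longrightarrow> \<c> A B \<in> Hom V (A \<boxtimes> B) (B \<boxtimes> A)"
    and braid_iso: "\<lbrakk>A \<in> Obj V; B \<in> Obj V\<rbrakk> \<Longrightarrow> \<exists>d \<in> Hom V (B \<boxtimes> A) (A \<boxtimes> B).
        d \<cdot> \<c> A B = \<i> (A \<boxtimes> B) \<and> \<c> A B \<cdot> d = \<i> (B \<boxtimes> A)"
    and braid_natural: "\<lbrakk>A \<in> Obj V; A' \<in> Obj V; B \<in> Obj V; B' \<in> Obj V;
        f \<in> Hom V A A'; g \<in> Hom V B B'\<rbrakk> \<Longrightarrow> \<c> A' B' \<cdot> (f \<boxdot> g) = (g \<boxdot> f) \<cdot> \<c> A B"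
    and braid_tensor_right: "\<lbrakk>A \<in> Obj V; B \<in> Obj V; C \<in> Obj V\<rbrakk>
      \<Longrightarrow> \<c> A (B \<boxtimes> C) = (\<i> B \<boxdot> \<c> A C) \<cdot> (\<c> A B \<boxdot> \<i> C)"
    and braid_tensor_left: "\<lbrakk>A \<in> Obj V; B \<in> Obj V; C \<in> Obj V\<rbrakk>
      \<Longrightarrow> \<c> (A \<boxtimes> B) C = (\<c> A C \<boxdot> \<i> B) \<cdot> (\<i> A \<boxdot> \<c> B C)"


section \<open>Coalgebras and algebras\<close>

text \<open>
  As the braiding need not be symmetric, a choice is made in the tensor product: coalgebras use
  \<open>\<c> C D\<close> and algebras use \<open>\<c> B A\<close>, so no inverse braiding occurs.
\<close>

record ('o, 'a) coalg =
  cca :: "'o"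
  cmul :: "'a"
  ceps :: "'a"

record ('o, 'a) alg =
  aca :: "'o"
  amul :: "'a"
  aeta :: "'a"

context
  fixes V :: "('o, 'a, 'm) brmoncat_scheme" (structure)
begin

definition coalgebras :: "('o, 'a) coalg set" where
  "coalgebras = {C. cca C \<in> Obj V \<and>
     cmul C \<in> Hom V (cca C) (cca C \<boxtimes> cca C) \<and> ceps C \<in> Hom V (cca C) \<k> \<and>
     (cmul C \<boxdot> \<i> (cca C)) \<cdot> cmul C = (\<i> (cca C) \<boxdot> cmul C) \<cdot> cmul C \<and>
     (ceps C \<boxdot> \<i> (cca C)) \<cdot> cmul C = \<i> (cca C) \<and>
     (\<i> (cca C) \<boxdot> ceps C) \<cdot> cmul C = \<i> (cca C)}"

definition coalgebra_homs :: "('o, 'a) coalg \<Rightarrow> ('o, 'a) coalg \<Rightarrow> 'a set" where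
  "coalgebra_homs C D = {f \<in> Hom V (cca C) (cca D).
     cmul D \<cdot> f = (f \<boxdot> f) \<cdot> cmul C \<and> ceps D \<cdot> f = ceps C}"

definition coalgebra_tensor :: "('o, 'a) coalg \<Rightarrow> ('o, 'a) coalg \<Rightarrow> ('o, 'a) coalg" where
  "coalgebra_tensor C D = \<lparr>cca = cca C \<boxtimes> cca D,
     cmul = (\<i> (cca C) \<boxdot> \<c> (cca C) (cca D) \<boxdot> \<i> (cca D)) \<cdot> (cmul C \<boxdot> cmul D),
     ceps = ceps C \<boxdot> ceps D\<rparr>"

definition Coalg :: "(('o, 'a) coalg, 'a) moncat" where
  "Coalg = \<lparr>Obj = coalgebras, Hom = coalgebra_homs, Idn = (\<lambda>C. \<i> (cca C)), Cmp = Cmp V,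
     Unt = \<lparr>cca = \<k>, cmul = \<i> \<k>, ceps = \<i> \<k>\<rparr>, TenO = coalgebra_tensor, TenM = TenM V\<rparr>"

definition algebras :: "('o, 'a) alg set" where
  "algebras = {A. aca A \<in> Obj V \<and>
     amul A \<in> Hom V (aca A \<boxtimes> aca A) (aca A) \<and> aeta A \<in> Hom V \<k> (aca A) \<and>
     amul A \<cdot> (amul A \<boxdot> \<i> (aca A)) = amul A \<cdot> (\<i> (aca A) \<boxdot> amul A) \<and>
     amul A \<cdot> (aeta A \<boxdot> \<i> (aca A)) = \<i> (aca A) \<and>
     amul A \<cdot> (\<i> (aca A) \<boxdot> aeta A) = \<i> (aca A)}"

definition algebra_homs :: "('o, 'a) alg \<Rightarrow> ('o, 'a) alg \<Rightarrow> 'a set" where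
  "algebra_homs A B = {f \<in> Hom V (aca A) (aca B).
     f \<cdot> amul A = amul B \<cdot> (f \<boxdot> f) \<and> f \<cdot> aeta A = aeta B}"

definition algebra_tensor :: "('o, 'a) alg \<Rightarrow> ('o, 'a) alg \<Rightarrow> ('o, 'a) alg" where
  "algebra_tensor A B = \<lparr>aca = aca A \<boxtimes> aca B,
     amul = (amul A \<boxdot> amul B) \<cdot> (\<i> (aca A) \<boxdot> \<c> (aca B) (aca A) \<boxdot> \<i> (aca B)),
     aeta = aeta A \<boxdot> aeta B\<rparr>"

definition Alg :: "(('o, 'a) alg, 'a) moncat" where
  "Alg = \<lparr>Obj = algebras, Hom = algebra_homs, Idn = (\<lambda>A. \<i> (aca A)), Cmp = Cmp V,
     Unt = \<lparr>aca = \<k>, amul = \<i> \<k>, aeta = \<i> \<k>\<rparr>, TenO = algebra_tensor, TenM = TenM V\<rparr>"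

end


section \<open>Strict 2-categories and 2-functors\<close>

text \<open>
  All data are indexed by the cells they depend on. For \<open>f, g, h : A \<rightarrow> B\<close>, \<open>\<alpha> : f \<Rightarrow> g\<close> and
  \<open>\<beta> : g \<Rightarrow> h\<close>, \<open>VComp A B f g h \<beta> \<alpha> : f \<Rightarrow> h\<close> is the vertical composite; for
  \<open>\<alpha> : f \<Rightarrow> f'\<close> between 1-cells \<open>A \<rightarrow> B\<close> and \<open>\<beta> : g \<Rightarrow> g'\<close> between 1-cells \<open>B \<rightarrow> C\<close>,
  \<open>HComp A B C f f' g g' \<alpha> \<beta> : g \<circ> f \<Rightarrow> g' \<circ> f'\<close> is the horizontal composite \<open>\<alpha> * \<beta>\<close>, written in
  diagrammatic order, whereas \<open>Comp1 A B C g f\<close> is \<open>g \<circ> f\<close>.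
\<close>

record ('c, 'f, 't) twocat =
  Cell0 :: "'c set"
  Cell1 :: "'c \<Rightarrow> 'c \<Rightarrow> 'f set"
  Cell2 :: "'c \<Rightarrow> 'c \<Rightarrow> 'f \<Rightarrow> 'f \<Rightarrow> 't set"
  Id1 :: "'c \<Rightarrow> 'f"
  Comp1 :: "'c \<Rightarrow> 'c \<Rightarrow> 'c \<Rightarrow> 'f \<Rightarrow> 'f \<Rightarrow> 'f"
  Id2 :: "'c \<Rightarrow> 'c \<Rightarrow> 'f \<Rightarrow> 't"
  VComp :: "'c \<Rightarrow> 'c \<Rightarrow> 'f \<Rightarrow> 'f \<Rightarrow> 'f \<Rightarrow> 't \<Rightarrow> 't \<Rightarrow> 't"
  HComp :: "'c \<Rightarrow> 'c \<Rightarrow> 'c \<Rightarrow> 'f \<Rightarrow> 'f \<Rightarrow> 'f \<Rightarrow> 'f \<Rightarrow> 't \<Rightarrow> 't \<Rightarrow> 't"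

locale two_category =
  fixes X :: "('c, 'f, 't) twocat"
  assumes id1_cell: "A \<in> Cell0 X \<Longrightarrow> Id1 X A \<in> Cell1 X A A"
    and comp1_cell: "\<lbrakk>A \<in> Cell0 X; B \<in> Cell0 X; C \<in> Cell0 X; f \<in> Cell1 X A B; g \<in> Cell1 X B C\<rbrakk>
      \<Longrightarrow> Comp1 X A B C g f \<in> Cell1 X A C"
    and comp1_id_left: "\<lbrakk>A \<in> Cell0 X; B \<in> Cell0 X; f \<in> Cell1 X A B\<rbrakk>
      \<Longrightarrow> Comp1 X A B B (Id1 X B) f = f"
    and comp1_id_right: "\<lbrakk>A \<in> Cell0 X; B \<in> Cell0 X; f \<in> Cell1 X A B\<rbrakk>
      \<Longrightarrow> Comp1 X A A B f (Id1 X A) = f"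
    and comp1_assoc: "\<lbrakk>A \<in> Cell0 X; B \<in> Cell0 X; C \<in> Cell0 X; D \<in> Cell0 X;
        f \<in> Cell1 X A B; g \<in> Cell1 X B C; h \<in> Cell1 X C D\<rbrakk>
      \<Longrightarrow> Comp1 X A B D (Comp1 X B C D h g) f = Comp1 X A C D h (Comp1 X A B C g f)"
    and id2_cell: "\<lbrakk>A \<in> Cell0 X; B \<in> Cell0 X; f \<in> Cell1 X A B\<rbrakk> \<Longrightarrow> Id2 X A B f \<in> Cell2 X A B f f"
    and vcomp_cell: "\<lbrakk>A \<in> Cell0 X; B \<in> Cell0 X;
        f \<in> Cell1 X A B; g \<in> Cell1 X A B; h \<in> Cell1 X A B;
        \<alpha> \<in> Cell2 X A B f g; \<beta> \<in> Cell2 X A B g h\<rbrakk>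
      \<Longrightarrow> VComp X A B f g h \<beta> \<alpha> \<in> Cell2 X A B f h"
    and vcomp_id_left: "\<lbrakk>A \<in> Cell0 X; B \<in> Cell0 X; f \<in> Cell1 X A B; g \<in> Cell1 X A B;
        \<alpha> \<in> Cell2 X A B f g\<rbrakk>
      \<Longrightarrow> VComp X A B f g g (Id2 X A B g) \<alpha> = \<alpha>"
    and vcomp_id_right: "\<lbrakk>A \<in> Cell0 X; B \<in> Cell0 X; f \<in> Cell1 X A B; g \<in> Cell1 X A B;
        \<alpha> \<in> Cell2 X A B f g\<rbrakk>
      \<Longrightarrow> VComp X A B f f g \<alpha> (Id2 X A B f) = \<alpha>"
    and vcomp_assoc: "\<lbrakk>A \<in> Cell0 X; B \<in> Cell0 X;
        f \<in> Cell1 X A B; g \<in> Cell1 X A B; h \<in> Cell1 X A B; i \<in> Cell1 X A B;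
        \<alpha> \<in> Cell2 X A B f g; \<beta> \<in> Cell2 X A B g h; \<gamma> \<in> Cell2 X A B h i\<rbrakk>
      \<Longrightarrow> VComp X A B f g i (VComp X A B g h i \<gamma> \<beta>) \<alpha>
        = VComp X A B f h i \<gamma> (VComp X A B f g h \<beta> \<alpha>)"
    and hcomp_cell: "\<lbrakk>A \<in> Cell0 X; B \<in> Cell0 X; C \<in> Cell0 X;
        f \<in> Cell1 X A B; f' \<in> Cell1 X A B; g \<in> Cell1 X B C; g' \<in> Cell1 X B C;
        \<alpha> \<in> Cell2 X A B f f'; \<beta> \<in> Cell2 X B C g g'\<rbrakk>
      \<Longrightarrow> HComp X A B C f f' g g' \<alpha> \<beta> \<in> Cell2 X A C (Comp1 X A B C g f) (Comp1 X A B C g' f')"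
    and hcomp_id_left: "\<lbrakk>A \<in> Cell0 X; B \<in> Cell0 X; f \<in> Cell1 X A B; f' \<in> Cell1 X A B;
        \<alpha> \<in> Cell2 X A B f f'\<rbrakk>
      \<Longrightarrow> HComp X A A B (Id1 X A) (Id1 X A) f f' (Id2 X A A (Id1 X A)) \<alpha> = \<alpha>"
    and hcomp_id_right: "\<lbrakk>A \<in> Cell0 X; B \<in> Cell0 X; f \<in> Cell1 X A B; f' \<in> Cell1 X A B;
        \<alpha> \<in> Cell2 X A B f f'\<rbrakk>
      \<Longrightarrow> HComp X A B B f f' (Id1 X B) (Id1 X B) \<alpha> (Id2 X B B (Id1 X B)) = \<alpha>"
    and hcomp_assoc: "\<lbrakk>A \<in> Cell0 X; B \<in> Cell0 X; C \<in> Cell0 X; D \<in> Cell0 X;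
        f \<in> Cell1 X A B; f' \<in> Cell1 X A B; g \<in> Cell1 X B C; g' \<in> Cell1 X B C;
        h \<in> Cell1 X C D; h' \<in> Cell1 X C D;
        \<alpha> \<in> Cell2 X A B f f'; \<beta> \<in> Cell2 X B C g g'; \<gamma> \<in> Cell2 X C D h h'\<rbrakk>
      \<Longrightarrow> HComp X A C D (Comp1 X A B C g f) (Comp1 X A B C g' f') h h'
            (HComp X A B C f f' g g' \<alpha> \<beta>) \<gamma>
        = HComp X A B D f f' (Comp1 X B C D h g) (Comp1 X B C D h' g')
            \<alpha> (HComp X B C D g g' h h' \<beta> \<gamma>)"
    and hcomp_id2: "\<lbrakk>A \<in> Cell0 X; B \<in> Cell0 X; C \<in> Cell0 X; f \<in> Cell1 X A B; g \<in> Cell1 X B C\<rbrakk>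
      \<Longrightarrow> HComp X A B C f f g g (Id2 X A B f) (Id2 X B C g) = Id2 X A C (Comp1 X A B C g f)"
    and hcomp_vcomp: "\<lbrakk>A \<in> Cell0 X; B \<in> Cell0 X; C \<in> Cell0 X;
        f \<in> Cell1 X A B; f' \<in> Cell1 X A B; f'' \<in> Cell1 X A B;
        g \<in> Cell1 X B C; g' \<in> Cell1 X B C; g'' \<in> Cell1 X B C;
        \<alpha> \<in> Cell2 X A B f f'; \<alpha>' \<in> Cell2 X A B f' f'';
        \<beta> \<in> Cell2 X B C g g'; \<beta>' \<in> Cell2 X B C g' g''\<rbrakk>
      \<Longrightarrow> HComp X A B C f f'' g g'' (VComp X A B f f' f'' \<alpha>' \<alpha>) (VComp X B C g g' g'' \<beta>' \<beta>)
        = VComp X A C (Comp1 X A B C g f) (Comp1 X A B C g' f') (Comp1 X A B C g'' f'')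
            (HComp X A B C f' f'' g' g'' \<alpha>' \<beta>') (HComp X A B C f f' g g' \<alpha> \<beta>)"

record ('c, 'f, 't, 'd, 'g, 'u) twofun =
  Fun0 :: "'c \<Rightarrow> 'd"
  Fun1 :: "'c \<Rightarrow> 'c \<Rightarrow> 'f \<Rightarrow> 'g"
  Fun2 :: "'c \<Rightarrow> 'c \<Rightarrow> 'f \<Rightarrow> 'f \<Rightarrow> 't \<Rightarrow> 'u"

locale two_functor = src: two_category X + tgt: two_category Y
  for X :: "('c, 'f, 't) twocat" and Y :: "('d, 'g, 'u) twocat" +
  fixes F :: "('c, 'f, 't, 'd, 'g, 'u) twofun"
  assumes fun0_cell: "A \<in> Cell0 X \<Longrightarrow> Fun0 F A \<in> Cell0 Y"
    and fun1_cell: "\<lbrakk>A \<in> Cell0 X; B \<in> Cell0 X; f \<in> Cell1 X A B\<rbrakk>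
      \<Longrightarrow> Fun1 F A B f \<in> Cell1 Y (Fun0 F A) (Fun0 F B)"
    and fun2_cell: "\<lbrakk>A \<in> Cell0 X; B \<in> Cell0 X; f \<in> Cell1 X A B; g \<in> Cell1 X A B;
        \<alpha> \<in> Cell2 X A B f g\<rbrakk>
      \<Longrightarrow> Fun2 F A B f g \<alpha> \<in> Cell2 Y (Fun0 F A) (Fun0 F B) (Fun1 F A B f) (Fun1 F A B g)"
    and fun_id1: "A \<in> Cell0 X \<Longrightarrow> Fun1 F A A (Id1 X A) = Id1 Y (Fun0 F A)"
    and fun_comp1: "\<lbrakk>A \<in> Cell0 X; B \<in> Cell0 X; C \<in> Cell0 X; f \<in> Cell1 X A B; g \<in> Cell1 X B C\<rbrakk>
      \<Longrightarrow> Fun1 F A C (Comp1 X A B C g f)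
        = Comp1 Y (Fun0 F A) (Fun0 F B) (Fun0 F C) (Fun1 F B C g) (Fun1 F A B f)"
    and fun_id2: "\<lbrakk>A \<in> Cell0 X; B \<in> Cell0 X; f \<in> Cell1 X A B\<rbrakk>
      \<Longrightarrow> Fun2 F A B f f (Id2 X A B f) = Id2 Y (Fun0 F A) (Fun0 F B) (Fun1 F A B f)"
    and fun_vcomp: "\<lbrakk>A \<in> Cell0 X; B \<in> Cell0 X;
        f \<in> Cell1 X A B; g \<in> Cell1 X A B; h \<in> Cell1 X A B;
        \<alpha> \<in> Cell2 X A B f g; \<beta> \<in> Cell2 X A B g h\<rbrakk>
      \<Longrightarrow> Fun2 F A B f h (VComp X A B f g h \<beta> \<alpha>)
        = VComp Y (Fun0 F A) (Fun0 F B) (Fun1 F A B f) (Fun1 F A B g) (Fun1 F A B h)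
            (Fun2 F A B g h \<beta>) (Fun2 F A B f g \<alpha>)"
    and fun_hcomp: "\<lbrakk>A \<in> Cell0 X; B \<in> Cell0 X; C \<in> Cell0 X;
        f \<in> Cell1 X A B; f' \<in> Cell1 X A B; g \<in> Cell1 X B C; g' \<in> Cell1 X B C;
        \<alpha> \<in> Cell2 X A B f f'; \<beta> \<in> Cell2 X B C g g'\<rbrakk>
      \<Longrightarrow> Fun2 F A C (Comp1 X A B C g f) (Comp1 X A B C g' f') (HComp X A B C f f' g g' \<alpha> \<beta>)
        = HComp Y (Fun0 F A) (Fun0 F B) (Fun0 F C)
            (Fun1 F A B f) (Fun1 F A B f') (Fun1 F B C g) (Fun1 F B C g')
            (Fun2 F A B f f' \<alpha>) (Fun2 F B C g g' \<beta>)"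


section \<open>The 2-category of \<open>W\<close>-categories\<close>

text \<open>
  The class underlying a \<open>W\<close>-category is a set over an arbitrary type. Families are functions that
  are \<^const>\<open>undefined\<close> outside their index set (\<open>\<Pi>\<^sub>E\<close> and restricted abstractions), so that
  equality of cells is equality of families. In \<open>wtrans\<close>, and wherever 1-cells and 2-cells are
  tensored below, strictness is used to identify \<open>\<k> \<boxtimes> A\<close> and \<open>A \<boxtimes> \<k>\<close> with \<open>A\<close>.
\<close>

record ('x, 'o, 'a) wcat =
  vtx :: "'x set"
  hob :: "'x \<Rightarrow> 'x \<Rightarrow> 'o"
  mul :: "'x \<Rightarrow> 'x \<Rightarrow> 'x \<Rightarrow> 'a"
  unt :: "'x \<Rightarrow> 'a"

record ('x, 'a) wfun =
  vmap :: "'x \<Rightarrow> 'x"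
  hmap :: "'x \<Rightarrow> 'x \<Rightarrow> 'a"

context
  fixes W :: "('o, 'a, 'm) moncat_scheme" (structure)
begin

definition wcats :: "('x, 'o, 'a) wcat set" where
  "wcats = {A.
     hob A \<in> vtx A \<rightarrow>\<^sub>E vtx A \<rightarrow>\<^sub>E Obj W \<and>
     mul A \<in> (\<Pi>\<^sub>E x\<in>vtx A. \<Pi>\<^sub>E y\<in>vtx A. \<Pi>\<^sub>E z\<in>vtx A. Hom W (hob A x y \<boxtimes> hob A y z) (hob A x z)) \<and>
     unt A \<in> (\<Pi>\<^sub>E x\<in>vtx A. Hom W \<k> (hob A x x)) \<and>
     (\<forall>x\<in>vtx A. \<forall>y\<in>vtx A. \<forall>z\<in>vtx A. \<forall>u\<in>vtx A.
        mul A x z u \<cdot> (mul A x y z \<boxdot> \<i> (hob A z u))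
          = mul A x y u \<cdot> (\<i> (hob A x y) \<boxdot> mul A y z u)) \<and>
     (\<forall>x\<in>vtx A. \<forall>y\<in>vtx A.
        mul A x x y \<cdot> (unt A x \<boxdot> \<i> (hob A x y)) = \<i> (hob A x y) \<and>
        mul A x y y \<cdot> (\<i> (hob A x y) \<boxdot> unt A y) = \<i> (hob A x y))}"

definition wfuns :: "('x, 'o, 'a) wcat \<Rightarrow> ('x, 'o, 'a) wcat \<Rightarrow> ('x, 'a) wfun set" where
  "wfuns A B = {f.
     vmap f \<in> vtx A \<rightarrow>\<^sub>E vtx B \<and>
     hmap f \<in> (\<Pi>\<^sub>E x\<in>vtx A. \<Pi>\<^sub>E y\<in>vtx A. Hom W (hob A x y) (hob B (vmap f x) (vmap f y))) \<and>
     (\<forall>x\<in>vtx A. \<forall>y\<in>vtx A. \<forall>z\<in>vtx A.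
        hmap f x z \<cdot> mul A x y z
          = mul B (vmap f x) (vmap f y) (vmap f z) \<cdot> (hmap f x y \<boxdot> hmap f y z)) \<and>
     (\<forall>x\<in>vtx A. hmap f x x \<cdot> unt A x = unt B (vmap f x))}"

definition wtrans ::
  "('x, 'o, 'a) wcat \<Rightarrow> ('x, 'o, 'a) wcat \<Rightarrow> ('x, 'a) wfun \<Rightarrow> ('x, 'a) wfun \<Rightarrow> ('x \<Rightarrow> 'a) set" where
  "wtrans A B f g = {\<alpha>.
     \<alpha> \<in> (\<Pi>\<^sub>E x\<in>vtx A. Hom W \<k> (hob B (vmap g x) (vmap f x))) \<and>
     (\<forall>x\<in>vtx A. \<forall>y\<in>vtx A.
        mul B (vmap g x) (vmap g y) (vmap f y) \<cdot> (hmap g x y \<boxdot> \<alpha> y)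
          = mul B (vmap g x) (vmap f x) (vmap f y) \<cdot> (\<alpha> x \<boxdot> hmap f x y))}"

definition WCat :: "(('x, 'o, 'a) wcat, ('x, 'a) wfun, 'x \<Rightarrow> 'a) twocat" where
  "WCat = \<lparr>Cell0 = wcats, Cell1 = wfuns, Cell2 = wtrans,
     Id1 = (\<lambda>A. \<lparr>vmap = \<lambda>x\<in>vtx A. x, hmap = \<lambda>x\<in>vtx A. \<lambda>y\<in>vtx A. \<i> (hob A x y)\<rparr>),
     Comp1 = (\<lambda>A B C g f. \<lparr>
       vmap = \<lambda>x\<in>vtx A. vmap g (vmap f x),
       hmap = \<lambda>x\<in>vtx A. \<lambda>y\<in>vtx A. hmap g (vmap f x) (vmap f y) \<cdot> hmap f x y\<rparr>),
     Id2 = (\<lambda>A B f. \<lambda>x\<in>vtx A. unt B (vmap f x)),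
     VComp = (\<lambda>A B f g h \<beta> \<alpha>. \<lambda>x\<in>vtx A. mul B (vmap h x) (vmap g x) (vmap f x) \<cdot> (\<beta> x \<boxdot> \<alpha> x)),
     HComp = (\<lambda>A B C f f' g g' \<alpha> \<beta>. \<lambda>x\<in>vtx A.
       mul C (vmap g' (vmap f' x)) (vmap g' (vmap f x)) (vmap g (vmap f x))
         \<cdot> ((hmap g' (vmap f' x) (vmap f x) \<cdot> \<alpha> x) \<boxdot> \<beta> (vmap f x)))\<rparr>"

end


section \<open>The 2-category of dual \<open>W\<close>-categories\<close>

record ('x, 'o, 'a) dwcat =
  dvtx :: "'x set"
  dhob :: "'x \<Rightarrow> 'x \<Rightarrow> 'o"
  dcomul :: "'x \<Rightarrow> 'x \<Rightarrow> 'x \<Rightarrow> 'a"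
  dcounit :: "'x \<Rightarrow> 'a"

context
  fixes W :: "('o, 'a, 'm) moncat_scheme" (structure)
begin

definition dwcats :: "('x, 'o, 'a) dwcat set" where
  "dwcats = {C.
     dhob C \<in> dvtx C \<rightarrow>\<^sub>E dvtx C \<rightarrow>\<^sub>E Obj W \<and>
     dcomul C \<in> (\<Pi>\<^sub>E x\<in>dvtx C. \<Pi>\<^sub>E y\<in>dvtx C. \<Pi>\<^sub>E z\<in>dvtx C.
        Hom W (dhob C x z) (dhob C x y \<boxtimes> dhob C y z)) \<and>
     dcounit C \<in> (\<Pi>\<^sub>E x\<in>dvtx C. Hom W (dhob C x x) \<k>) \<and>
     (\<forall>x\<in>dvtx C. \<forall>y\<in>dvtx C. \<forall>z\<in>dvtx C. \<forall>u\<in>dvtx C.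
        (dcomul C x y z \<boxdot> \<i> (dhob C z u)) \<cdot> dcomul C x z u
          = (\<i> (dhob C x y) \<boxdot> dcomul C y z u) \<cdot> dcomul C x y u) \<and>
     (\<forall>x\<in>dvtx C. \<forall>y\<in>dvtx C.
        (dcounit C x \<boxdot> \<i> (dhob C x y)) \<cdot> dcomul C x x y = \<i> (dhob C x y) \<and>
        (\<i> (dhob C x y) \<boxdot> dcounit C y) \<cdot> dcomul C x y y = \<i> (dhob C x y))}"

definition dwfuns :: "('x, 'o, 'a) dwcat \<Rightarrow> ('x, 'o, 'a) dwcat \<Rightarrow> ('x, 'a) wfun set" where
  "dwfuns C D = {f.
     vmap f \<in> dvtx C \<rightarrow>\<^sub>E dvtx D \<and>
     hmap f \<in> (\<Pi>\<^sub>E x\<in>dvtx C. \<Pi>\<^sub>E y\<in>dvtx C. Hom W (dhob D (vmap f x) (vmap f y)) (dhob C x y)) \<and>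
     (\<forall>x\<in>dvtx C. \<forall>y\<in>dvtx C. \<forall>z\<in>dvtx C.
        dcomul C x y z \<cdot> hmap f x z
          = (hmap f x y \<boxdot> hmap f y z) \<cdot> dcomul D (vmap f x) (vmap f y) (vmap f z)) \<and>
     (\<forall>x\<in>dvtx C. dcounit C x \<cdot> hmap f x x = dcounit D (vmap f x))}"

definition dwtrans ::
  "('x, 'o, 'a) dwcat \<Rightarrow> ('x, 'o, 'a) dwcat \<Rightarrow> ('x, 'a) wfun \<Rightarrow> ('x, 'a) wfun \<Rightarrow> ('x \<Rightarrow> 'a) set" where
  "dwtrans C D f g = {\<alpha>.
     \<alpha> \<in> (\<Pi>\<^sub>E x\<in>dvtx C. Hom W (dhob D (vmap f x) (vmap g x)) \<k>) \<and>
     (\<forall>x\<in>dvtx C. \<forall>y\<in>dvtx C.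
        (hmap f x y \<boxdot> \<alpha> y) \<cdot> dcomul D (vmap f x) (vmap f y) (vmap g y)
          = (\<alpha> x \<boxdot> hmap g x y) \<cdot> dcomul D (vmap f x) (vmap g x) (vmap g y))}"

definition DWCat :: "(('x, 'o, 'a) dwcat, ('x, 'a) wfun, 'x \<Rightarrow> 'a) twocat" where
  "DWCat = \<lparr>Cell0 = dwcats, Cell1 = dwfuns, Cell2 = dwtrans,
     Id1 = (\<lambda>C. \<lparr>vmap = \<lambda>x\<in>dvtx C. x, hmap = \<lambda>x\<in>dvtx C. \<lambda>y\<in>dvtx C. \<i> (dhob C x y)\<rparr>),
     Comp1 = (\<lambda>C D E g f. \<lparr>
       vmap = \<lambda>x\<in>dvtx C. vmap g (vmap f x),
       hmap = \<lambda>x\<in>dvtx C. \<lambda>y\<in>dvtx C. hmap f x y \<cdot> hmap g (vmap f x) (vmap f y)\<rparr>),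
     Id2 = (\<lambda>C D f. \<lambda>x\<in>dvtx C. dcounit D (vmap f x)),
     VComp = (\<lambda>C D f g h \<beta> \<alpha>. \<lambda>x\<in>dvtx C.
       (\<alpha> x \<boxdot> \<beta> x) \<cdot> dcomul D (vmap f x) (vmap g x) (vmap h x)),
     HComp = (\<lambda>C D E f f' g g' \<alpha> \<beta>. \<lambda>x\<in>dvtx C.
       (\<beta> (vmap f x) \<boxdot> (\<alpha> x \<cdot> hmap g' (vmap f x) (vmap f' x)))
         \<cdot> dcomul E (vmap g (vmap f x)) (vmap g' (vmap f x)) (vmap g' (vmap f' x)))\<rparr>"

end


section \<open>Group graded algebras and coalgebras\<close>

text \<open>
  The multiplication of the grading group is required to be \<^const>\<open>undefined\<close> outside the carrier,
  so that a 0-cell does not depend on irrelevant values of the record; every group has exactly one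
  such representative.
\<close>

definition ext_group :: "'g monoid \<Rightarrow> bool" where
  "ext_group G \<longleftrightarrow> group G \<and> mult G \<in> carrier G \<rightarrow>\<^sub>E carrier G \<rightarrow>\<^sub>E carrier G"

abbreviation ldiv :: "'g monoid \<Rightarrow> 'g \<Rightarrow> 'g \<Rightarrow> 'g" where
  "ldiv G \<sigma> \<tau> \<equiv> inv\<^bsub>G\<^esub> \<sigma> \<otimes>\<^bsub>G\<^esub> \<tau>"

record ('g, 'o, 'a) gralg =
  grp :: "'g monoid"
  gob :: "'g \<Rightarrow> 'o"
  gmul :: "'g \<Rightarrow> 'g \<Rightarrow> 'a"
  gunt :: "'a"

record ('g, 'o, 'a) grcoalg =
  cgrp :: "'g monoid"
  cob :: "'g \<Rightarrow> 'o"
  gcomul :: "'g \<Rightarrow> 'g \<Rightarrow> 'a"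
  gcounit :: "'a"

record ('g, 'a) grfun =
  gmap :: "'g \<Rightarrow> 'g"
  cmap :: "'g \<Rightarrow> 'a"

context
  fixes W :: "('o, 'a, 'm) moncat_scheme" (structure)
begin

definition gralgs :: "('g, 'o, 'a) gralg set" where
  "gralgs = {A. let G = grp A in
     ext_group G \<and>
     gob A \<in> carrier G \<rightarrow>\<^sub>E Obj W \<and>
     gmul A \<in> (\<Pi>\<^sub>E \<sigma>\<in>carrier G. \<Pi>\<^sub>E \<tau>\<in>carrier G.
        Hom W (gob A \<sigma> \<boxtimes> gob A \<tau>) (gob A (\<sigma> \<otimes>\<^bsub>G\<^esub> \<tau>))) \<and>
     gunt A \<in> Hom W \<k> (gob A \<one>\<^bsub>G\<^esub>) \<and>
     (\<forall>\<sigma>\<in>carrier G. \<forall>\<tau>\<in>carrier G. \<forall>\<rho>\<in>carrier G.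
        gmul A (\<sigma> \<otimes>\<^bsub>G\<^esub> \<tau>) \<rho> \<cdot> (gmul A \<sigma> \<tau> \<boxdot> \<i> (gob A \<rho>))
          = gmul A \<sigma> (\<tau> \<otimes>\<^bsub>G\<^esub> \<rho>) \<cdot> (\<i> (gob A \<sigma>) \<boxdot> gmul A \<tau> \<rho>)) \<and>
     (\<forall>\<sigma>\<in>carrier G.
        gmul A \<one>\<^bsub>G\<^esub> \<sigma> \<cdot> (gunt A \<boxdot> \<i> (gob A \<sigma>)) = \<i> (gob A \<sigma>) \<and>
        gmul A \<sigma> \<one>\<^bsub>G\<^esub> \<cdot> (\<i> (gob A \<sigma>) \<boxdot> gunt A) = \<i> (gob A \<sigma>))}"

definition gralg_homs :: "('g, 'o, 'a) gralg \<Rightarrow> ('g, 'o, 'a) gralg \<Rightarrow> ('g, 'a) grfun set" where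
  "gralg_homs A B = {f. let G = grp A; H = grp B in
     gmap f \<in> hom G H \<inter> extensional (carrier G) \<and>
     cmap f \<in> (\<Pi>\<^sub>E \<sigma>\<in>carrier G. Hom W (gob A \<sigma>) (gob B (gmap f \<sigma>))) \<and>
     (\<forall>\<sigma>\<in>carrier G. \<forall>\<tau>\<in>carrier G.
        cmap f (\<sigma> \<otimes>\<^bsub>G\<^esub> \<tau>) \<cdot> gmul A \<sigma> \<tau>
          = gmul B (gmap f \<sigma>) (gmap f \<tau>) \<cdot> (cmap f \<sigma> \<boxdot> cmap f \<tau>)) \<and>
     cmap f \<one>\<^bsub>G\<^esub> \<cdot> gunt A = gunt B}"

definition gralg_trans ::
  "('g, 'o, 'a) gralg \<Rightarrow> ('g, 'o, 'a) gralg \<Rightarrow> ('g, 'a) grfun \<Rightarrow> ('g, 'a) grfun \<Rightarrow> ('g \<Rightarrow> 'a) set"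
  where
  "gralg_trans A B f g = {\<alpha>. let G = grp A; H = grp B in
     \<alpha> \<in> (\<Pi>\<^sub>E \<sigma>\<in>carrier G. Hom W \<k> (gob B (ldiv H (gmap g \<sigma>) (gmap f \<sigma>)))) \<and>
     (\<forall>\<sigma>\<in>carrier G. \<forall>\<tau>\<in>carrier G.
        gmul B (ldiv H (gmap g \<sigma>) (gmap g \<tau>)) (ldiv H (gmap g \<tau>) (gmap f \<tau>))
            \<cdot> (cmap g (ldiv G \<sigma> \<tau>) \<boxdot> \<alpha> \<tau>)
          = gmul B (ldiv H (gmap g \<sigma>) (gmap f \<sigma>)) (ldiv H (gmap f \<sigma>) (gmap f \<tau>))
            \<cdot> (\<alpha> \<sigma> \<boxdot> cmap f (ldiv G \<sigma> \<tau>)))}"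

definition GrAlg :: "(('g, 'o, 'a) gralg, ('g, 'a) grfun, 'g \<Rightarrow> 'a) twocat" where
  "GrAlg = \<lparr>Cell0 = gralgs, Cell1 = gralg_homs, Cell2 = gralg_trans,
     Id1 = (\<lambda>A. \<lparr>gmap = \<lambda>\<sigma>\<in>carrier (grp A). \<sigma>, cmap = \<lambda>\<sigma>\<in>carrier (grp A). \<i> (gob A \<sigma>)\<rparr>),
     Comp1 = (\<lambda>A B C g f. \<lparr>
       gmap = \<lambda>\<sigma>\<in>carrier (grp A). gmap g (gmap f \<sigma>),
       cmap = \<lambda>\<sigma>\<in>carrier (grp A). cmap g (gmap f \<sigma>) \<cdot> cmap f \<sigma>\<rparr>),
     Id2 = (\<lambda>A B f. \<lambda>\<sigma>\<in>carrier (grp A). gunt B),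
     VComp = (\<lambda>A B f g h \<beta> \<alpha>. \<lambda>\<sigma>\<in>carrier (grp A).
       gmul B (ldiv (grp B) (gmap h \<sigma>) (gmap g \<sigma>)) (ldiv (grp B) (gmap g \<sigma>) (gmap f \<sigma>))
         \<cdot> (\<beta> \<sigma> \<boxdot> \<alpha> \<sigma>)),
     HComp = (\<lambda>A B C f f' g g' \<alpha> \<beta>. \<lambda>\<sigma>\<in>carrier (grp A).
       gmul C (ldiv (grp C) (gmap g' (gmap f' \<sigma>)) (gmap g' (gmap f \<sigma>)))
              (ldiv (grp C) (gmap g' (gmap f \<sigma>)) (gmap g (gmap f \<sigma>)))
         \<cdot> ((cmap g' (ldiv (grp B) (gmap f' \<sigma>) (gmap f \<sigma>)) \<cdot> \<alpha> \<sigma>) \<boxdot> \<beta> (gmap f \<sigma>)))\<rparr>"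

definition grcoalgs :: "('g, 'o, 'a) grcoalg set" where
  "grcoalgs = {C. let G = cgrp C in
     ext_group G \<and>
     cob C \<in> carrier G \<rightarrow>\<^sub>E Obj W \<and>
     gcomul C \<in> (\<Pi>\<^sub>E \<sigma>\<in>carrier G. \<Pi>\<^sub>E \<tau>\<in>carrier G.
        Hom W (cob C (\<sigma> \<otimes>\<^bsub>G\<^esub> \<tau>)) (cob C \<sigma> \<boxtimes> cob C \<tau>)) \<and>
     gcounit C \<in> Hom W (cob C \<one>\<^bsub>G\<^esub>) \<k> \<and>
     (\<forall>\<sigma>\<in>carrier G. \<forall>\<tau>\<in>carrier G. \<forall>\<rho>\<in>carrier G.
        (gcomul C \<sigma> \<tau> \<boxdot> \<i> (cob C \<rho>)) \<cdot> gcomul C (\<sigma> \<otimes>\<^bsub>G\<^esub> \<tau>) \<rho>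
          = (\<i> (cob C \<sigma>) \<boxdot> gcomul C \<tau> \<rho>) \<cdot> gcomul C \<sigma> (\<tau> \<otimes>\<^bsub>G\<^esub> \<rho>)) \<and>
     (\<forall>\<sigma>\<in>carrier G.
        (gcounit C \<boxdot> \<i> (cob C \<sigma>)) \<cdot> gcomul C \<one>\<^bsub>G\<^esub> \<sigma> = \<i> (cob C \<sigma>) \<and>
        (\<i> (cob C \<sigma>) \<boxdot> gcounit C) \<cdot> gcomul C \<sigma> \<one>\<^bsub>G\<^esub> = \<i> (cob C \<sigma>))}"

definition grcoalg_homs :: "('g, 'o, 'a) grcoalg \<Rightarrow> ('g, 'o, 'a) grcoalg \<Rightarrow> ('g, 'a) grfun set" where
  "grcoalg_homs C D = {f. let G = cgrp C; H = cgrp D in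
     gmap f \<in> hom G H \<inter> extensional (carrier G) \<and>
     cmap f \<in> (\<Pi>\<^sub>E \<sigma>\<in>carrier G. Hom W (cob D (gmap f \<sigma>)) (cob C \<sigma>)) \<and>
     (\<forall>\<sigma>\<in>carrier G. \<forall>\<tau>\<in>carrier G.
        gcomul C \<sigma> \<tau> \<cdot> cmap f (\<sigma> \<otimes>\<^bsub>G\<^esub> \<tau>)
          = (cmap f \<sigma> \<boxdot> cmap f \<tau>) \<cdot> gcomul D (gmap f \<sigma>) (gmap f \<tau>)) \<and>
     gcounit C \<cdot> cmap f \<one>\<^bsub>G\<^esub> = gcounit D}"

definition grcoalg_trans ::
  "('g, 'o, 'a) grcoalg \<Rightarrow> ('g, 'o, 'a) grcoalg \<Rightarrow> ('g, 'a) grfun \<Rightarrow> ('g, 'a) grfun \<Rightarrow> ('g \<Rightarrow> 'a) set"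
  where
  "grcoalg_trans C D f g = {\<alpha>. let G = cgrp C; H = cgrp D in
     \<alpha> \<in> (\<Pi>\<^sub>E \<sigma>\<in>carrier G. Hom W (cob D (ldiv H (gmap f \<sigma>) (gmap g \<sigma>))) \<k>) \<and>
     (\<forall>\<sigma>\<in>carrier G. \<forall>\<tau>\<in>carrier G.
        (cmap f (ldiv G \<sigma> \<tau>) \<boxdot> \<alpha> \<tau>)
            \<cdot> gcomul D (ldiv H (gmap f \<sigma>) (gmap f \<tau>)) (ldiv H (gmap f \<tau>) (gmap g \<tau>))
          = (\<alpha> \<sigma> \<boxdot> cmap g (ldiv G \<sigma> \<tau>))
            \<cdot> gcomul D (ldiv H (gmap f \<sigma>) (gmap g \<sigma>)) (ldiv H (gmap g \<sigma>) (gmap g \<tau>)))}"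

definition GrCoalg :: "(('g, 'o, 'a) grcoalg, ('g, 'a) grfun, 'g \<Rightarrow> 'a) twocat" where
  "GrCoalg = \<lparr>Cell0 = grcoalgs, Cell1 = grcoalg_homs, Cell2 = grcoalg_trans,
     Id1 = (\<lambda>C. \<lparr>gmap = \<lambda>\<sigma>\<in>carrier (cgrp C). \<sigma>, cmap = \<lambda>\<sigma>\<in>carrier (cgrp C). \<i> (cob C \<sigma>)\<rparr>),
     Comp1 = (\<lambda>C D E g f. \<lparr>
       gmap = \<lambda>\<sigma>\<in>carrier (cgrp C). gmap g (gmap f \<sigma>),
       cmap = \<lambda>\<sigma>\<in>carrier (cgrp C). cmap f \<sigma> \<cdot> cmap g (gmap f \<sigma>)\<rparr>),
     Id2 = (\<lambda>C D f. \<lambda>\<sigma>\<in>carrier (cgrp C). gcounit D),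
     VComp = (\<lambda>C D f g h \<beta> \<alpha>. \<lambda>\<sigma>\<in>carrier (cgrp C).
       (\<alpha> \<sigma> \<boxdot> \<beta> \<sigma>)
         \<cdot> gcomul D (ldiv (cgrp D) (gmap f \<sigma>) (gmap g \<sigma>)) (ldiv (cgrp D) (gmap g \<sigma>) (gmap h \<sigma>))),
     HComp = (\<lambda>C D E f f' g g' \<alpha> \<beta>. \<lambda>\<sigma>\<in>carrier (cgrp C).
       (\<beta> (gmap f \<sigma>) \<boxdot> (\<alpha> \<sigma> \<cdot> cmap g' (ldiv (cgrp D) (gmap f \<sigma>) (gmap f' \<sigma>))))
         \<cdot> gcomul E (ldiv (cgrp E) (gmap g (gmap f \<sigma>)) (gmap g' (gmap f \<sigma>)))
                    (ldiv (cgrp E) (gmap g' (gmap f \<sigma>)) (gmap g' (gmap f' \<sigma>))))\<rparr>"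

end


section \<open>The assignments \<open>K\<close>\<close>

definition K_alg ::
  "(('g, 'o, 'a) gralg, ('g, 'a) grfun, 'g \<Rightarrow> 'a,
    ('g, 'o, 'a) wcat, ('g, 'a) wfun, 'g \<Rightarrow> 'a) twofun" where
  "K_alg = \<lparr>
     Fun0 = (\<lambda>A. let G = grp A in \<lparr>
       vtx = carrier G,
       hob = \<lambda>\<sigma>\<in>carrier G. \<lambda>\<tau>\<in>carrier G. gob A (ldiv G \<sigma> \<tau>),
       mul = \<lambda>\<sigma>\<in>carrier G. \<lambda>\<rho>\<in>carrier G. \<lambda>\<tau>\<in>carrier G. gmul A (ldiv G \<sigma> \<rho>) (ldiv G \<rho> \<tau>),
       unt = \<lambda>\<sigma>\<in>carrier G. gunt A\<rparr>),
     Fun1 = (\<lambda>A B f. let G = grp A in \<lparr>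
       vmap = gmap f,
       hmap = \<lambda>\<sigma>\<in>carrier G. \<lambda>\<tau>\<in>carrier G. cmap f (ldiv G \<sigma> \<tau>)\<rparr>),
     Fun2 = (\<lambda>A B f g \<alpha>. \<alpha>)\<rparr>"

definition K_coalg ::
  "(('g, 'o, 'a) grcoalg, ('g, 'a) grfun, 'g \<Rightarrow> 'a,
    ('g, 'o, 'a) dwcat, ('g, 'a) wfun, 'g \<Rightarrow> 'a) twofun" where
  "K_coalg = \<lparr>
     Fun0 = (\<lambda>C. let G = cgrp C in \<lparr>
       dvtx = carrier G,
       dhob = \<lambda>\<sigma>\<in>carrier G. \<lambda>\<tau>\<in>carrier G. cob C (ldiv G \<sigma> \<tau>),
       dcomul = \<lambda>\<sigma>\<in>carrier G. \<lambda>\<rho>\<in>carrier G. \<lambda>\<tau>\<in>carrier G. gcomul C (ldiv G \<sigma> \<rho>) (ldiv G \<rho> \<tau>),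
       dcounit = \<lambda>\<sigma>\<in>carrier G. gcounit C\<rparr>),
     Fun1 = (\<lambda>C D f. let G = cgrp C in \<lparr>
       vmap = gmap f,
       hmap = \<lambda>\<sigma>\<in>carrier G. \<lambda>\<tau>\<in>carrier G. cmap f (ldiv G \<sigma> \<tau>)\<rparr>),
     Fun2 = (\<lambda>C D f g \<alpha>. \<alpha>)\<rparr>"


section \<open>Hopf structures\<close>

text \<open>The antipodes are morphisms of \<open>V\<close>, not of coalgebras or algebras.\<close>

context
  fixes V :: "('o, 'a, 'm) brmoncat_scheme" (structure)
begin

definition Hopf_group_algebra :: "('g, ('o, 'a) coalg, 'a) gralg \<Rightarrow> bool" where
  "Hopf_group_algebra A \<longleftrightarrow> A \<in> Cell0 (GrAlg (Coalg V)) \<and>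
     (let G = grp A in
      \<exists>S. (\<forall>\<sigma>\<in>carrier G.
        S \<sigma> \<in> Hom V (cca (gob A \<sigma>)) (cca (gob A (inv\<^bsub>G\<^esub> \<sigma>))) \<and>
        gmul A \<sigma> (inv\<^bsub>G\<^esub> \<sigma>) \<cdot> (\<i> (cca (gob A \<sigma>)) \<boxdot> S \<sigma>) \<cdot> cmul (gob A \<sigma>)
          = gunt A \<cdot> ceps (gob A \<sigma>) \<and>
        gmul A (inv\<^bsub>G\<^esub> \<sigma>) \<sigma> \<cdot> (S \<sigma> \<boxdot> \<i> (cca (gob A \<sigma>))) \<cdot> cmul (gob A \<sigma>)
          = gunt A \<cdot> ceps (gob A \<sigma>)))"

definition Hopf_group_coalgebra :: "('g, ('o, 'a) alg, 'a) grcoalg \<Rightarrow> bool" where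
  "Hopf_group_coalgebra C \<longleftrightarrow> C \<in> Cell0 (GrCoalg (Alg V)) \<and>
     (let G = cgrp C in
      \<exists>S. (\<forall>\<sigma>\<in>carrier G.
        S \<sigma> \<in> Hom V (aca (cob C (inv\<^bsub>G\<^esub> \<sigma>))) (aca (cob C \<sigma>)) \<and>
        amul (cob C \<sigma>) \<cdot> (\<i> (aca (cob C \<sigma>)) \<boxdot> S \<sigma>) \<cdot> gcomul C \<sigma> (inv\<^bsub>G\<^esub> \<sigma>)
          = aeta (cob C \<sigma>) \<cdot> gcounit C \<and>
        amul (cob C \<sigma>) \<cdot> (S \<sigma> \<boxdot> \<i> (aca (cob C \<sigma>))) \<cdot> gcomul C (inv\<^bsub>G\<^esub> \<sigma>) \<sigma>
          = aeta (cob C \<sigma>) \<cdot> gcounit C))"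

definition Hopf_category :: "('x, ('o, 'a) coalg, 'a) wcat \<Rightarrow> bool" where
  "Hopf_category A \<longleftrightarrow> A \<in> Cell0 (WCat (Coalg V)) \<and>
     (\<exists>S. \<forall>x\<in>vtx A. \<forall>y\<in>vtx A.
        S x y \<in> Hom V (cca (hob A x y)) (cca (hob A y x)) \<and>
        mul A x y x \<cdot> (\<i> (cca (hob A x y)) \<boxdot> S x y) \<cdot> cmul (hob A x y)
          = unt A x \<cdot> ceps (hob A x y) \<and>
        mul A y x y \<cdot> (S x y \<boxdot> \<i> (cca (hob A x y))) \<cdot> cmul (hob A x y)
          = unt A y \<cdot> ceps (hob A x y))"

definition dual_Hopf_category :: "('x, ('o, 'a) alg, 'a) dwcat \<Rightarrow> bool" where
  "dual_Hopf_category C \<longleftrightarrow> C \<in> Cell0 (DWCat (Alg V)) \<and>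
     (\<exists>S. \<forall>x\<in>dvtx C. \<forall>y\<in>dvtx C.
        S x y \<in> Hom V (aca (dhob C y x)) (aca (dhob C x y)) \<and>
        amul (dhob C x y) \<cdot> (\<i> (aca (dhob C x y)) \<boxdot> S x y) \<cdot> dcomul C x y x
          = aeta (dhob C x y) \<cdot> dcounit C x \<and>
        amul (dhob C y x) \<cdot> (S y x \<boxdot> \<i> (aca (dhob C y x))) \<cdot> dcomul C x y x
          = aeta (dhob C y x) \<cdot> dcounit C x)"

end

end

theory Submission
  imports Defs
begin

text \<open>
  The coalgebra half carries all the computation. \<open>K\<close> is injective on 1-cells with given source and
  target (\<open>f\<^sub>\<sigma>\<close> is the component of \<open>K(f)\<close> at \<open>(e, \<sigma>)\<close>), it is bijective on 2-cells, and it
  preserves all operations. Hence the 2-category axioms of graded algebras are reflected from those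
  of \<open>W\<close>-categories, and group computations are only needed for the cancellation
  \<open>\<sigma>\<^sup>-\<^sup>1\<rho> \<cdot> \<rho>\<^sup>-\<^sup>1\<tau> = \<sigma>\<^sup>-\<^sup>1\<tau>\<close>. The other half follows by duality: algebras in \<open>V\<close> are coalgebras in
  \<open>V\<^sup>o\<^sup>p\<close> with braiding \<open>\<c> B A\<close>, and dual \<open>W\<close>-categories are \<open>W\<^sup>o\<^sup>p\<close>-categories with 2-cells reversed.
  The antipode of the image under \<open>K\<close> is \<open>S\<close> at \<open>\<sigma>\<^sup>-\<^sup>1\<tau>\<close>.
\<close>

section \<open>The 2-category of \<open>W\<close>-categories\<close>

text \<open>The braiding is kept out of the 2-categorical part, which is carried out over an
  arbitrary strict monoidal \<open>W\<close>; it is spent on showing that coalgebras in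
  \<open>V\<close> form such a \<open>W\<close>. K is not full on 1-cells: a left translation of the
  group, with identity components, is a 1-cell from the image of (G,A) to itself, but a group
  morphism only if it translates by the unit. Hence identities and composites of graded 1-cells have
  to be shown to be graded 1-cells again, whereas closure of the 2-cells is inherited, since these
  are the same families on both sides. Duality reverses 2-cells because a component
  \<open>D_{f(x),g(x)} -> \<k>\<close>, read in the opposite category, is a component of a 2-cell
  from g to f.\<close>

lemma wcat_hob: "\<lbrakk>A \<in> wcats W; x \<in> vtx A; y \<in> vtx A\<rbrakk> \<Longrightarrow> hob A x y \<in> Obj W"
  by (auto simp: wcats_def PiE_iff)

lemma wfun_vmap: "\<lbrakk>f \<in> wfuns W A B; x \<in> vtx A\<rbrakk> \<Longrightarrow> vmap f x \<in> vtx B"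
  by (auto simp: wfuns_def PiE_iff)

lemma wfun_hmap:
  "\<lbrakk>f \<in> wfuns W A B; x \<in> vtx A; y \<in> vtx A\<rbrakk> \<Longrightarrow> hmap f x y \<in> Hom W (hob A x y) (hob B (vmap f x) (vmap f y))"
  by (auto simp: wfuns_def PiE_iff)

context strict_monoidal_category
begin

text \<open>Generalized elements \<open>a : P \<rightarrow> A\<^sub>x\<^sub>y\<close> of the hom-objects of a \<open>W\<close>-category multiply by
  \<open>a \<star> b = m \<circ> (a \<otimes> b)\<close>. For this product the axioms of 0-, 1- and 2-cells become
  associativity, multiplicativity and naturality, and no interchange law is needed any more.\<close>

definition elem :: "('x, 'o, 'a) wcat \<Rightarrow> 'o \<Rightarrow> 'x \<Rightarrow> 'x \<Rightarrow> 'a \<Rightarrow> bool" where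
  "elem A P x y a \<longleftrightarrow> A \<in> wcats W \<and> P \<in> Obj W \<and> x \<in> vtx A \<and> y \<in> vtx A \<and> a \<in> Hom W P (hob A x y)"

definition star :: "('x, 'o, 'a) wcat \<Rightarrow> 'x \<Rightarrow> 'x \<Rightarrow> 'x \<Rightarrow> 'a \<Rightarrow> 'a \<Rightarrow> 'a" where
  "star A x y z a b = mul A x y z \<cdot> (a \<boxdot> b)"

lemma mul_hom:
  "\<lbrakk>A \<in> wcats W; x \<in> vtx A; y \<in> vtx A; z \<in> vtx A\<rbrakk>
    \<Longrightarrow> mul A x y z \<in> Hom W (hob A x y \<boxtimes> hob A y z) (hob A x z)"
  by (auto simp: wcats_def PiE_iff)

lemma unt_elem: "\<lbrakk>A \<in> wcats W; x \<in> vtx A\<rbrakk> \<Longrightarrow> elem A \<k> x x (unt A x)"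
  by (auto simp: wcats_def elem_def PiE_iff unit_obj)

lemma star_elem:
  assumes a: "elem A P x y a" and b: "elem A Q y z b"
  shows "elem A (P \<boxtimes> Q) x z (star A x y z a b)"
proof -
  note ab = a[unfolded elem_def] b[unfolded elem_def]
  have "a \<boxdot> b \<in> Hom W (P \<boxtimes> Q) (hob A x y \<boxtimes> hob A y z)"
    using ab by (intro tensor_hom) (auto simp: wcat_hob)
  then have "star A x y z a b \<in> Hom W (P \<boxtimes> Q) (hob A x z)"
    unfolding star_def using ab
    by (intro comp_hom[where B = "hob A x y \<boxtimes> hob A y z"]) (auto simp: wcat_hob mul_hom tensor_obj)
  then show ?thesis using ab by (simp add: elem_def tensor_obj)
qed

text \<open>Strictness gives \<open>\<k> \<boxtimes> \<k> = \<k>\<close>, so products of components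
  of 2-cells can again be components of 2-cells.\<close>

lemma star_elem_unit:
  "\<lbrakk>elem A \<k> x y a; elem A \<k> y z b\<rbrakk> \<Longrightarrow> elem A \<k> x z (star A x y z a b)"
  using star_elem[of A \<k> x y a \<k> z b] by (simp add: unit_obj unit_tensor_obj)

lemma elem_hmap:
  "\<lbrakk>elem A P x y a; B \<in> wcats W; f \<in> wfuns W A B\<rbrakk> \<Longrightarrow> elem B P (vmap f x) (vmap f y) (hmap f x y \<cdot> a)"
  unfolding elem_def
  by (intro conjI comp_hom[where B = "hob A x y"]) (auto simp: wcat_hob wfun_hmap wfun_vmap)

text \<open>A component of a 1-cell is the image of the generic element
  \<open>\<i> (hob A x y)\<close>. Read this way, the naturality condition of 2-cells is an equation
  between two products.\<close>

lemma hmap_elem: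
  "\<lbrakk>A \<in> wcats W; B \<in> wcats W; f \<in> wfuns W A B; x \<in> vtx A; y \<in> vtx A\<rbrakk>
    \<Longrightarrow> elem B (hob A x y) (vmap f x) (vmap f y) (hmap f x y)"
  by (auto simp: elem_def wcat_hob wfun_hmap wfun_vmap)

text \<open>Change of the parameter object. Interchange enters the calculus of \<open>star\<close>
  only here and in \<open>star_assoc\<close>.\<close>

lemma star_comp:
  assumes a: "elem A P x y a" and b: "elem A Q y z b"
    and "P' \<in> Obj W" "Q' \<in> Obj W" "u \<in> Hom W P' P" "v \<in> Hom W Q' Q"
  shows "star A x y z a b \<cdot> (u \<boxdot> v) = star A x y z (a \<cdot> u) (b \<cdot> v)"
proof -
  note ab = a[unfolded elem_def] b[unfolded elem_def] assms(3-)
  have "(a \<cdot> u) \<boxdot> (b \<cdot> v) = (a \<boxdot> b) \<cdot> (u \<boxdot> v)"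
    using ab by (intro interchange[of P' P "hob A x y" Q' Q "hob A y z"]) (auto simp: wcat_hob)
  moreover have "mul A x y z \<cdot> (a \<boxdot> b) \<cdot> (u \<boxdot> v) = mul A x y z \<cdot> ((a \<boxdot> b) \<cdot> (u \<boxdot> v))"
    using ab by (intro comp_assoc[of "P' \<boxtimes> Q'" "P \<boxtimes> Q" "hob A x y \<boxtimes> hob A y z" "hob A x z"])
      (auto simp: wcat_hob tensor_obj intro!: tensor_hom mul_hom)
  ultimately show ?thesis by (simp add: star_def)
qed

text \<open>After an identity is inserted next to the outer factor, interchange factors both sides
  through the triple tensor product of \<open>a\<close>, \<open>b\<close>, \<open>c\<close>, whose
  two bracketings coincide by strictness; what remains is the associativity axiom of
  \<open>A\<close>.\<close>

lemma star_assoc: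
  assumes a: "elem A P x y a" and b: "elem A Q y z b" and c: "elem A R z u c"
  shows "star A x z u (star A x y z a b) c = star A x y u a (star A y z u b c)"
proof -
  note abc = a[unfolded elem_def] b[unfolded elem_def] c[unfolded elem_def]
  let ?X = "hob A x y" and ?Y = "hob A y z" and ?Z = "hob A z u"
  have obs: "?X \<in> Obj W" "?Y \<in> Obj W" "?Z \<in> Obj W" "hob A x z \<in> Obj W" "hob A y u \<in> Obj W"
    "hob A x u \<in> Obj W" "P \<in> Obj W" "Q \<in> Obj W" "R \<in> Obj W"
    using abc by (auto simp: wcat_hob)
  have homs: "a \<in> Hom W P ?X" "b \<in> Hom W Q ?Y" "c \<in> Hom W R ?Z"
    "mul A x y z \<in> Hom W (?X \<boxtimes> ?Y) (hob A x z)" "mul A y z u \<in> Hom W (?Y \<boxtimes> ?Z) (hob A y u)"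
    "mul A x z u \<in> Hom W (hob A x z \<boxtimes> ?Z) (hob A x u)"
    "mul A x y u \<in> Hom W (?X \<boxtimes> hob A y u) (hob A x u)"
    using abc by (auto intro: mul_hom)
  have "star A x z u (star A x y z a b) c
      = mul A x z u \<cdot> ((mul A x y z \<cdot> (a \<boxdot> b)) \<boxdot> (\<i> ?Z \<cdot> c))"
    using obs homs by (simp add: star_def comp_id_left[of R])
  also have "(mul A x y z \<cdot> (a \<boxdot> b)) \<boxdot> (\<i> ?Z \<cdot> c) = (mul A x y z \<boxdot> \<i> ?Z) \<cdot> ((a \<boxdot> b) \<boxdot> c)"
    using obs homs by (intro interchange[of "P \<boxtimes> Q" "?X \<boxtimes> ?Y" "hob A x z" R ?Z ?Z])
      (auto intro: tensor_obj tensor_hom id_hom)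
  also have "(a \<boxdot> b) \<boxdot> c = a \<boxdot> (b \<boxdot> c)"
    using obs homs by (intro tensor_hom_assoc[of P ?X Q ?Y R ?Z])
  also have "mul A x z u \<cdot> ((mul A x y z \<boxdot> \<i> ?Z) \<cdot> (a \<boxdot> (b \<boxdot> c)))
      = mul A x z u \<cdot> (mul A x y z \<boxdot> \<i> ?Z) \<cdot> (a \<boxdot> (b \<boxdot> c))"
    using obs homs tensor_hom[of "?X \<boxtimes> ?Y" "hob A x z" ?Z ?Z "mul A x y z" "\<i> ?Z"]
    by (intro comp_assoc[symmetric, of "P \<boxtimes> (Q \<boxtimes> R)" "?X \<boxtimes> (?Y \<boxtimes> ?Z)" "hob A x z \<boxtimes> ?Z"])
      (auto simp: tensor_obj id_hom tensor_obj_assoc intro!: tensor_hom)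
  also have "mul A x z u \<cdot> (mul A x y z \<boxdot> \<i> ?Z) = mul A x y u \<cdot> (\<i> ?X \<boxdot> mul A y z u)"
    using abc by (auto simp: wcats_def)
  also have "mul A x y u \<cdot> (\<i> ?X \<boxdot> mul A y z u) \<cdot> (a \<boxdot> (b \<boxdot> c))
      = mul A x y u \<cdot> ((\<i> ?X \<boxdot> mul A y z u) \<cdot> (a \<boxdot> (b \<boxdot> c)))"
    using obs homs
    by (intro comp_assoc[of "P \<boxtimes> (Q \<boxtimes> R)" "?X \<boxtimes> (?Y \<boxtimes> ?Z)" "?X \<boxtimes> hob A y u"])
      (auto simp: tensor_obj id_hom intro!: tensor_hom)
  also have "(\<i> ?X \<boxdot> mul A y z u) \<cdot> (a \<boxdot> (b \<boxdot> c)) = (\<i> ?X \<cdot> a) \<boxdot> (mul A y z u \<cdot> (b \<boxdot> c))"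
    using obs homs
    by (intro interchange[symmetric, of P ?X ?X "Q \<boxtimes> R" "?Y \<boxtimes> ?Z" "hob A y u"])
      (auto simp: tensor_obj id_hom intro!: tensor_hom)
  also have "\<i> ?X \<cdot> a = a"
    using obs homs by (simp add: comp_id_left[of P])
  finally show ?thesis by (simp add: star_def)
qed

text \<open>The unit axiom of \<open>A\<close> is the case of the generic element
  \<open>\<i> (hob A x y)\<close>; \<open>star_comp\<close> transports it along
  \<open>\<i> \<k> \<boxdot> a\<close>, which is \<open>a\<close> by strictness.\<close>

lemma star_unt_left:
  assumes a: "elem A P x y a"
  shows "star A x x y (unt A x) a = a"
proof -
  note a' = a[unfolded elem_def]
  have e: "elem A \<k> x x (unt A x)" "elem A (hob A x y) x y (\<i> (hob A x y))"
    using a' unt_elem[of A x] by (auto simp: elem_def id_hom wcat_hob)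
  have "star A x x y (unt A x) a = star A x x y (unt A x \<cdot> \<i> \<k>) (\<i> (hob A x y) \<cdot> a)"
    using a' e by (simp add: elem_def comp_id_right[of \<k> "hob A x x"] comp_id_left[of P] unit_obj wcat_hob)
  also have "\<dots> = star A x x y (unt A x) (\<i> (hob A x y)) \<cdot> (\<i> \<k> \<boxdot> a)"
    using a' by (intro star_comp[OF e, symmetric, where P' = \<k> and Q' = P]) (auto simp: unit_obj id_hom)
  also have "star A x x y (unt A x) (\<i> (hob A x y)) = \<i> (hob A x y)"
    using a' by (auto simp: star_def wcats_def)
  also have "\<i> \<k> \<boxdot> a = a"
    using a' by (auto intro!: unit_tensor_hom[of P "hob A x y"] simp: wcat_hob)
  finally show ?thesis using a' by (simp add: comp_id_left[of P "hob A x y"] wcat_hob)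
qed

lemma star_unt_right:
  assumes a: "elem A P x y a"
  shows "star A x y y a (unt A y) = a"
proof -
  note a' = a[unfolded elem_def]
  have e: "elem A (hob A x y) x y (\<i> (hob A x y))" "elem A \<k> y y (unt A y)"
    using a' unt_elem[of A y] by (auto simp: elem_def id_hom wcat_hob)
  have "star A x y y a (unt A y) = star A x y y (\<i> (hob A x y) \<cdot> a) (unt A y \<cdot> \<i> \<k>)"
    using a' e by (simp add: elem_def comp_id_right[of \<k> "hob A y y"] comp_id_left[of P] unit_obj wcat_hob)
  also have "\<dots> = star A x y y (\<i> (hob A x y)) (unt A y) \<cdot> (a \<boxdot> \<i> \<k>)"
    using a' by (intro star_comp[OF e, symmetric, where P' = P and Q' = \<k>]) (auto simp: unit_obj id_hom)
  also have "star A x y y (\<i> (hob A x y)) (unt A y) = \<i> (hob A x y)"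
    using a' by (auto simp: star_def wcats_def)
  also have "a \<boxdot> \<i> \<k> = a"
    using a' by (auto intro!: tensor_unit_hom[of P "hob A x y"] simp: wcat_hob)
  finally show ?thesis using a' by (simp add: comp_id_left[of P "hob A x y"] wcat_hob)
qed

text \<open>The multiplicativity axiom of a 1-cell is the case where \<open>a\<close> and
  \<open>b\<close> are identities of hom-objects; precomposition with \<open>a \<boxdot> b\<close>
  gives all others.\<close>

lemma hmap_star:
  assumes a: "elem A P x y a" and b: "elem A Q y z b" and B: "B \<in> wcats W" and f: "f \<in> wfuns W A B"
  shows "hmap f x z \<cdot> star A x y z a b
    = star B (vmap f x) (vmap f y) (vmap f z) (hmap f x y \<cdot> a) (hmap f y z \<cdot> b)"
proof -
  note ab = a[unfolded elem_def] b[unfolded elem_def]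
  have el: "elem B (hob A x y) (vmap f x) (vmap f y) (hmap f x y)"
    "elem B (hob A y z) (vmap f y) (vmap f z) (hmap f y z)"
    using ab by (auto intro!: hmap_elem simp: B f)
  have "hmap f x z \<cdot> star A x y z a b = hmap f x z \<cdot> mul A x y z \<cdot> (a \<boxdot> b)"
    unfolding star_def using ab
    by (intro comp_assoc[symmetric, of "P \<boxtimes> Q" "hob A x y \<boxtimes> hob A y z" "hob A x z" "hob B (vmap f x) (vmap f z)"])
      (auto simp: wcat_hob tensor_obj B wfun_hmap[OF f] wfun_vmap[OF f]
        intro: tensor_hom[of P _ Q] mul_hom)
  also have "hmap f x z \<cdot> mul A x y z
      = star B (vmap f x) (vmap f y) (vmap f z) (hmap f x y) (hmap f y z)"
    using ab f by (auto simp: wfuns_def star_def)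
  also have "\<dots> \<cdot> (a \<boxdot> b)
      = star B (vmap f x) (vmap f y) (vmap f z) (hmap f x y \<cdot> a) (hmap f y z \<cdot> b)"
    using ab by (intro star_comp[OF el, where P' = P and Q' = Q]) auto
  finally show ?thesis .
qed

lemma wtrans_elem:
  "\<lbrakk>\<alpha> \<in> wtrans W A B f g; B \<in> wcats W; f \<in> wfuns W A B; g \<in> wfuns W A B; x \<in> vtx A\<rbrakk>
    \<Longrightarrow> elem B \<k> (vmap g x) (vmap f x) (\<alpha> x)"
  by (auto simp: wtrans_def elem_def unit_obj wfun_vmap PiE_iff)

lemma wtrans_star_hmap:
  "\<lbrakk>\<alpha> \<in> wtrans W A B f g; x \<in> vtx A; y \<in> vtx A\<rbrakk>
    \<Longrightarrow> star B (vmap g x) (vmap g y) (vmap f y) (hmap g x y) (\<alpha> y)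
      = star B (vmap g x) (vmap f x) (vmap f y) (\<alpha> x) (hmap f x y)"
  by (auto simp: wtrans_def star_def)

lemma wtransI:
  assumes "\<alpha> \<in> extensional (vtx A)"
    and "\<And>x. x \<in> vtx A \<Longrightarrow> elem B \<k> (vmap g x) (vmap f x) (\<alpha> x)"
    and "\<And>x y. \<lbrakk>x \<in> vtx A; y \<in> vtx A\<rbrakk>
      \<Longrightarrow> star B (vmap g x) (vmap g y) (vmap f y) (hmap g x y) (\<alpha> y)
        = star B (vmap g x) (vmap f x) (vmap f y) (\<alpha> x) (hmap f x y)"
  shows "\<alpha> \<in> wtrans W A B f g"
  using assms by (auto simp: wtrans_def elem_def star_def PiE_iff)

text \<open>\<open>wtrans_star_hmap\<close> is naturality at the generic element, and precomposition
  with \<open>a\<close> extends it to every element. The two sides acquire the factors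
  \<open>a \<boxdot> \<i> \<k>\<close> and \<open>\<i> \<k> \<boxdot> a\<close>, which strictness
  identifies; no braiding is involved in moving \<open>a\<close> past \<alpha>.\<close>

lemma wtrans_star:
  assumes \<alpha>: "\<alpha> \<in> wtrans W A B f g" and f: "f \<in> wfuns W A B" and g: "g \<in> wfuns W A B"
    and B: "B \<in> wcats W" and a: "elem A P x y a"
  shows "star B (vmap g x) (vmap g y) (vmap f y) (hmap g x y \<cdot> a) (\<alpha> y)
    = star B (vmap g x) (vmap f x) (vmap f y) (\<alpha> x) (hmap f x y \<cdot> a)"
proof -
  note a' = a[unfolded elem_def]
  have xy: "x \<in> vtx A" "y \<in> vtx A" using a' by auto
  note el = wtrans_elem[OF \<alpha> B f g]
  have k: "\<alpha> z \<cdot> \<i> \<k> = \<alpha> z" if "z \<in> vtx A" for z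
    using el[OF that] comp_id_right[of \<k> "hob B (vmap g z) (vmap f z)" "\<alpha> z"]
    by (auto simp: elem_def wcat_hob)
  have "star B (vmap g x) (vmap g y) (vmap f y) (hmap g x y \<cdot> a) (\<alpha> y)
      = star B (vmap g x) (vmap g y) (vmap f y) (hmap g x y) (\<alpha> y) \<cdot> (a \<boxdot> \<i> \<k>)"
    using a' k[OF xy(2)] star_comp[OF hmap_elem[OF _ B g xy] el[OF xy(2)], of P \<k> a "\<i> \<k>"]
    by (simp add: unit_obj id_hom)
  also have "a \<boxdot> \<i> \<k> = \<i> \<k> \<boxdot> a"
    using a' tensor_unit_hom[of P "hob A x y" a] unit_tensor_hom[of P "hob A x y" a]
    by (simp add: wcat_hob)
  also have "star B (vmap g x) (vmap g y) (vmap f y) (hmap g x y) (\<alpha> y)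
      = star B (vmap g x) (vmap f x) (vmap f y) (\<alpha> x) (hmap f x y)"
    using wtrans_star_hmap[OF \<alpha> xy] .
  also have "\<dots> \<cdot> (\<i> \<k> \<boxdot> a) = star B (vmap g x) (vmap f x) (vmap f y) (\<alpha> x) (hmap f x y \<cdot> a)"
    using a' k[OF xy(1)] star_comp[OF el[OF xy(1)] hmap_elem[OF _ B f xy], of \<k> P "\<i> \<k>" a]
    by (simp add: unit_obj id_hom)
  finally show ?thesis .
qed

section \<open>Identities and composites of 1-cells and 2-cells\<close>

lemma WCat_id1:
  assumes A: "A \<in> wcats W"
  shows "Id1 (WCat W) A \<in> wfuns W A A"
proof -
  have "\<i> (hob A x z) \<cdot> mul A x y z = mul A x y z \<cdot> (\<i> (hob A x y) \<boxdot> \<i> (hob A y z))"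
    if "x \<in> vtx A" "y \<in> vtx A" "z \<in> vtx A" for x y z
    using that mul_hom[OF A that] wcat_hob[OF A]
    by (simp add: tensor_id comp_id_left[of "hob A x y \<boxtimes> hob A y z"] comp_id_right[of _ "hob A x z"] tensor_obj)
  moreover have "\<i> (hob A x x) \<cdot> unt A x = unt A x" if "x \<in> vtx A" for x
    using unt_elem[OF A that] wcat_hob[OF A]
    by (auto simp: elem_def intro!: comp_id_left[of \<k>])
  ultimately show ?thesis
    using wcat_hob[OF A] by (auto simp: WCat_def wfuns_def id_hom)
qed

lemma WCat_comp1:
  assumes A: "A \<in> wcats W" and B: "B \<in> wcats W" and C: "C \<in> wcats W"
    and f: "f \<in> wfuns W A B" and g: "g \<in> wfuns W B C"
  shows "Comp1 (WCat W) A B C g f \<in> wfuns W A C"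
proof -
  let ?h = "\<lambda>x y. hmap g (vmap f x) (vmap f y) \<cdot> hmap f x y"
  have h: "?h x y \<in> Hom W (hob A x y) (hob C (vmap g (vmap f x)) (vmap g (vmap f y)))"
    if "x \<in> vtx A" "y \<in> vtx A" for x y
    using elem_hmap[OF hmap_elem[OF A B f that] C g] by (simp add: elem_def)
  have 1: "?h x z \<cdot> mul A x y z
      = star C (vmap g (vmap f x)) (vmap g (vmap f y)) (vmap g (vmap f z)) (?h x y) (?h y z)"
    if xyz: "x \<in> vtx A" "y \<in> vtx A" "z \<in> vtx A" for x y z
  proof -
    have "?h x z \<cdot> mul A x y z = hmap g (vmap f x) (vmap f z) \<cdot> (hmap f x z \<cdot> mul A x y z)"
      using xyz
      by (intro comp_assoc[of "hob A x y \<boxtimes> hob A y z" "hob A x z" "hob B (vmap f x) (vmap f z)"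
            "hob C (vmap g (vmap f x)) (vmap g (vmap f z))"])
        (auto simp: tensor_obj wcat_hob A B C wfun_vmap[OF f] wfun_vmap[OF g] wfun_hmap[OF f]
          wfun_hmap[OF g] mul_hom)
    also have "hmap f x z \<cdot> mul A x y z
        = star B (vmap f x) (vmap f y) (vmap f z) (hmap f x y) (hmap f y z)"
      using f xyz by (auto simp: wfuns_def star_def)
    also have "hmap g (vmap f x) (vmap f z) \<cdot> \<dots>
        = star C (vmap g (vmap f x)) (vmap g (vmap f y)) (vmap g (vmap f z)) (?h x y) (?h y z)"
      using xyz by (intro hmap_star[OF _ _ C g]) (auto intro: hmap_elem[OF A B f])
    finally show ?thesis .
  qed
  have 2: "?h x x \<cdot> unt A x = unt C (vmap g (vmap f x))" if x: "x \<in> vtx A" for x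
  proof -
    have "?h x x \<cdot> unt A x = hmap g (vmap f x) (vmap f x) \<cdot> (hmap f x x \<cdot> unt A x)"
      using x unt_elem[OF A x]
      by (intro comp_assoc[of \<k> "hob A x x" "hob B (vmap f x) (vmap f x)"
            "hob C (vmap g (vmap f x)) (vmap g (vmap f x))"])
        (auto simp: elem_def wcat_hob A B C wfun_vmap[OF f] wfun_vmap[OF g] wfun_hmap[OF f]
          wfun_hmap[OF g])
    also have "\<dots> = unt C (vmap g (vmap f x))"
      using x f g wfun_vmap[OF f x] by (simp add: wfuns_def)
    finally show ?thesis .
  qed
  show ?thesis
    using h 1 2 by (auto simp: WCat_def wfuns_def star_def PiE_iff wfun_vmap[OF f] wfun_vmap[OF g])
qed

text \<open>In juxtaposition for \<open>star\<close>, the chain is h(\<beta>\<alpha>) =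
  (h\<beta>)\<alpha> = (\<beta>g)\<alpha> = \<beta>(g\<alpha>) = \<beta>(\<alpha>f) =
  (\<beta>\<alpha>)f.\<close>

lemma WCat_vcomp_cell:
  assumes "A \<in> wcats W" "B \<in> wcats W"
    and "f \<in> wfuns W A B" "g \<in> wfuns W A B" "h \<in> wfuns W A B"
    and \<alpha>: "\<alpha> \<in> wtrans W A B f g" and \<beta>: "\<beta> \<in> wtrans W A B g h"
  shows "VComp (WCat W) A B f g h \<beta> \<alpha> \<in> wtrans W A B f h"
proof (rule wtransI)
  let ?\<gamma> = "VComp (WCat W) A B f g h \<beta> \<alpha>"
  have \<gamma>: "?\<gamma> x = star B (vmap h x) (vmap g x) (vmap f x) (\<beta> x) (\<alpha> x)" if "x \<in> vtx A" for x
    using that by (simp add: WCat_def star_def)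
  note el = wtrans_elem[OF \<alpha> assms(2,3,4)] wtrans_elem[OF \<beta> assms(2,4,5)]
  note hel = hmap_elem[OF assms(1,2)]
  show "?\<gamma> \<in> extensional (vtx A)" by (simp add: WCat_def)
  show "elem B \<k> (vmap h x) (vmap f x) (?\<gamma> x)" if "x \<in> vtx A" for x
    using that by (simp add: \<gamma> star_elem_unit[OF el(2,1)])
  show "star B (vmap h x) (vmap h y) (vmap f y) (hmap h x y) (?\<gamma> y)
      = star B (vmap h x) (vmap f x) (vmap f y) (?\<gamma> x) (hmap f x y)"
    if xy: "x \<in> vtx A" "y \<in> vtx A" for x y
    using wtrans_star_hmap[OF \<alpha> xy] wtrans_star_hmap[OF \<beta> xy] xy
      star_assoc[OF hel[OF assms(5) xy] el(2)[OF xy(2)] el(1)[OF xy(2)]]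
      star_assoc[OF el(2)[OF xy(1)] hel[OF assms(4) xy] el(1)[OF xy(2)]]
      star_assoc[OF el(2)[OF xy(1)] el(1)[OF xy(1)] hel[OF assms(3) xy]]
    by (simp add: \<gamma>)
qed

lemma WCat_hcomp:
  "x \<in> vtx A \<Longrightarrow> HComp (WCat W) A B C f f' g g' \<alpha> \<beta> x
    = star C (vmap g' (vmap f' x)) (vmap g' (vmap f x)) (vmap g (vmap f x))
        (hmap g' (vmap f' x) (vmap f x) \<cdot> \<alpha> x) (\<beta> (vmap f x))"
  by (simp add: WCat_def star_def)

text \<open>Naturality of \<alpha> is pushed through \<open>g'\<close> by \<open>hmap_star\<close>;
  then \<beta> is moved past the image of \<open>hmap f x y\<close> by naturality at that element,
  which replaces \<open>g'\<close> by \<open>g\<close>. The rest is reassociation.\<close>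

lemma WCat_hcomp_cell:
  assumes A: "A \<in> wcats W" and B: "B \<in> wcats W" and C: "C \<in> wcats W"
    and f: "f \<in> wfuns W A B" and f': "f' \<in> wfuns W A B"
    and g: "g \<in> wfuns W B C" and g': "g' \<in> wfuns W B C"
    and \<alpha>: "\<alpha> \<in> wtrans W A B f f'" and \<beta>: "\<beta> \<in> wtrans W B C g g'"
  shows "HComp (WCat W) A B C f f' g g' \<alpha> \<beta>
    \<in> wtrans W A C (Comp1 (WCat W) A B C g f) (Comp1 (WCat W) A B C g' f')"
proof (rule wtransI)
  let ?\<gamma> = "HComp (WCat W) A B C f f' g g' \<alpha> \<beta>"
  let ?p = "Comp1 (WCat W) A B C g f" and ?q = "Comp1 (WCat W) A B C g' f'"
  have pq: "vmap ?p x = vmap g (vmap f x)" "vmap ?q x = vmap g' (vmap f' x)" if "x \<in> vtx A" for x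
    using that by (auto simp: WCat_def)
  have pq': "hmap ?p x y = hmap g (vmap f x) (vmap f y) \<cdot> hmap f x y"
    "hmap ?q x y = hmap g' (vmap f' x) (vmap f' y) \<cdot> hmap f' x y" if "x \<in> vtx A" "y \<in> vtx A" for x y
    using that by (auto simp: WCat_def)
  note v = wfun_vmap[OF f] wfun_vmap[OF f']
  note ae = wtrans_elem[OF \<alpha> B f f'] and be = wtrans_elem[OF \<beta> C g g', OF v(1)]
  note gae = elem_hmap[OF ae C g']
  show "?\<gamma> \<in> extensional (vtx A)" by (simp add: WCat_def)
  show "elem C \<k> (vmap ?q x) (vmap ?p x) (?\<gamma> x)" if "x \<in> vtx A" for x
    using that star_elem_unit[OF gae be] by (simp add: WCat_hcomp pq)
  show "star C (vmap ?q x) (vmap ?q y) (vmap ?p y) (hmap ?q x y) (?\<gamma> y)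
      = star C (vmap ?q x) (vmap ?p x) (vmap ?p y) (?\<gamma> x) (hmap ?p x y)"
    if x: "x \<in> vtx A" and y: "y \<in> vtx A" for x y
    using star_assoc[OF elem_hmap[OF hmap_elem[OF A B f' x y] C g'] gae[OF y] be[OF y]]
      hmap_star[OF hmap_elem[OF A B f' x y] ae[OF y] C g']
      wtrans_star_hmap[OF \<alpha> x y]
      hmap_star[OF ae[OF x] hmap_elem[OF A B f x y] C g']
      star_assoc[OF gae[OF x] elem_hmap[OF hmap_elem[OF A B f x y] C g'] be[OF y]]
      wtrans_star[OF \<beta> g g' C hmap_elem[OF A B f x y]]
      star_assoc[OF gae[OF x] be[OF x] elem_hmap[OF hmap_elem[OF A B f x y] C g]]
    by (simp add: WCat_hcomp pq pq' x y)
qed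

section \<open>The 2-category axioms, checked vertex by vertex\<close>

lemma wfun_eqI:
  fixes f g :: "('x, 'a) wfun"
  assumes "f \<in> wfuns W A B" "g \<in> wfuns W A B"
    and "\<And>x. x \<in> vtx A \<Longrightarrow> vmap f x = vmap g x"
    and "\<And>x y. \<lbrakk>x \<in> vtx A; y \<in> vtx A\<rbrakk> \<Longrightarrow> hmap f x y = hmap g x y"
  shows "f = g"
proof -
  have "vmap f = vmap g"
    using assms(1-3) by (intro extensionalityI[of _ "vtx A"]) (auto simp: wfuns_def PiE_iff)
  moreover have "hmap f = hmap g"
  proof (rule extensionalityI[of _ "vtx A"])
    show "hmap f x = hmap g x" if x: "x \<in> vtx A" for x
      using assms(1,2,4) x
      by (intro extensionalityI[of _ "vtx A"]) (auto simp: wfuns_def PiE_iff)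
  qed (use assms(1,2) in \<open>auto simp: wfuns_def PiE_iff\<close>)
  ultimately show ?thesis by simp
qed

lemma wtrans_ext: "\<alpha> \<in> wtrans W A B f g \<Longrightarrow> \<alpha> \<in> extensional (vtx A)"
  by (auto simp: wtrans_def PiE_iff)

theorem two_category_WCat: "two_category (WCat W :: (('x, 'o, 'a) wcat, _, _) twocat)"
proof -
  let ?X = "WCat W :: (('x, 'o, 'a) wcat, _, _) twocat"
  have cells [simp]: "Cell0 ?X = wcats W" "Cell1 ?X = wfuns W" "Cell2 ?X = wtrans W"
    by (auto simp: WCat_def)
  have id1 [simp]: "vmap (Id1 ?X A) x = x" if "x \<in> vtx A" for A :: "('x, 'o, 'a) wcat" and x
    using that by (simp add: WCat_def)
  have id1h [simp]: "hmap (Id1 ?X A) x y = \<i> (hob A x y)" if "x \<in> vtx A" "y \<in> vtx A" for A :: "('x, 'o, 'a) wcat" and x y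
    using that by (simp add: WCat_def)
  have c1 [simp]: "vmap (Comp1 ?X A B C g f) x = vmap g (vmap f x)" if "x \<in> vtx A" for A B C :: "('x, 'o, 'a) wcat" and f g x
    using that by (simp add: WCat_def)
  have c1h [simp]: "hmap (Comp1 ?X A B C g f) x y = hmap g (vmap f x) (vmap f y) \<cdot> hmap f x y"
    if "x \<in> vtx A" "y \<in> vtx A" for A B C :: "('x, 'o, 'a) wcat" and f g x y
    using that by (simp add: WCat_def)
  have i2 [simp]: "Id2 ?X A B f x = unt B (vmap f x)" if "x \<in> vtx A" for A B :: "('x, 'o, 'a) wcat" and f x
    using that by (simp add: WCat_def)
  have vc [simp]: "VComp ?X A B f g h \<beta> \<alpha> x = star B (vmap h x) (vmap g x) (vmap f x) (\<beta> x) (\<alpha> x)"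
    if "x \<in> vtx A" for A B :: "('x, 'o, 'a) wcat" and f g h \<beta> \<alpha> x
    using that by (simp add: WCat_def star_def)
  have ext: "Id2 ?X A B f \<in> extensional (vtx A)" "VComp ?X A B f g h \<beta> \<alpha> \<in> extensional (vtx A)"
    "HComp ?X A B C f f' k k' \<alpha> \<beta>' \<in> extensional (vtx A)" for A B C :: "('x, 'o, 'a) wcat" and f f' g h k k' \<alpha> \<beta> \<beta>'
    by (auto simp: WCat_def)
  have idl: "\<i> (hob B (vmap f x) (vmap f y)) \<cdot> hmap f x y = hmap f x y"
    and idr: "hmap f x y \<cdot> \<i> (hob A x y) = hmap f x y"
    if "A \<in> wcats W" "B \<in> wcats W" "f \<in> wfuns W A B" "x \<in> vtx A" "y \<in> vtx A"
    for f :: "('x, 'a) wfun" and A B x y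
    using that wfun_hmap[OF that(3-5)] wfun_vmap[OF that(3)]
    by (auto intro!: comp_id_left[of "hob A x y"] comp_id_right[of _ "hob B (vmap f x) (vmap f y)"] wcat_hob)
  have hassoc: "(hmap h (vmap g x) (vmap g y) \<cdot> hmap g x y) \<cdot> a = hmap h (vmap g x) (vmap g y) \<cdot> (hmap g x y \<cdot> a)"
    if C: "C \<in> wcats W" and D: "D \<in> wcats W" and g: "g \<in> wfuns W B C" and h: "h \<in> wfuns W C D"
      and a: "elem B P x y a"
    for g h :: "('x, 'a) wfun" and B C D P x y a
    using a wfun_hmap[OF h]
    by (intro comp_assoc[of P "hob B x y" "hob C (vmap g x) (vmap g y)"
          "hob D (vmap h (vmap g x)) (vmap h (vmap g y))"])
      (auto simp: elem_def C D wcat_hob wfun_vmap[OF g] wfun_vmap[OF h] wfun_hmap[OF g])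
  show ?thesis
  proof (unfold_locales, unfold cells)
    fix A :: "('x, 'o, 'a) wcat" assume "A \<in> wcats W"
    then show "Id1 ?X A \<in> wfuns W A A" by (rule WCat_id1)
  next
    fix A B C :: "('x, 'o, 'a) wcat" and f g assume "A \<in> wcats W" "B \<in> wcats W" "C \<in> wcats W" "f \<in> wfuns W A B" "g \<in> wfuns W B C"
    then show "Comp1 ?X A B C g f \<in> wfuns W A C" by (rule WCat_comp1)
  next
    fix A B :: "('x, 'o, 'a) wcat" and f assume a: "A \<in> wcats W" "B \<in> wcats W" "f \<in> wfuns W A B"
    note v = wfun_vmap[OF a(3)]
    show "Comp1 ?X A B B (Id1 ?X B) f = f"
      using a v idl by (intro wfun_eqI[of _ A B]) (auto intro!: WCat_comp1 WCat_id1)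
    show "Comp1 ?X A A B f (Id1 ?X A) = f"
      using a v idr by (intro wfun_eqI[of _ A B]) (auto intro!: WCat_comp1 WCat_id1)
    show "Id2 ?X A B f \<in> wtrans W A B f f"
      using a v
      by (intro wtransI)
        (auto simp: ext unt_elem star_unt_left[OF hmap_elem] star_unt_right[OF hmap_elem])
  next
    fix A B C D :: "('x, 'o, 'a) wcat" and f g h
    assume a: "A \<in> wcats W" "B \<in> wcats W" "C \<in> wcats W" "D \<in> wcats W"
      "f \<in> wfuns W A B" "g \<in> wfuns W B C" "h \<in> wfuns W C D"
    note v = wfun_vmap[OF a(5)] wfun_vmap[OF a(6)] wfun_vmap[OF a(7)]
    show "Comp1 ?X A B D (Comp1 ?X B C D h g) f = Comp1 ?X A C D h (Comp1 ?X A B C g f)"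
      using a v
      by (intro wfun_eqI[of _ A D]) (auto intro: WCat_comp1 hassoc hmap_elem)
  next
    fix A B :: "('x, 'o, 'a) wcat" and f g h \<alpha> \<beta>
    assume a: "A \<in> wcats W" "B \<in> wcats W" "f \<in> wfuns W A B" "g \<in> wfuns W A B" "h \<in> wfuns W A B"
      "\<alpha> \<in> wtrans W A B f g" "\<beta> \<in> wtrans W A B g h"
    then show "VComp ?X A B f g h \<beta> \<alpha> \<in> wtrans W A B f h" by (rule WCat_vcomp_cell)
  next
    fix A B :: "('x, 'o, 'a) wcat" and f g \<alpha>
    assume a: "A \<in> wcats W" "B \<in> wcats W" "f \<in> wfuns W A B" "g \<in> wfuns W A B"
      and \<alpha>: "\<alpha> \<in> wtrans W A B f g"
    note el = wtrans_elem[OF \<alpha> a(2-4)]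
    show "VComp ?X A B f g g (Id2 ?X A B g) \<alpha> = \<alpha>"
      using star_unt_left[OF el]
      by (intro extensionalityI[OF ext(2) wtrans_ext[OF \<alpha>]]) simp
    show "VComp ?X A B f f g \<alpha> (Id2 ?X A B f) = \<alpha>"
      using star_unt_right[OF el]
      by (intro extensionalityI[OF ext(2) wtrans_ext[OF \<alpha>]]) simp
    have "HComp ?X A A B (Id1 ?X A) (Id1 ?X A) f g (Id2 ?X A A (Id1 ?X A)) \<alpha> x = \<alpha> x" if x: "x \<in> vtx A" for x
    proof -
      have "hmap g x x \<cdot> unt A x = unt B (vmap g x)" using x a(4) by (simp add: wfuns_def)
      then show ?thesis using x star_unt_left[OF el[OF x]] by (simp add: WCat_hcomp)
    qed
    then show "HComp ?X A A B (Id1 ?X A) (Id1 ?X A) f g (Id2 ?X A A (Id1 ?X A)) \<alpha> = \<alpha>"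
      by (intro extensionalityI[OF ext(3) wtrans_ext[OF \<alpha>]])
    have "HComp ?X A B B f g (Id1 ?X B) (Id1 ?X B) \<alpha> (Id2 ?X B B (Id1 ?X B)) x = \<alpha> x" if x: "x \<in> vtx A" for x
    proof -
      note v = wfun_vmap[OF a(3) x] wfun_vmap[OF a(4) x]
      have "\<i> (hob B (vmap g x) (vmap f x)) \<cdot> \<alpha> x = \<alpha> x"
        using el[OF x] by (auto simp: elem_def intro!: comp_id_left[of \<k>] wcat_hob)
      then show ?thesis using x v star_unt_right[OF el[OF x]] by (simp add: WCat_hcomp)
    qed
    then show "HComp ?X A B B f g (Id1 ?X B) (Id1 ?X B) \<alpha> (Id2 ?X B B (Id1 ?X B)) = \<alpha>"
      by (intro extensionalityI[OF ext(3) wtrans_ext[OF \<alpha>]])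
  next
    fix A B :: "('x, 'o, 'a) wcat" and f g h i \<alpha> \<beta> \<gamma>
    assume a: "A \<in> wcats W" "B \<in> wcats W" "f \<in> wfuns W A B" "g \<in> wfuns W A B" "h \<in> wfuns W A B"
      "i \<in> wfuns W A B" "\<alpha> \<in> wtrans W A B f g" "\<beta> \<in> wtrans W A B g h" "\<gamma> \<in> wtrans W A B h i"
    show "VComp ?X A B f g i (VComp ?X A B g h i \<gamma> \<beta>) \<alpha> = VComp ?X A B f h i \<gamma> (VComp ?X A B f g h \<beta> \<alpha>)"
      using star_assoc[OF wtrans_elem[OF a(9,2,5,6)] wtrans_elem[OF a(8,2,4,5)] wtrans_elem[OF a(7,2,3,4)]]
      by (intro extensionalityI[OF ext(2) ext(2)]) simp
  next
    fix A B C :: "('x, 'o, 'a) wcat" and f f' g g' \<alpha> \<beta>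
    assume "A \<in> wcats W" "B \<in> wcats W" "C \<in> wcats W"
      "f \<in> wfuns W A B" "f' \<in> wfuns W A B" "g \<in> wfuns W B C" "g' \<in> wfuns W B C"
      "\<alpha> \<in> wtrans W A B f f'" "\<beta> \<in> wtrans W B C g g'"
    then show "HComp ?X A B C f f' g g' \<alpha> \<beta> \<in> wtrans W A C (Comp1 ?X A B C g f) (Comp1 ?X A B C g' f')"
      by (rule WCat_hcomp_cell)
  next
    fix A B C D :: "('x, 'o, 'a) wcat" and f f' g g' h h' \<alpha> \<beta> \<gamma>
    assume a: "A \<in> wcats W" "B \<in> wcats W" "C \<in> wcats W" "D \<in> wcats W"
      and f: "f \<in> wfuns W A B" "f' \<in> wfuns W A B" and g: "g \<in> wfuns W B C" "g' \<in> wfuns W B C"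
      and h: "h \<in> wfuns W C D" "h' \<in> wfuns W C D"
      and \<alpha>: "\<alpha> \<in> wtrans W A B f f'" and \<beta>: "\<beta> \<in> wtrans W B C g g'" and \<gamma>: "\<gamma> \<in> wtrans W C D h h'"
    show "HComp ?X A C D (Comp1 ?X A B C g f) (Comp1 ?X A B C g' f') h h' (HComp ?X A B C f f' g g' \<alpha> \<beta>) \<gamma>
      = HComp ?X A B D f f' (Comp1 ?X B C D h g) (Comp1 ?X B C D h' g') \<alpha> (HComp ?X B C D g g' h h' \<beta> \<gamma>)"
    proof (rule extensionalityI[OF ext(3) ext(3)])
      fix x assume x: "x \<in> vtx A"
      note v = wfun_vmap[OF f(1) x] wfun_vmap[OF f(2) x]
      note ae = wtrans_elem[OF \<alpha> a(2) f x] and be = wtrans_elem[OF \<beta> a(3) g v(1)]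
      note ce = wtrans_elem[OF \<gamma> a(4) h wfun_vmap[OF g(1) v(1)]]
      note gae = elem_hmap[OF ae a(3) g(2)]
      \<comment> \<open>Both sides are the product of h'(g'(\<alpha>)), h'(\<beta>) and \<gamma>,
        with different brackets: \<open>hmap_star\<close> distributes \<open>h'\<close> over the
        inner horizontal composite.\<close>
      show "HComp ?X A C D (Comp1 ?X A B C g f) (Comp1 ?X A B C g' f') h h' (HComp ?X A B C f f' g g' \<alpha> \<beta>) \<gamma> x
        = HComp ?X A B D f f' (Comp1 ?X B C D h g) (Comp1 ?X B C D h' g') \<alpha> (HComp ?X B C D g g' h h' \<beta> \<gamma>) x"
        using x v hmap_star[OF gae be a(4) h(2)] hassoc[OF a(3,4) g(2) h(2) ae]
          star_assoc[OF elem_hmap[OF gae a(4) h(2)] elem_hmap[OF be a(4) h(2)] ce]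
        by (simp add: WCat_hcomp)
    qed
  next
    fix A B C :: "('x, 'o, 'a) wcat" and f g
    assume a: "A \<in> wcats W" "B \<in> wcats W" "C \<in> wcats W" and f: "f \<in> wfuns W A B" and g: "g \<in> wfuns W B C"
    show "HComp ?X A B C f f g g (Id2 ?X A B f) (Id2 ?X B C g) = Id2 ?X A C (Comp1 ?X A B C g f)"
    proof (rule extensionalityI[OF ext(3) ext(1)])
      fix x assume x: "x \<in> vtx A"
      note v = wfun_vmap[OF f x]
      have "hmap g (vmap f x) (vmap f x) \<cdot> unt B (vmap f x) = unt C (vmap g (vmap f x))"
        using g v by (simp add: wfuns_def)
      then show "HComp ?X A B C f f g g (Id2 ?X A B f) (Id2 ?X B C g) x = Id2 ?X A C (Comp1 ?X A B C g f) x"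
        using x v star_unt_left[OF unt_elem[OF a(3) wfun_vmap[OF g v]]] by (simp add: WCat_hcomp)
    qed
  next
    fix A B C :: "('x, 'o, 'a) wcat" and f f' f'' g g' g'' \<alpha> \<alpha>' \<beta> \<beta>'
    assume a: "A \<in> wcats W" "B \<in> wcats W" "C \<in> wcats W"
      and f: "f \<in> wfuns W A B" "f' \<in> wfuns W A B" "f'' \<in> wfuns W A B"
      and g: "g \<in> wfuns W B C" "g' \<in> wfuns W B C" "g'' \<in> wfuns W B C"
      and \<alpha>: "\<alpha> \<in> wtrans W A B f f'" and \<alpha>': "\<alpha>' \<in> wtrans W A B f' f''"
      and \<beta>: "\<beta> \<in> wtrans W B C g g'" and \<beta>': "\<beta>' \<in> wtrans W B C g' g''"
    show "HComp ?X A B C f f'' g g'' (VComp ?X A B f f' f'' \<alpha>' \<alpha>) (VComp ?X B C g g' g'' \<beta>' \<beta>)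
      = VComp ?X A C (Comp1 ?X A B C g f) (Comp1 ?X A B C g' f') (Comp1 ?X A B C g'' f'')
          (HComp ?X A B C f' f'' g' g'' \<alpha>' \<beta>') (HComp ?X A B C f f' g g' \<alpha> \<beta>)"
    proof (rule extensionalityI[OF ext(3) ext(2)])
      fix x assume x: "x \<in> vtx A"
      note v = wfun_vmap[OF f(1) x] wfun_vmap[OF f(2) x] wfun_vmap[OF f(3) x]
      note ae = wtrans_elem[OF \<alpha> a(2) f(1,2) x] and ae' = wtrans_elem[OF \<alpha>' a(2) f(2,3) x]
      note be = wtrans_elem[OF \<beta> a(3) g(1,2)] and be' = wtrans_elem[OF \<beta>' a(3) g(2,3)]
      note gae' = elem_hmap[OF ae' a(3) g(3)] and gae = elem_hmap[OF ae a(3) g(3)]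
        and gae2 = elem_hmap[OF ae a(3) g(2)]
      \<comment> \<open>The left side contains g''(\<alpha>) followed by \<beta>' at
        \<open>f x\<close>, the right side \<beta>' at \<open>f' x\<close> followed by g'(\<alpha>).
        Naturality of \<beta>' at the element \<open>\<alpha> x\<close> exchanges them; this is the
        only non-formal step of the interchange law.\<close>
      show "HComp ?X A B C f f'' g g'' (VComp ?X A B f f' f'' \<alpha>' \<alpha>) (VComp ?X B C g g' g'' \<beta>' \<beta>) x
        = VComp ?X A C (Comp1 ?X A B C g f) (Comp1 ?X A B C g' f') (Comp1 ?X A B C g'' f'')
          (HComp ?X A B C f' f'' g' g'' \<alpha>' \<beta>') (HComp ?X A B C f f' g g' \<alpha> \<beta>) x"
        using x v hmap_star[OF ae' ae a(3) g(3)]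
          star_assoc[OF gae' gae star_elem_unit[OF be'[OF v(1)] be[OF v(1)]]]
          star_assoc[OF gae be'[OF v(1)] be[OF v(1)]]
          wtrans_star[OF \<beta>' g(2,3) a(3) ae]
          star_assoc[OF be'[OF v(2)] gae2 be[OF v(1)]]
          star_assoc[OF gae' be'[OF v(2)] star_elem_unit[OF gae2 be[OF v(1)]]]
        by (simp add: WCat_hcomp)
    qed
  qed
qed

end


section \<open>The monoidal category of coalgebras\<close>

text \<open>Hom-sets of a \<open>moncat\<close> need not be disjoint, so a morphism does not determine its domain.
  Recording source and target makes the side conditions of the interchange law decidable by
  rewriting.\<close>

datatype ('o, 'a) arrow = Arrow (src: 'o) (mor: 'a) (trg: 'o)

context strict_monoidal_category
begin

definition arr :: "('o, 'a) arrow \<Rightarrow> bool" where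
  "arr f \<longleftrightarrow> src f \<in> Obj W \<and> trg f \<in> Obj W \<and> mor f \<in> Hom W (src f) (trg f)"

definition one :: "'o \<Rightarrow> ('o, 'a) arrow" where
  "one A = Arrow A (\<i> A) A"

definition cmp :: "('o, 'a) arrow \<Rightarrow> ('o, 'a) arrow \<Rightarrow> ('o, 'a) arrow" (infixr "\<bullet>" 65) where
  "g \<bullet> f = Arrow (src f) (mor g \<cdot> mor f) (trg g)"

definition ten :: "('o, 'a) arrow \<Rightarrow> ('o, 'a) arrow \<Rightarrow> ('o, 'a) arrow" (infixr "\<odot>" 70) where
  "f \<odot> g = Arrow (src f \<boxtimes> src g) (mor f \<boxdot> mor g) (trg f \<boxtimes> trg g)"

lemma src_trg [simp]:
  "src (one A) = A" "trg (one A) = A" "mor (one A) = \<i> A"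
  "src (g \<bullet> f) = src f" "trg (g \<bullet> f) = trg g" "mor (g \<bullet> f) = mor g \<cdot> mor f"
  "src (f \<odot> g) = src f \<boxtimes> src g" "trg (f \<odot> g) = trg f \<boxtimes> trg g" "mor (f \<odot> g) = mor f \<boxdot> mor g"
  by (auto simp: one_def cmp_def ten_def)

lemma arr_obj: "arr f \<Longrightarrow> src f \<in> Obj W" "arr f \<Longrightarrow> trg f \<in> Obj W"
  by (auto simp: arr_def)

lemma arr_one [simp]: "A \<in> Obj W \<Longrightarrow> arr (one A)"
  by (simp add: arr_def id_hom)

lemma arr_cmp [simp]: "\<lbrakk>arr f; arr g; src g = trg f\<rbrakk> \<Longrightarrow> arr (g \<bullet> f)"
  using comp_hom[of "src f" "trg f" "trg g"] by (simp add: arr_def)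

lemma arr_ten [simp]: "\<lbrakk>arr f; arr g\<rbrakk> \<Longrightarrow> arr (f \<odot> g)"
  by (simp add: arr_def tensor_obj tensor_hom)

lemma one_cmp [simp]: "\<lbrakk>arr f; trg f = A\<rbrakk> \<Longrightarrow> one A \<bullet> f = f"
  by (intro arrow.expand) (simp add: arr_def comp_id_left[of "src f"])

lemma cmp_one [simp]: "\<lbrakk>arr f; src f = A\<rbrakk> \<Longrightarrow> f \<bullet> one A = f"
  by (intro arrow.expand) (simp add: arr_def comp_id_right[of _ "trg f"])

lemma cmp_assoc: "\<lbrakk>arr f; arr g; arr h; src g = trg f; src h = trg g\<rbrakk> \<Longrightarrow> (h \<bullet> g) \<bullet> f = h \<bullet> (g \<bullet> f)"
  by (intro arrow.expand) (simp add: arr_def comp_assoc[of "src f" "trg f" "trg g" "trg h"])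

lemma ten_assoc: "\<lbrakk>arr f; arr g; arr h\<rbrakk> \<Longrightarrow> (f \<odot> g) \<odot> h = f \<odot> (g \<odot> h)"
  by (intro arrow.expand)
    (simp add: arr_def tensor_obj_assoc tensor_hom_assoc[of "src f" "trg f" "src g" "trg g" "src h" "trg h"])

lemma one_ten: "\<lbrakk>A \<in> Obj W; B \<in> Obj W\<rbrakk> \<Longrightarrow> one A \<odot> one B = one (A \<boxtimes> B)"
  by (intro arrow.expand) (simp add: tensor_id)

lemma unit_ten [simp]: "arr f \<Longrightarrow> one \<k> \<odot> f = f"
  by (intro arrow.expand) (simp add: arr_def unit_tensor_obj unit_tensor_hom[of "src f" "trg f"])

lemma ten_unit [simp]: "arr f \<Longrightarrow> f \<odot> one \<k> = f"
  by (intro arrow.expand) (simp add: arr_def tensor_unit_obj tensor_unit_hom[of "src f" "trg f"])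

lemma exchange:
  "\<lbrakk>arr f; arr f'; arr g; arr g'; src f' = trg f; src g' = trg g\<rbrakk>
    \<Longrightarrow> (f' \<odot> g') \<bullet> (f \<odot> g) = (f' \<bullet> f) \<odot> (g' \<bullet> g)"
  by (intro arrow.expand)
    (simp add: arr_def interchange[of "src f" "trg f" "trg f'" "src g" "trg g" "trg g'"])

text \<open>Objects are normalised to right-nested products without \<open>\<k>\<close>, so that
  composability conditions become syntactic equalities.\<close>

lemmas obj_simps [simp] = unit_obj tensor_obj tensor_obj_assoc unit_tensor_obj tensor_unit_obj arr_obj

end

section \<open>The braiding as an arrow, and braidings with the unit object\<close>

context braided_strict_monoidal_category
begin

notation cmp (infixr "\<bullet>" 65) and ten (infixr "\<odot>" 70)

definition br :: "'o \<Rightarrow> 'o \<Rightarrow> ('o, 'a) arrow" where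
  "br A B = Arrow (A \<boxtimes> B) (\<c> A B) (B \<boxtimes> A)"

lemma br_simps [simp]:
  "src (br A B) = A \<boxtimes> B" "trg (br A B) = B \<boxtimes> A" "mor (br A B) = \<c> A B"
  by (auto simp: br_def)

lemma arr_br [simp]: "\<lbrakk>A \<in> Obj V; B \<in> Obj V\<rbrakk> \<Longrightarrow> arr (br A B)"
  by (simp add: arr_def braid_hom del: arr_obj)

lemma br_natural:
  "\<lbrakk>arr f; arr g\<rbrakk> \<Longrightarrow> (g \<odot> f) \<bullet> br (src f) (src g) = br (trg f) (trg g) \<bullet> (f \<odot> g)"
  by (intro arrow.expand) (simp add: arr_def braid_natural[of "src f" "trg f" "src g" "trg g"] del: arr_obj)

lemma br_ten_right:
  "\<lbrakk>A \<in> Obj V; B \<in> Obj V; C \<in> Obj V\<rbrakk> \<Longrightarrow> br A (B \<boxtimes> C) = (one B \<odot> br A C) \<bullet> (br A B \<odot> one C)"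
  by (intro arrow.expand) (simp add: braid_tensor_right)

lemma br_ten_left:
  "\<lbrakk>A \<in> Obj V; B \<in> Obj V; C \<in> Obj V\<rbrakk> \<Longrightarrow> br (A \<boxtimes> B) C = (br A C \<odot> one B) \<bullet> (one A \<odot> br B C)"
  by (intro arrow.expand) (simp add: braid_tensor_left)

text \<open>Left cancellation of the braiding. It turns an idempotent braiding into an identity, the
  one consequence of invertibility on which the monoidal structure of coalgebras rests.\<close>

lemma br_cancel:
  assumes "A \<in> Obj V" "B \<in> Obj V" "arr f" "trg f = A \<boxtimes> B" "br A B \<bullet> f = br A B"
  shows "f = one (A \<boxtimes> B)"
proof -
  obtain d where d: "d \<in> Hom V (B \<boxtimes> A) (A \<boxtimes> B)" "d \<cdot> \<c> A B = \<i> (A \<boxtimes> B)"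
    using braid_iso assms by blast
  let ?d = "Arrow (B \<boxtimes> A) d (A \<boxtimes> B)"
  have d': "arr ?d" "?d \<bullet> br A B = one (A \<boxtimes> B)"
    using d assms by (auto simp: arr_def simp del: arr_obj intro: arrow.expand)
  have "f = (?d \<bullet> br A B) \<bullet> f" using assms d' by simp
  also have "\<dots> = ?d \<bullet> (br A B \<bullet> f)" using assms d' by (intro cmp_assoc) auto
  finally show ?thesis unfolding assms(5) d'(2) .
qed

text \<open>Since \<open>\<k> \<boxtimes> \<k> = \<k>\<close>, the hexagon makes \<open>\<c> A \<k>\<close> idempotent.\<close>

lemma br_unit_right [simp]: "A \<in> Obj V \<Longrightarrow> br A \<k> = one A"
  using br_ten_right[of A \<k> \<k>, symmetric] br_cancel[of A \<k> "br A \<k>"] by simp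

lemma br_unit_left [simp]: "A \<in> Obj V \<Longrightarrow> br \<k> A = one A"
  using br_ten_left[of \<k> \<k> A, symmetric] br_cancel[of \<k> A "br \<k> A"] by simp

section \<open>Coalgebras and their tensor product\<close>

definition comult :: "('o, 'a) coalg \<Rightarrow> ('o, 'a) arrow" where
  "comult C = Arrow (cca C) (cmul C) (cca C \<boxtimes> cca C)"

definition counit :: "('o, 'a) coalg \<Rightarrow> ('o, 'a) arrow" where
  "counit C = Arrow (cca C) (ceps C) \<k>"

lemma comult_counit_simps [simp]:
  "src (comult C) = cca C" "trg (comult C) = cca C \<boxtimes> cca C" "mor (comult C) = cmul C"
  "src (counit C) = cca C" "trg (counit C) = \<k>" "mor (counit C) = ceps C"
  by (auto simp: comult_def counit_def)

lemma coalgebras_iff: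
  "C \<in> coalgebras V \<longleftrightarrow> cca C \<in> Obj V \<and> arr (comult C) \<and> arr (counit C) \<and>
    (comult C \<odot> one (cca C)) \<bullet> comult C = (one (cca C) \<odot> comult C) \<bullet> comult C \<and>
    (counit C \<odot> one (cca C)) \<bullet> comult C = one (cca C) \<and>
    (one (cca C) \<odot> counit C) \<bullet> comult C = one (cca C)"
proof (cases "cca C \<in> Obj V")
  case True
  have eq: "f = g \<longleftrightarrow> mor f = mor g" if "src f = src g" "trg f = trg g"
    for f g :: "('o, 'a) arrow"
    using that by (auto intro: arrow.expand)
  show ?thesis using True by (simp add: coalgebras_def eq) (auto simp: arr_def simp del: arr_obj)
qed (auto simp: coalgebras_def)

lemma coalgebra_homs_iff:
  assumes "C \<in> coalgebras V" "D \<in> coalgebras V"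
  shows "f \<in> coalgebra_homs V C D \<longleftrightarrow> (let F = Arrow (cca C) f (cca D) in
    arr F \<and> comult D \<bullet> F = (F \<odot> F) \<bullet> comult C \<and> counit D \<bullet> F = counit C)"
proof -
  have eq: "f = g \<longleftrightarrow> mor f = mor g" if "src f = src g" "trg f = trg g"
    for f g :: "('o, 'a) arrow"
    using that by (auto intro: arrow.expand)
  show ?thesis using assms
    by (simp add: coalgebra_homs_def eq Let_def) (auto simp: arr_def coalgebras_iff simp del: arr_obj)
qed

lemma cca_tensor [simp]: "cca (coalgebra_tensor V C D) = cca C \<boxtimes> cca D"
  by (simp add: coalgebra_tensor_def)

lemma counit_tensor:
  "counit (coalgebra_tensor V C D) = counit C \<odot> counit D"
  by (intro arrow.expand) (simp add: coalgebra_tensor_def)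

text \<open>The defining formula brackets its three middle factors to the left,
  \<open>\<odot>\<close> to the right. The hypotheses type the objects, as \<open>ten_assoc\<close>
  demands.\<close>

lemma comult_tensor:
  assumes "C \<in> coalgebras V" "D \<in> coalgebras V"
  shows "comult (coalgebra_tensor V C D)
    = (one (cca C) \<odot> br (cca C) (cca D) \<odot> one (cca D)) \<bullet> (comult C \<odot> comult D)"
proof -
  have P: "cca C \<in> Obj V" "cca D \<in> Obj V" using assms by (auto simp: coalgebras_iff)
  then have "comult (coalgebra_tensor V C D)
    = ((one (cca C) \<odot> br (cca C) (cca D)) \<odot> one (cca D)) \<bullet> (comult C \<odot> comult D)"
    by (intro arrow.expand) (simp add: coalgebra_tensor_def)
  then show ?thesis using P by (simp add: ten_assoc)
qed

text \<open>For coassociativity, naturality of the braiding moves all comultiplications in front of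
  all braidings. Coassociativity of the factors makes the first parts agree; the second parts are
  two expressions of the braid from \<open>PPPQQQ\<close> to \<open>PQPQPQ\<close>, equal by the
  hexagon identities. In the counit laws only a braiding with \<open>\<k>\<close> is left
  over.\<close>

lemma coalgebra_tensor_closed:
  assumes "C \<in> coalgebras V" "D \<in> coalgebras V"
  shows "coalgebra_tensor V C D \<in> coalgebras V"
proof -
  define P Q p q c d e s t where
    "P = cca C" "Q = cca D" "p = one P" "q = one Q" "c = br P Q"
    "d = comult C" "e = comult D" "s = counit C" "t = counit D"
  note defs = this
  have P [simp]: "P \<in> Obj V" "Q \<in> Obj V" "arr d" "arr e" "arr s" "arr t"
    using assms by (auto simp: coalgebras_iff defs)
  have ty [simp]: "src p = P" "trg p = P" "src q = Q" "trg q = Q" "src c = P \<boxtimes> Q" "trg c = Q \<boxtimes> P"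
    "src d = P" "trg d = P \<boxtimes> P" "src e = Q" "trg e = Q \<boxtimes> Q"
    "src s = P" "trg s = \<k>" "src t = Q" "trg t = \<k>" "arr p" "arr q" "arr c"
    by (auto simp: defs) (use P in \<open>auto simp: defs\<close>)
  have ones [simp]: "p \<bullet> f = f" if "arr f" "trg f = P" for f using that by (simp add: defs)
  have ones' [simp]: "f \<bullet> p = f" if "arr f" "src f = P" for f using that by (simp add: defs)
  have onesq [simp]: "q \<bullet> f = f" if "arr f" "trg f = Q" for f using that by (simp add: defs)
  have onesq' [simp]: "f \<bullet> q = f" if "arr f" "src f = Q" for f using that by (simp add: defs)
  have coalg: "(d \<odot> p) \<bullet> d = (p \<odot> d) \<bullet> d" "(s \<odot> p) \<bullet> d = p" "(p \<odot> s) \<bullet> d = p"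
    "(e \<odot> q) \<bullet> e = (q \<odot> e) \<bullet> e" "(t \<odot> q) \<bullet> e = q" "(q \<odot> t) \<bullet> e = q"
    using assms by (auto simp: coalgebras_iff defs)
  define x where "x = p \<odot> c \<odot> q"
  define T where "T = x \<bullet> (d \<odot> e)"
  have x [simp]: "arr x" "src x = P \<boxtimes> P \<boxtimes> Q \<boxtimes> Q" "trg x = P \<boxtimes> Q \<boxtimes> P \<boxtimes> Q"
    by (auto simp: x_def)
  have T: "comult (coalgebra_tensor V C D) = T"
    using comult_tensor[OF assms] by (simp add: T_def x_def defs)
  have arrT [simp]: "arr T" "src T = P \<boxtimes> Q" "trg T = (P \<boxtimes> Q) \<boxtimes> (P \<boxtimes> Q)"
    by (auto simp: T_def)
  let ?r = "p \<odot> q" and ?c2 = "br P (Q \<boxtimes> Q)" and ?c2' = "br (P \<boxtimes> P) Q"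
  have r: "?r = one (P \<boxtimes> Q)" using one_ten[OF P(1,2)] by (simp add: defs)
  have "(T \<odot> ?r) \<bullet> T = (x \<odot> ?r) \<bullet> ((d \<odot> e) \<odot> ?r) \<bullet> x \<bullet> (d \<odot> e)"
  proof -
    have "T \<odot> ?r = (x \<odot> ?r) \<bullet> ((d \<odot> e) \<odot> ?r)"
      by (simp add: exchange T_def)
    then show ?thesis by (simp add: T_def cmp_assoc)
  qed
  also have "((d \<odot> e) \<odot> ?r) \<bullet> x \<bullet> (d \<odot> e) = (((d \<odot> e) \<odot> ?r) \<bullet> x) \<bullet> (d \<odot> e)"
    by (simp add: cmp_assoc)
  also have "((d \<odot> e) \<odot> ?r) \<bullet> x = (one (P \<boxtimes> P) \<odot> ?c2 \<odot> q) \<bullet> ((d \<odot> p) \<odot> (e \<odot> q))"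
  proof -
    have "((d \<odot> e) \<odot> ?r) \<bullet> x = (d \<odot> ((e \<odot> p) \<odot> q)) \<bullet> (p \<odot> (c \<odot> q))"
      by (simp add: ten_assoc x_def)
    also have "\<dots> = d \<odot> (((e \<odot> p) \<bullet> c) \<odot> q)"
      by (simp add: exchange)
    also have "(e \<odot> p) \<bullet> c = ?c2 \<bullet> (p \<odot> e)"
      using br_natural[of p e] by (simp add: defs(5))
    also have "d \<odot> ((?c2 \<bullet> (p \<odot> e)) \<odot> q) = (one (P \<boxtimes> P) \<odot> ?c2 \<odot> q) \<bullet> (d \<odot> ((p \<odot> e) \<odot> q))"
      by (simp add: exchange)
    finally show ?thesis by (simp add: ten_assoc)
  qed
  also have "\<dots> \<bullet> (d \<odot> e) = (one (P \<boxtimes> P) \<odot> ?c2 \<odot> q) \<bullet> (((d \<odot> p) \<bullet> d) \<odot> ((e \<odot> q) \<bullet> e))"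
    by (simp add: cmp_assoc exchange)
  also have "(x \<odot> ?r) \<bullet> \<dots> = ((x \<odot> ?r) \<bullet> (one (P \<boxtimes> P) \<odot> ?c2 \<odot> q)) \<bullet> (((d \<odot> p) \<bullet> d) \<odot> ((e \<odot> q) \<bullet> e))"
    by (simp add: cmp_assoc)
  \<comment> \<open>Comparison of the two braids. Once the outer strands \<open>p\<close> and
    \<open>q\<close> are removed, the hexagons split \<open>?c2\<close> and \<open>?c2'\<close> into
    single crossings; the two crossings in \<open>c \<odot> c\<close> act on disjoint factors and
    may be performed in either order.\<close>
  also have "(x \<odot> ?r) \<bullet> (one (P \<boxtimes> P) \<odot> ?c2 \<odot> q) = (?r \<odot> x) \<bullet> (p \<odot> ?c2' \<odot> one (Q \<boxtimes> Q))"
  proof -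
    have "(x \<odot> ?r) \<bullet> (one (P \<boxtimes> P) \<odot> ?c2 \<odot> q) = (p \<odot> ((c \<odot> (q \<odot> p)) \<odot> q)) \<bullet> (p \<odot> ((p \<odot> ?c2) \<odot> q))"
      by (simp add: x_def ten_assoc one_ten[symmetric] flip: defs)
    also have "\<dots> = p \<odot> (((c \<odot> (q \<odot> p)) \<bullet> (p \<odot> ?c2)) \<odot> q)"
      by (simp add: exchange)
    also have "(c \<odot> (q \<odot> p)) \<bullet> (p \<odot> ?c2) = ((q \<odot> p) \<odot> c) \<bullet> (?c2' \<odot> q)"
    proof -
      have qp: "q \<odot> p = one (Q \<boxtimes> P)" using one_ten[OF P(2,1)] by (simp add: defs)
      have "(c \<odot> (q \<odot> p)) \<bullet> (p \<odot> ?c2) = (c \<odot> (q \<odot> p)) \<bullet> ((p \<odot> (q \<odot> c)) \<bullet> (p \<odot> (c \<odot> q)))"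
        by (simp add: br_ten_right exchange flip: defs)
      also have "\<dots> = ((c \<odot> (q \<odot> p)) \<bullet> ((p \<odot> q) \<odot> c)) \<bullet> (p \<odot> (c \<odot> q))"
        by (simp add: cmp_assoc ten_assoc)
      also have "(c \<odot> (q \<odot> p)) \<bullet> ((p \<odot> q) \<odot> c) = c \<odot> c"
        by (simp add: exchange) (simp add: qp r)
      also have "c \<odot> c = ((q \<odot> p) \<odot> c) \<bullet> (c \<odot> (p \<odot> q))"
        by (simp add: exchange) (simp add: qp r)
      also have "\<dots> \<bullet> (p \<odot> (c \<odot> q)) = ((q \<odot> p) \<odot> c) \<bullet> (((c \<odot> p) \<odot> q) \<bullet> ((p \<odot> c) \<odot> q))"
        by (simp add: cmp_assoc ten_assoc)
      also have "((c \<odot> p) \<odot> q) \<bullet> ((p \<odot> c) \<odot> q) = ?c2' \<odot> q"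
        by (simp add: br_ten_left exchange flip: defs)
      finally show ?thesis .
    qed
    also have "p \<odot> ((((q \<odot> p) \<odot> c) \<bullet> (?c2' \<odot> q)) \<odot> q)
        = (p \<odot> (((q \<odot> p) \<odot> c) \<odot> q)) \<bullet> (p \<odot> ((?c2' \<odot> q) \<odot> q))"
      by (simp add: exchange)
    finally show ?thesis
      by (simp add: x_def ten_assoc one_ten[symmetric] flip: defs)
  qed
  also have "((?r \<odot> x) \<bullet> (p \<odot> ?c2' \<odot> one (Q \<boxtimes> Q))) \<bullet> (((d \<odot> p) \<bullet> d) \<odot> ((e \<odot> q) \<bullet> e))
      = (?r \<odot> x) \<bullet> ((p \<odot> ?c2' \<odot> one (Q \<boxtimes> Q)) \<bullet> ((p \<odot> d) \<odot> (q \<odot> e))) \<bullet> (d \<odot> e)"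
    by (simp add: cmp_assoc exchange coalg)
  \<comment> \<open>The mirror image of the first sliding step: \<open>d\<close> passes back through
    \<open>?c2'\<close> in the first variable, so that the braiding is single again.\<close>
  also have "(p \<odot> ?c2' \<odot> one (Q \<boxtimes> Q)) \<bullet> ((p \<odot> d) \<odot> (q \<odot> e)) = (?r \<odot> (d \<odot> e)) \<bullet> x"
  proof -
    have "(p \<odot> ?c2' \<odot> one (Q \<boxtimes> Q)) \<bullet> ((p \<odot> d) \<odot> (q \<odot> e))
        = (p \<odot> ?c2' \<odot> one (Q \<boxtimes> Q)) \<bullet> (p \<odot> ((d \<odot> q) \<odot> e))"
      by (simp add: ten_assoc)
    also have "\<dots> = p \<odot> ((?c2' \<bullet> (d \<odot> q)) \<odot> e)"
      by (simp add: exchange)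
    also have "?c2' \<bullet> (d \<odot> q) = (q \<odot> d) \<bullet> c"
      using br_natural[of d q] by (simp add: defs(5))
    also have "p \<odot> (((q \<odot> d) \<bullet> c) \<odot> e) = (p \<odot> ((q \<odot> d) \<odot> e)) \<bullet> (p \<odot> (c \<odot> q))"
      by (simp add: exchange)
    finally show ?thesis by (simp add: ten_assoc x_def)
  qed
  also have "(?r \<odot> x) \<bullet> ((?r \<odot> (d \<odot> e)) \<bullet> x) \<bullet> (d \<odot> e) = ((?r \<odot> x) \<bullet> (?r \<odot> (d \<odot> e))) \<bullet> T"
    by (simp add: cmp_assoc T_def)
  also have "(?r \<odot> x) \<bullet> (?r \<odot> (d \<odot> e)) = ?r \<odot> T"
    by (simp add: exchange T_def)
  finally have 1: "(T \<odot> ?r) \<bullet> T = (?r \<odot> T) \<bullet> T" .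
  \<comment> \<open>Naturality carries the counit \<open>t\<close> through the crossing and leaves
    the braiding of \<open>P\<close> with \<open>\<k>\<close>, an identity.\<close>
  have "((s \<odot> t) \<odot> ?r) \<bullet> x = (s \<odot> p) \<odot> (t \<odot> q)"
  proof -
    have "((s \<odot> t) \<odot> ?r) \<bullet> x = (s \<odot> ((t \<odot> p) \<odot> q)) \<bullet> (p \<odot> (c \<odot> q))"
      by (simp add: ten_assoc x_def)
    also have "\<dots> = s \<odot> (((t \<odot> p) \<bullet> c) \<odot> q)" by (simp add: exchange)
    also have "(t \<odot> p) \<bullet> c = p \<odot> t"
      using br_natural[of p t] by (simp add: defs(5))
    finally show ?thesis by (simp add: ten_assoc)
  qed
  then have 2: "((s \<odot> t) \<odot> ?r) \<bullet> T = ?r"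
    using coalg by (simp add: T_def exchange flip: cmp_assoc)
  have "(?r \<odot> (s \<odot> t)) \<bullet> x = (p \<odot> s) \<odot> (q \<odot> t)"
  proof -
    have "(?r \<odot> (s \<odot> t)) \<bullet> x = (p \<odot> ((q \<odot> s) \<odot> t)) \<bullet> (p \<odot> (c \<odot> q))"
      by (simp add: ten_assoc x_def)
    also have "\<dots> = p \<odot> (((q \<odot> s) \<bullet> c) \<odot> t)" by (simp add: exchange)
    also have "(q \<odot> s) \<bullet> c = s \<odot> q"
      using br_natural[of s q] by (simp add: defs(5))
    finally show ?thesis by (simp add: ten_assoc)
  qed
  then have 3: "(?r \<odot> (s \<odot> t)) \<bullet> T = ?r"
    using coalg by (simp add: T_def exchange flip: cmp_assoc)
  show ?thesis
    using 1 2 3 by (simp add: coalgebras_iff T counit_tensor flip: defs r)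
qed

lemma coalg_eqI:
  "\<lbrakk>cca C = cca D; comult C = comult D; counit C = counit D\<rbrakk> \<Longrightarrow> C = (D :: ('o, 'a) coalg)"
  by (simp add: comult_def counit_def)

lemma coalgebra_unit:
  fixes U :: "('o, 'a) coalg"
  defines "U \<equiv> \<lparr>cca = \<k>, cmul = \<i> \<k>, ceps = \<i> \<k>\<rparr>"
  shows "cca U = \<k>" "comult U = one \<k>" "counit U = one \<k>" "U \<in> coalgebras V"
proof -
  show 1: "cca U = \<k>" "comult U = one \<k>" "counit U = one \<k>"
    by (auto simp: U_def intro!: arrow.expand)
  show "U \<in> coalgebras V" by (simp add: coalgebras_iff 1)
qed

text \<open>The underlying objects agree by strictness. Each comultiplication is
  \<open>d \<odot> e \<odot> f\<close> followed by a braid from \<open>PPQQRR\<close> to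
  \<open>PQRPQR\<close>, and the hexagons show that the two braids are the same.\<close>

lemma coalgebra_tensor_assoc:
  assumes "C \<in> coalgebras V" "D \<in> coalgebras V" "E \<in> coalgebras V"
  shows "coalgebra_tensor V (coalgebra_tensor V C D) E = coalgebra_tensor V C (coalgebra_tensor V D E)"
proof (rule coalg_eqI)
  define P Q R p q r d e f where
    "P = cca C" "Q = cca D" "R = cca E" "p = one P" "q = one Q" "r = one R"
    "d = comult C" "e = comult D" "f = comult E"
  note defs = this
  have P [simp]: "P \<in> Obj V" "Q \<in> Obj V" "R \<in> Obj V" "arr d" "arr e" "arr f"
    "arr (counit C)" "arr (counit D)" "arr (counit E)"
    using assms by (auto simp: coalgebras_iff defs)
  have ty [simp]: "src p = P" "trg p = P" "src q = Q" "trg q = Q" "src r = R" "trg r = R"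
    "src d = P" "trg d = P \<boxtimes> P" "src e = Q" "trg e = Q \<boxtimes> Q"
    "src f = R" "trg f = R \<boxtimes> R" "arr p" "arr q" "arr r"
    by (auto simp: defs) (use P in \<open>auto simp: defs\<close>)
  have ones [simp]: "p \<bullet> g = g" if "arr g" "trg g = P" for g using that by (simp add: defs)
  have onesq [simp]: "q \<bullet> g = g" if "arr g" "trg g = Q" for g using that by (simp add: defs)
  have onesr [simp]: "r \<bullet> g = g" if "arr g" "trg g = R" for g using that by (simp add: defs)
  have onespp [simp]: "one P = p" "one Q = q" "one R = r" by (auto simp: defs)
  have pq: "p \<odot> q = one (P \<boxtimes> Q)" "q \<odot> r = one (Q \<boxtimes> R)" "q \<odot> p = one (Q \<boxtimes> P)" "r \<odot> q = one (R \<boxtimes> Q)"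
    "p \<odot> p = one (P \<boxtimes> P)" "r \<odot> r = one (R \<boxtimes> R)"
    by (auto simp: one_ten[symmetric])
  let ?c = "br P Q" and ?c' = "br Q R" and ?b = "br P R"
  note DE = coalgebra_tensor_closed[OF assms(1,2)] coalgebra_tensor_closed[OF assms(2,3)]
  show "cca (coalgebra_tensor V (coalgebra_tensor V C D) E) = cca (coalgebra_tensor V C (coalgebra_tensor V D E))"
    using P by (simp flip: defs)
  show "counit (coalgebra_tensor V (coalgebra_tensor V C D) E) = counit (coalgebra_tensor V C (coalgebra_tensor V D E))"
    by (simp add: counit_tensor ten_assoc)
  have "comult (coalgebra_tensor V (coalgebra_tensor V C D) E)
      = ((p \<odot> q) \<odot> br (P \<boxtimes> Q) R \<odot> r) \<bullet> (((p \<odot> ?c \<odot> q) \<bullet> (d \<odot> e)) \<odot> f)"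
    by (simp add: comult_tensor assms DE pq flip: defs)
  also have "((p \<odot> ?c \<odot> q) \<bullet> (d \<odot> e)) \<odot> f = ((p \<odot> ?c \<odot> q) \<odot> (r \<odot> r)) \<bullet> ((d \<odot> e) \<odot> f)"
    by (simp add: exchange) (simp add: pq)
  also have "((p \<odot> q) \<odot> br (P \<boxtimes> Q) R \<odot> r) \<bullet> \<dots>
      = (((p \<odot> q) \<odot> br (P \<boxtimes> Q) R \<odot> r) \<bullet> ((p \<odot> ?c \<odot> q) \<odot> (r \<odot> r))) \<bullet> (d \<odot> e \<odot> f)"
    by (simp add: cmp_assoc ten_assoc)
  also have "((p \<odot> q) \<odot> br (P \<boxtimes> Q) R \<odot> r) \<bullet> ((p \<odot> ?c \<odot> q) \<odot> (r \<odot> r))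
      = (p \<odot> br P (Q \<boxtimes> R) \<odot> (q \<odot> r)) \<bullet> ((p \<odot> p) \<odot> (q \<odot> ?c' \<odot> r))"
  proof -
    \<comment> \<open>The braid without its outer strands, from \<open>PQQR\<close> to
      \<open>QRPQ\<close>: both composite braidings are split by the hexagons, and \<open>?c\<close>
      and \<open>?c'\<close>, acting on disjoint factors, commute.\<close>
    have "(q \<odot> br (P \<boxtimes> Q) R) \<bullet> (?c \<odot> (q \<odot> r)) = (br P (Q \<boxtimes> R) \<odot> q) \<bullet> ((p \<odot> q) \<odot> ?c')"
    proof -
      have "(q \<odot> br (P \<boxtimes> Q) R) \<bullet> (?c \<odot> (q \<odot> r))
          = ((q \<odot> (?b \<odot> q)) \<bullet> (q \<odot> (p \<odot> ?c'))) \<bullet> (?c \<odot> (q \<odot> r))"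
        by (simp add: br_ten_left exchange)
      also have "\<dots> = (q \<odot> (?b \<odot> q)) \<bullet> (((q \<odot> p) \<odot> ?c') \<bullet> (?c \<odot> (q \<odot> r)))"
        by (simp add: cmp_assoc ten_assoc)
      also have "((q \<odot> p) \<odot> ?c') \<bullet> (?c \<odot> (q \<odot> r)) = ?c \<odot> ?c'"
        by (simp add: exchange) (simp add: pq)
      also have "?c \<odot> ?c' = (?c \<odot> (r \<odot> q)) \<bullet> ((p \<odot> q) \<odot> ?c')"
        by (simp add: exchange) (simp add: pq)
      also have "(q \<odot> (?b \<odot> q)) \<bullet> \<dots> = (((q \<odot> ?b) \<odot> q) \<bullet> ((?c \<odot> r) \<odot> q)) \<bullet> ((p \<odot> q) \<odot> ?c')"
        by (simp add: cmp_assoc ten_assoc)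
      also have "((q \<odot> ?b) \<odot> q) \<bullet> ((?c \<odot> r) \<odot> q) = br P (Q \<boxtimes> R) \<odot> q"
        by (simp add: br_ten_right exchange)
      finally show ?thesis .
    qed
    then have "(p \<odot> (q \<odot> br (P \<boxtimes> Q) R) \<odot> r) \<bullet> (p \<odot> (?c \<odot> (q \<odot> r)) \<odot> r)
        = (p \<odot> (br P (Q \<boxtimes> R) \<odot> q) \<odot> r) \<bullet> (p \<odot> ((p \<odot> q) \<odot> ?c') \<odot> r)"
      by (simp add: exchange)
    then show ?thesis by (simp add: ten_assoc)
  qed
  also have "((p \<odot> br P (Q \<boxtimes> R) \<odot> (q \<odot> r)) \<bullet> ((p \<odot> p) \<odot> (q \<odot> ?c' \<odot> r))) \<bullet> (d \<odot> e \<odot> f)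
      = (p \<odot> br P (Q \<boxtimes> R) \<odot> (q \<odot> r)) \<bullet> (((p \<odot> p) \<odot> (q \<odot> ?c' \<odot> r)) \<bullet> (d \<odot> (e \<odot> f)))"
    by (simp add: cmp_assoc)
  also have "((p \<odot> p) \<odot> (q \<odot> ?c' \<odot> r)) \<bullet> (d \<odot> (e \<odot> f)) = d \<odot> ((q \<odot> ?c' \<odot> r) \<bullet> (e \<odot> f))"
    by (simp add: exchange) (simp add: pq)
  also have "(p \<odot> br P (Q \<boxtimes> R) \<odot> (q \<odot> r)) \<bullet> \<dots> = comult (coalgebra_tensor V C (coalgebra_tensor V D E))"
    by (simp add: comult_tensor assms DE pq flip: defs)
  finally show "comult (coalgebra_tensor V (coalgebra_tensor V C D) E)
      = comult (coalgebra_tensor V C (coalgebra_tensor V D E))" .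
qed

text \<open>Naturality of the braiding in both variables lets the inner pair \<open>F\<close>,
  \<open>G\<close> pass the crossing inside the comultiplication; the counit law needs interchange
  only.\<close>

lemma coalgebra_tensor_hom:
  assumes C: "C \<in> coalgebras V" "C' \<in> coalgebras V" and D: "D \<in> coalgebras V" "D' \<in> coalgebras V"
    and f: "f \<in> coalgebra_homs V C C'" and g: "g \<in> coalgebra_homs V D D'"
  shows "f \<boxdot> g \<in> coalgebra_homs V (coalgebra_tensor V C D) (coalgebra_tensor V C' D')"
proof -
  define F where "F = Arrow (cca C) f (cca C')"
  define G where "G = Arrow (cca D) g (cca D')"
  define x where "x = one (cca C) \<odot> br (cca C) (cca D) \<odot> one (cca D)"
  define x' where "x' = one (cca C') \<odot> br (cca C') (cca D') \<odot> one (cca D')"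
  have arrs [simp]: "arr (comult C)" "arr (comult D)" "arr (comult C')" "arr (comult D')"
    "arr (counit C)" "arr (counit D)" "arr (counit C')" "arr (counit D')"
    "cca C \<in> Obj V" "cca D \<in> Obj V" "cca C' \<in> Obj V" "cca D' \<in> Obj V"
    using C D by (auto simp: coalgebras_iff)
  have FG [simp]: "arr F" "src F = cca C" "trg F = cca C'" "arr G" "src G = cca D" "trg G = cca D'"
    and F: "comult C' \<bullet> F = (F \<odot> F) \<bullet> comult C" "counit C' \<bullet> F = counit C"
    and G: "comult D' \<bullet> G = (G \<odot> G) \<bullet> comult D" "counit D' \<bullet> G = counit D"
    using f g C D by (auto simp: coalgebra_homs_iff F_def G_def Let_def)
  have xs [simp]: "arr x" "src x = cca C \<boxtimes> (cca C \<boxtimes> (cca D \<boxtimes> cca D))"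
    "trg x = cca C \<boxtimes> (cca D \<boxtimes> (cca C \<boxtimes> cca D))"
    "arr x'" "src x' = cca C' \<boxtimes> (cca C' \<boxtimes> (cca D' \<boxtimes> cca D'))"
    "trg x' = cca C' \<boxtimes> (cca D' \<boxtimes> (cca C' \<boxtimes> cca D'))"
    by (auto simp: x_def x'_def)
  have "comult (coalgebra_tensor V C' D') \<bullet> (F \<odot> G) = x' \<bullet> ((F \<odot> F) \<odot> (G \<odot> G)) \<bullet> (comult C \<odot> comult D)"
    by (simp add: comult_tensor C D cmp_assoc exchange F G flip: x'_def)
  also have "\<dots> = (x' \<bullet> (F \<odot> ((F \<odot> G) \<odot> G))) \<bullet> (comult C \<odot> comult D)"
    by (simp add: cmp_assoc ten_assoc)
  also have "x' \<bullet> (F \<odot> ((F \<odot> G) \<odot> G)) = F \<odot> (((G \<odot> F) \<bullet> br (cca C) (cca D)) \<odot> G)"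
    using br_natural[of F G] by (simp add: x'_def exchange)
  also have "\<dots> = (F \<odot> ((G \<odot> F) \<odot> G)) \<bullet> x"
    by (simp add: x_def exchange)
  also have "\<dots> \<bullet> (comult C \<odot> comult D) = ((F \<odot> G) \<odot> (F \<odot> G)) \<bullet> comult (coalgebra_tensor V C D)"
    by (simp add: comult_tensor C D cmp_assoc ten_assoc flip: x_def)
  finally have 1: "comult (coalgebra_tensor V C' D') \<bullet> (F \<odot> G)
    = ((F \<odot> G) \<odot> (F \<odot> G)) \<bullet> comult (coalgebra_tensor V C D)" .
  have 2: "counit (coalgebra_tensor V C' D') \<bullet> (F \<odot> G) = counit (coalgebra_tensor V C D)"
    by (simp add: counit_tensor exchange F G)
  have 3: "Arrow (cca C \<boxtimes> cca D) (f \<boxdot> g) (cca C' \<boxtimes> cca D') = F \<odot> G"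
    by (simp add: ten_def F_def G_def)
  show ?thesis
    using 1 2 by (simp add: coalgebra_homs_iff coalgebra_tensor_closed C D 3)
qed

lemma coalgebra_hom_comp:
  assumes C: "C \<in> coalgebras V" and D: "D \<in> coalgebras V" and E: "E \<in> coalgebras V"
    and f: "f \<in> coalgebra_homs V C D" and g: "g \<in> coalgebra_homs V D E"
  shows "g \<cdot> f \<in> coalgebra_homs V C E"
proof -
  define F where "F = Arrow (cca C) f (cca D)"
  define G where "G = Arrow (cca D) g (cca E)"
  have arrs [simp]: "arr (comult C)" "arr (comult D)" "arr (comult E)"
    "arr (counit C)" "arr (counit D)" "arr (counit E)"
    using C D E by (auto simp: coalgebras_iff)
  have FG [simp]: "arr F" "src F = cca C" "trg F = cca D" "arr G" "src G = cca D" "trg G = cca E"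
    and F: "comult D \<bullet> F = (F \<odot> F) \<bullet> comult C" "counit D \<bullet> F = counit C"
    and G: "comult E \<bullet> G = (G \<odot> G) \<bullet> comult D" "counit E \<bullet> G = counit D"
    using f g C D E by (auto simp: coalgebra_homs_iff F_def G_def Let_def)
  have "comult E \<bullet> (G \<bullet> F) = (comult E \<bullet> G) \<bullet> F" by (simp add: cmp_assoc)
  also have "\<dots> = (G \<odot> G) \<bullet> (F \<odot> F) \<bullet> comult C" by (simp add: G F cmp_assoc)
  also have "\<dots> = ((G \<odot> G) \<bullet> (F \<odot> F)) \<bullet> comult C" by (simp add: cmp_assoc)
  finally have 1: "comult E \<bullet> (G \<bullet> F) = ((G \<bullet> F) \<odot> (G \<bullet> F)) \<bullet> comult C" by (simp add: exchange)
  have "counit E \<bullet> (G \<bullet> F) = (counit E \<bullet> G) \<bullet> F" by (simp add: cmp_assoc)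
  then have 2: "counit E \<bullet> (G \<bullet> F) = counit C" by (simp add: F G)
  have 3: "Arrow (cca C) (g \<cdot> f) (cca E) = G \<bullet> F"
    by (simp add: cmp_def F_def G_def)
  show ?thesis using 1 2 by (simp add: coalgebra_homs_iff C E 3)
qed

text \<open>Composition and tensor product of morphisms are those of \<open>V\<close>, so equations
  between morphisms are inherited. The work lies in closure of the hom-sets and in the strict
  equations between coalgebras, which concern their whole structure and not just the
  carriers.\<close>

theorem strict_monoidal_Coalg: "strict_monoidal_category (Coalg V)"
proof -
  have Coalg [simp]: "Obj (Coalg V) = coalgebras V" "Hom (Coalg V) = coalgebra_homs V"
    "Idn (Coalg V) = (\<lambda>C. \<i> (cca C))" "Cmp (Coalg V) = Cmp V" "TenM (Coalg V) = TenM V"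
    "TenO (Coalg V) = coalgebra_tensor V" "Unt (Coalg V) = \<lparr>cca = \<k>, cmul = \<i> \<k>, ceps = \<i> \<k>\<rparr>"
    by (auto simp: Coalg_def)
  have o: "cca C \<in> Obj V" if "C \<in> coalgebras V" for C using that by (simp add: coalgebras_iff)
  have h: "f \<in> Hom V (cca C) (cca D)" if "f \<in> coalgebra_homs V C D" for f C D
    using that by (simp add: coalgebra_homs_def)
  note U = coalgebra_unit
  show ?thesis
  proof (unfold_locales, unfold Coalg)
    fix C assume C: "C \<in> coalgebras V"
    then have arrs [simp]: "arr (comult C)" "arr (counit C)" "cca C \<in> Obj V"
      by (auto simp: coalgebras_iff)
    have 1: "Arrow (cca C) (\<i> (cca C)) (cca C) = one (cca C)" by (simp add: one_def)
    show "\<i> (cca C) \<in> coalgebra_homs V C C"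
      using C by (simp add: coalgebra_homs_iff 1 one_ten)
    \<comment> \<open>Tensoring with the unit coalgebra returns the same record because the crossing
      in its comultiplication is a braiding with \<open>\<k>\<close>.\<close>
    show "coalgebra_tensor V \<lparr>cca = \<k>, cmul = \<i> \<k>, ceps = \<i> \<k>\<rparr> C = C"
      by (rule coalg_eqI) (simp_all add: comult_tensor U C counit_tensor one_ten)
    show "coalgebra_tensor V C \<lparr>cca = \<k>, cmul = \<i> \<k>, ceps = \<i> \<k>\<rparr> = C"
      by (rule coalg_eqI) (simp_all add: comult_tensor U C counit_tensor one_ten)
  next
    fix C D E f g
    assume "C \<in> coalgebras V" "D \<in> coalgebras V" "E \<in> coalgebras V"
      "f \<in> coalgebra_homs V C D" "g \<in> coalgebra_homs V D E"
    then show "g \<cdot> f \<in> coalgebra_homs V C E" by (rule coalgebra_hom_comp)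
  next
    fix C D f assume a: "C \<in> coalgebras V" "D \<in> coalgebras V" "f \<in> coalgebra_homs V C D"
    note b = o[OF a(1)] o[OF a(2)] h[OF a(3)]
    show "\<i> (cca D) \<cdot> f = f" by (rule comp_id_left[OF b])
    show "f \<cdot> \<i> (cca C) = f" by (rule comp_id_right[OF b])
    show "\<i> (cca \<lparr>cca = \<k>, cmul = \<i> \<k>, ceps = \<i> \<k>\<rparr>) \<boxdot> f = f"
      using unit_tensor_hom[OF b] by simp
    show "f \<boxdot> \<i> (cca \<lparr>cca = \<k>, cmul = \<i> \<k>, ceps = \<i> \<k>\<rparr>) = f"
      using tensor_unit_hom[OF b] by simp
  next
    fix C D E F f g k
    assume a: "C \<in> coalgebras V" "D \<in> coalgebras V" "E \<in> coalgebras V" "F \<in> coalgebras V"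
      "f \<in> coalgebra_homs V C D" "g \<in> coalgebra_homs V D E" "k \<in> coalgebra_homs V E F"
    show "(k \<cdot> g) \<cdot> f = k \<cdot> (g \<cdot> f)"
      by (rule comp_assoc[OF a(1-4)[THEN o] a(5-7)[THEN h]])
  next
    show "\<lparr>cca = \<k>, cmul = \<i> \<k>, ceps = \<i> \<k>\<rparr> \<in> coalgebras V" by (rule U)
  next
    fix C D assume a: "C \<in> coalgebras V" "D \<in> coalgebras V"
    show "coalgebra_tensor V C D \<in> coalgebras V" by (rule coalgebra_tensor_closed[OF a])
    show "\<i> (cca C) \<boxdot> \<i> (cca D) = \<i> (cca (coalgebra_tensor V C D))"
      using tensor_id[OF a[THEN o]] by simp
  next
    fix C C' D D' f g
    assume "C \<in> coalgebras V" "C' \<in> coalgebras V" "D \<in> coalgebras V" "D' \<in> coalgebras V"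
      "f \<in> coalgebra_homs V C C'" "g \<in> coalgebra_homs V D D'"
    then show "f \<boxdot> g \<in> coalgebra_homs V (coalgebra_tensor V C D) (coalgebra_tensor V C' D')"
      by (rule coalgebra_tensor_hom)
  next
    fix C C' C'' D D' D'' f f' g g'
    assume a: "C \<in> coalgebras V" "C' \<in> coalgebras V" "C'' \<in> coalgebras V"
      "D \<in> coalgebras V" "D' \<in> coalgebras V" "D'' \<in> coalgebras V"
      "f \<in> coalgebra_homs V C C'" "f' \<in> coalgebra_homs V C' C''"
      "g \<in> coalgebra_homs V D D'" "g' \<in> coalgebra_homs V D' D''"
    show "(f' \<cdot> f) \<boxdot> (g' \<cdot> g) = (f' \<boxdot> g') \<cdot> (f \<boxdot> g)"
      by (rule interchange[OF a(1-6)[THEN o] a(7-10)[THEN h]])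
  next
    fix C D E assume "C \<in> coalgebras V" "D \<in> coalgebras V" "E \<in> coalgebras V"
    then show "coalgebra_tensor V (coalgebra_tensor V C D) E = coalgebra_tensor V C (coalgebra_tensor V D E)"
      by (rule coalgebra_tensor_assoc)
  next
    fix C C' D D' E E' f g k
    assume a: "C \<in> coalgebras V" "C' \<in> coalgebras V" "D \<in> coalgebras V" "D' \<in> coalgebras V"
      "E \<in> coalgebras V" "E' \<in> coalgebras V"
      "f \<in> coalgebra_homs V C C'" "g \<in> coalgebra_homs V D D'" "k \<in> coalgebra_homs V E E'"
    show "(f \<boxdot> g) \<boxdot> k = f \<boxdot> (g \<boxdot> k)"
      by (rule tensor_hom_assoc[OF a(1-6)[THEN o] a(7-9)[THEN h]])
  qed
qed

end


section \<open>Opposites\<close>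

text \<open>The order of tensor factors is kept, so a comultiplication indexed by x, y, z becomes a
  multiplication with the same indices and the vertices need no reordering.\<close>

definition op_moncat :: "('o, 'a, 'm) moncat_scheme \<Rightarrow> ('o, 'a) moncat" where
  "op_moncat W = \<lparr>Obj = Obj W, Hom = (\<lambda>A B. Hom W B A), Idn = Idn W, Cmp = (\<lambda>g f. Cmp W f g),
     Unt = Unt W, TenO = TenO W, TenM = TenM W\<rparr>"

text \<open>Read backwards, \<open>\<c> B A\<close> runs from \<open>A \<boxtimes> B\<close> to
  \<open>B \<boxtimes> A\<close>, so the opposite is braided without inverting anything. It is also
  the braiding in \<open>algebra_tensor\<close>, which makes tensor products of algebras and of
  coalgebras correspond literally.\<close>

definition op_brmoncat :: "('o, 'a, 'm) brmoncat_scheme \<Rightarrow> ('o, 'a) brmoncat" where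
  "op_brmoncat V = \<lparr>Obj = Obj V, Hom = (\<lambda>A B. Hom V B A), Idn = Idn V, Cmp = (\<lambda>g f. Cmp V f g),
     Unt = Unt V, TenO = TenO V, TenM = TenM V, Br = (\<lambda>A B. Br V B A)\<rparr>"

lemma op_moncat_simps [simp]:
  "Obj (op_moncat W) = Obj W" "Hom (op_moncat W) = (\<lambda>A B. Hom W B A)" "Idn (op_moncat W) = Idn W"
  "Cmp (op_moncat W) = (\<lambda>g f. Cmp W f g)" "Unt (op_moncat W) = Unt W"
  "TenO (op_moncat W) = TenO W" "TenM (op_moncat W) = TenM W"
  by (simp_all add: op_moncat_def)

lemma op_brmoncat_simps [simp]:
  "Obj (op_brmoncat V) = Obj V" "Hom (op_brmoncat V) = (\<lambda>A B. Hom V B A)" "Idn (op_brmoncat V) = Idn V"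
  "Cmp (op_brmoncat V) = (\<lambda>g f. Cmp V f g)" "Unt (op_brmoncat V) = Unt V"
  "TenO (op_brmoncat V) = TenO V" "TenM (op_brmoncat V) = TenM V" "Br (op_brmoncat V) = (\<lambda>A B. Br V B A)"
  by (simp_all add: op_brmoncat_def)

context strict_monoidal_category
begin

text \<open>The axioms are stable under reversing arrows: the two identity laws for composition
  trade places, and associativity of composition is read backwards.\<close>

lemmas op_axioms =
  id_hom comp_hom comp_id_left comp_id_right comp_assoc[symmetric] unit_obj tensor_obj tensor_hom
  tensor_id interchange tensor_obj_assoc unit_tensor_obj tensor_unit_obj tensor_hom_assoc
  unit_tensor_hom tensor_unit_hom

lemma strict_monoidal_op: "strict_monoidal_category (op_moncat W)"
  by (unfold_locales, unfold op_moncat_simps; (rule op_axioms; assumption))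

end

text \<open>Injectivity of \<phi> is what reflects the strictness axioms, which are equations
  between objects; morphisms are shared by both categories. With the identity for \<phi>, the lemma
  also passes between records with and without a braiding.\<close>

lemma strict_monoidal_transport:
  assumes "strict_monoidal_category W'" and inj: "inj \<phi>"
    and "\<And>A. A \<in> Obj W \<longleftrightarrow> \<phi> A \<in> Obj W'" "\<And>A B. Hom W A B = Hom W' (\<phi> A) (\<phi> B)"
    "\<And>A. Idn W A = Idn W' (\<phi> A)" "Cmp W = Cmp W'" "TenM W = TenM W'" "\<phi> (Unt W) = Unt W'"
    "\<And>A B. \<phi> (TenO W A B) = TenO W' (\<phi> A) (\<phi> B)"
  shows "strict_monoidal_category W"
proof -
  interpret strict_monoidal_category W' by fact
  have eq: "A = B \<longleftrightarrow> \<phi> A = \<phi> B" for A B using inj by (auto dest: injD)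
  show ?thesis
    by (unfold_locales, unfold assms(3-) eq;
        (rule id_hom comp_hom comp_id_left comp_id_right comp_assoc unit_obj tensor_obj tensor_hom
          tensor_id interchange tensor_obj_assoc unit_tensor_obj tensor_unit_obj tensor_hom_assoc
          unit_tensor_hom tensor_unit_hom; assumption))
qed

context braided_strict_monoidal_category
begin

text \<open>Since \<open>Br\<close> exchanges its arguments, the two hexagon identities turn into
  each other, and the inverse of a crossing, read backwards, inverts the reversed crossing.\<close>

lemma braided_op: "braided_strict_monoidal_category (op_brmoncat V)"
proof (intro braided_strict_monoidal_category.intro braided_strict_monoidal_category_axioms.intro,
    unfold op_brmoncat_simps)
  show "strict_monoidal_category (op_brmoncat V)"
    by (rule strict_monoidal_transport[OF strict_monoidal_op inj_on_id]) simp_all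
  show "\<exists>d \<in> Hom V (A \<boxtimes> B) (B \<boxtimes> A). \<c> B A \<cdot> d = \<i> (A \<boxtimes> B) \<and> d \<cdot> \<c> B A = \<i> (B \<boxtimes> A)"
    if "A \<in> Obj V" "B \<in> Obj V" for A B
    using braid_iso[OF that(2,1)] by blast
  show "(f \<boxdot> g) \<cdot> \<c> B' A' = \<c> B A \<cdot> (g \<boxdot> f)"
    if "A \<in> Obj V" "A' \<in> Obj V" "B \<in> Obj V" "B' \<in> Obj V" "f \<in> Hom V A' A" "g \<in> Hom V B' B"
    for A A' B B' f g
    by (rule braid_natural[OF that(4,3,2,1,6,5), symmetric])
qed (rule braid_hom braid_tensor_left braid_tensor_right; assumption)+

end

section \<open>Algebras as coalgebras in the opposite category\<close>

definition op_alg :: "('o, 'a) alg \<Rightarrow> ('o, 'a) coalg" where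
  "op_alg A = \<lparr>cca = aca A, cmul = amul A, ceps = aeta A\<rparr>"

lemma inj_op_alg: "inj op_alg"
  by (rule injI) (simp add: op_alg_def)

text \<open>Passing to \<open>op_brmoncat V\<close> turns algebra homomorphisms around; the outer
  \<open>op_moncat\<close> restores their direction.\<close>

lemma (in braided_strict_monoidal_category) strict_monoidal_Alg: "strict_monoidal_category (Alg V)"
proof (rule strict_monoidal_transport[OF _ inj_op_alg])
  let ?W = "op_moncat (Coalg (op_brmoncat V))"
  interpret op: braided_strict_monoidal_category "op_brmoncat V" by (rule braided_op)
  interpret coalg: strict_monoidal_category "Coalg (op_brmoncat V)" by (rule op.strict_monoidal_Coalg)
  show "strict_monoidal_category ?W" by (rule coalg.strict_monoidal_op)
qed (auto simp: Alg_def Coalg_def op_alg_def algebras_def coalgebras_def algebra_homs_def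
    coalgebra_homs_def algebra_tensor_def coalgebra_tensor_def)


section \<open>Reflecting 2-category axioms\<close>

text \<open>Equations between 1-cells are tested after applying \<open>F\<close>, by injectivity;
  equations between 2-cells are those of \<open>Y\<close>, because \<open>F\<close> fixes 2-cells
  and their sets coincide. The same coincidence yields closure of the 2-cells of \<open>X\<close>,
  whereas \<open>F\<close> may fail to be full on 1-cells, so their closure is assumed.\<close>

lemma two_functor_reflect:
  fixes X :: "('c, 'f, 't) twocat" and Y :: "('d, 'g, 't) twocat"
    and F :: "('c, 'f, 't, 'd, 'g, 't) twofun"
  assumes Y: "two_category Y"
    and F2 [simp]: "\<And>A B f g \<alpha>. Fun2 F A B f g \<alpha> = \<alpha>"
    and c0: "\<And>A. A \<in> Cell0 X \<Longrightarrow> Fun0 F A \<in> Cell0 Y"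
    and c1: "\<And>A B f. \<lbrakk>A \<in> Cell0 X; B \<in> Cell0 X; f \<in> Cell1 X A B\<rbrakk>
      \<Longrightarrow> Fun1 F A B f \<in> Cell1 Y (Fun0 F A) (Fun0 F B)"
    and inj: "\<And>A B f g. \<lbrakk>A \<in> Cell0 X; B \<in> Cell0 X; f \<in> Cell1 X A B; g \<in> Cell1 X A B;
      Fun1 F A B f = Fun1 F A B g\<rbrakk> \<Longrightarrow> f = g"
    and c2: "\<And>A B f g. \<lbrakk>A \<in> Cell0 X; B \<in> Cell0 X; f \<in> Cell1 X A B; g \<in> Cell1 X A B\<rbrakk>
      \<Longrightarrow> Cell2 X A B f g = Cell2 Y (Fun0 F A) (Fun0 F B) (Fun1 F A B f) (Fun1 F A B g)"
    and i1c: "\<And>A. A \<in> Cell0 X \<Longrightarrow> Id1 X A \<in> Cell1 X A A"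
    and c1c: "\<And>A B C f g. \<lbrakk>A \<in> Cell0 X; B \<in> Cell0 X; C \<in> Cell0 X; f \<in> Cell1 X A B; g \<in> Cell1 X B C\<rbrakk>
      \<Longrightarrow> Comp1 X A B C g f \<in> Cell1 X A C"
    and i1: "\<And>A. A \<in> Cell0 X \<Longrightarrow> Fun1 F A A (Id1 X A) = Id1 Y (Fun0 F A)"
    and cp: "\<And>A B C f g. \<lbrakk>A \<in> Cell0 X; B \<in> Cell0 X; C \<in> Cell0 X; f \<in> Cell1 X A B; g \<in> Cell1 X B C\<rbrakk>
      \<Longrightarrow> Fun1 F A C (Comp1 X A B C g f)
        = Comp1 Y (Fun0 F A) (Fun0 F B) (Fun0 F C) (Fun1 F B C g) (Fun1 F A B f)"
    and i2: "\<And>A B f. \<lbrakk>A \<in> Cell0 X; B \<in> Cell0 X; f \<in> Cell1 X A B\<rbrakk>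
      \<Longrightarrow> Id2 X A B f = Id2 Y (Fun0 F A) (Fun0 F B) (Fun1 F A B f)"
    and vc: "\<And>A B f g h \<alpha> \<beta>. \<lbrakk>A \<in> Cell0 X; B \<in> Cell0 X;
        f \<in> Cell1 X A B; g \<in> Cell1 X A B; h \<in> Cell1 X A B;
        \<alpha> \<in> Cell2 X A B f g; \<beta> \<in> Cell2 X A B g h\<rbrakk>
      \<Longrightarrow> VComp X A B f g h \<beta> \<alpha>
        = VComp Y (Fun0 F A) (Fun0 F B) (Fun1 F A B f) (Fun1 F A B g) (Fun1 F A B h) \<beta> \<alpha>"
    and hc: "\<And>A B C f f' g g' \<alpha> \<beta>. \<lbrakk>A \<in> Cell0 X; B \<in> Cell0 X; C \<in> Cell0 X;
        f \<in> Cell1 X A B; f' \<in> Cell1 X A B; g \<in> Cell1 X B C; g' \<in> Cell1 X B C;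
        \<alpha> \<in> Cell2 X A B f f'; \<beta> \<in> Cell2 X B C g g'\<rbrakk>
      \<Longrightarrow> HComp X A B C f f' g g' \<alpha> \<beta>
        = HComp Y (Fun0 F A) (Fun0 F B) (Fun0 F C)
            (Fun1 F A B f) (Fun1 F A B f') (Fun1 F B C g) (Fun1 F B C g') \<alpha> \<beta>"
  shows "two_functor X Y F"
proof -
  interpret Y: two_category Y by (rule Y)
  have v: "VComp X A B f g h \<beta> \<alpha> \<in> Cell2 X A B f h"
    if "A \<in> Cell0 X" "B \<in> Cell0 X" "f \<in> Cell1 X A B" "g \<in> Cell1 X A B" "h \<in> Cell1 X A B"
      "\<alpha> \<in> Cell2 X A B f g" "\<beta> \<in> Cell2 X A B g h" for A B f g h \<alpha> \<beta>
    using that Y.vcomp_cell[of "Fun0 F A" "Fun0 F B" "Fun1 F A B f" "Fun1 F A B g" "Fun1 F A B h" \<alpha> \<beta>]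
    by (simp add: vc) (simp add: c2 c0 c1)
  have h: "HComp X A B C f f' g g' \<alpha> \<beta> \<in> Cell2 X A C (Comp1 X A B C g f) (Comp1 X A B C g' f')"
    if "A \<in> Cell0 X" "B \<in> Cell0 X" "C \<in> Cell0 X" "f \<in> Cell1 X A B" "f' \<in> Cell1 X A B"
      "g \<in> Cell1 X B C" "g' \<in> Cell1 X B C" "\<alpha> \<in> Cell2 X A B f f'" "\<beta> \<in> Cell2 X B C g g'"
    for A B C f f' g g' \<alpha> \<beta>
    using that Y.hcomp_cell[of "Fun0 F A" "Fun0 F B" "Fun0 F C" "Fun1 F A B f" "Fun1 F A B f'"
        "Fun1 F B C g" "Fun1 F B C g'" \<alpha> \<beta>]
    by (simp add: hc) (simp add: c2 c0 c1 c1c cp)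
  have id2: "Id2 X A B f \<in> Cell2 X A B f f"
    if "A \<in> Cell0 X" "B \<in> Cell0 X" "f \<in> Cell1 X A B" for A B f
    using that Y.id2_cell[of "Fun0 F A" "Fun0 F B" "Fun1 F A B f"] by (simp add: i2 c2 c0 c1)
  interpret X: two_category X
  proof
    fix A B f assume a: "A \<in> Cell0 X" "B \<in> Cell0 X" "f \<in> Cell1 X A B"
    show "Comp1 X A B B (Id1 X B) f = f" "Comp1 X A A B f (Id1 X A) = f"
      using a by (auto intro!: inj[OF a(1,2)] simp: c1c i1c cp i1 c0 c1 Y.comp1_id_left Y.comp1_id_right)
  next
    fix A B C D f g h
    assume a: "A \<in> Cell0 X" "B \<in> Cell0 X" "C \<in> Cell0 X" "D \<in> Cell0 X"
      "f \<in> Cell1 X A B" "g \<in> Cell1 X B C" "h \<in> Cell1 X C D"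
    show "Comp1 X A B D (Comp1 X B C D h g) f = Comp1 X A C D h (Comp1 X A B C g f)"
      using a by (intro inj[OF a(1,4)]) (simp_all add: c1c cp c0 c1 Y.comp1_assoc)
  next
    fix A B f g \<alpha>
    assume a: "A \<in> Cell0 X" "B \<in> Cell0 X" "f \<in> Cell1 X A B" "g \<in> Cell1 X A B" "\<alpha> \<in> Cell2 X A B f g"
    have \<alpha>: "\<alpha> \<in> Cell2 Y (Fun0 F A) (Fun0 F B) (Fun1 F A B f) (Fun1 F A B g)"
      using a by (simp add: c2)
    \<comment> \<open>The two rounds of simplification are deliberate: \<open>vc\<close> has to
      apply while its argument is still \<open>Id2 X\<close>, known to be a 2-cell by
      \<open>id2\<close>, before \<open>i2\<close> rewrites it into an identity of
      \<open>Y\<close>.\<close>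
    show "VComp X A B f g g (Id2 X A B g) \<alpha> = \<alpha>"
      using a Y.vcomp_id_left[OF _ _ _ _ \<alpha>] by (simp add: vc id2) (simp add: i2 c0 c1)
    show "VComp X A B f f g \<alpha> (Id2 X A B f) = \<alpha>"
      using a Y.vcomp_id_right[OF _ _ _ _ \<alpha>] by (simp add: vc id2) (simp add: i2 c0 c1)
    show "HComp X A A B (Id1 X A) (Id1 X A) f g (Id2 X A A (Id1 X A)) \<alpha> = \<alpha>"
      using a Y.hcomp_id_left[OF _ _ _ _ \<alpha>] by (simp add: hc i1c id2) (simp add: i1c i2 i1 c0 c1)
    show "HComp X A B B f g (Id1 X B) (Id1 X B) \<alpha> (Id2 X B B (Id1 X B)) = \<alpha>"
      using a Y.hcomp_id_right[OF _ _ _ _ \<alpha>] by (simp add: hc i1c id2) (simp add: i1c i2 i1 c0 c1)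
  next
    fix A B f g h i \<alpha> \<beta> \<gamma>
    assume a: "A \<in> Cell0 X" "B \<in> Cell0 X"
      "f \<in> Cell1 X A B" "g \<in> Cell1 X A B" "h \<in> Cell1 X A B" "i \<in> Cell1 X A B"
      "\<alpha> \<in> Cell2 X A B f g" "\<beta> \<in> Cell2 X A B g h" "\<gamma> \<in> Cell2 X A B h i"
    have b: "\<alpha> \<in> Cell2 Y (Fun0 F A) (Fun0 F B) (Fun1 F A B f) (Fun1 F A B g)"
      "\<beta> \<in> Cell2 Y (Fun0 F A) (Fun0 F B) (Fun1 F A B g) (Fun1 F A B h)"
      "\<gamma> \<in> Cell2 Y (Fun0 F A) (Fun0 F B) (Fun1 F A B h) (Fun1 F A B i)"
      using a by (simp_all add: c2)
    \<comment> \<open>For the same reason nested composites are translated from the outside inwards: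
      the inner one is recognised as a 2-cell of \<open>X\<close> only as long as it is written in
      \<open>X\<close>.\<close>
    have "VComp X A B f g i (VComp X A B g h i \<gamma> \<beta>) \<alpha>
      = VComp Y (Fun0 F A) (Fun0 F B) (Fun1 F A B f) (Fun1 F A B g) (Fun1 F A B i) (VComp X A B g h i \<gamma> \<beta>) \<alpha>"
      by (rule vc[OF a(1,2,3,4,6,7) v[OF a(1,2,4,5,6,8,9)]])
    moreover have "VComp X A B f h i \<gamma> (VComp X A B f g h \<beta> \<alpha>)
      = VComp Y (Fun0 F A) (Fun0 F B) (Fun1 F A B f) (Fun1 F A B h) (Fun1 F A B i) \<gamma> (VComp X A B f g h \<beta> \<alpha>)"
      by (rule vc[OF a(1,2,3,5,6) v[OF a(1,2,3,4,5,7,8)] a(9)])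
    ultimately show "VComp X A B f g i (VComp X A B g h i \<gamma> \<beta>) \<alpha>
      = VComp X A B f h i \<gamma> (VComp X A B f g h \<beta> \<alpha>)"
      using a by (simp add: vc[of A B g h i \<beta> \<gamma>] vc[of A B f g h \<alpha> \<beta>] c0 c1 Y.vcomp_assoc[OF _ _ _ _ _ _ b])
  next
    fix A B C D f f' g g' h h' \<alpha> \<beta> \<gamma>
    assume a: "A \<in> Cell0 X" "B \<in> Cell0 X" "C \<in> Cell0 X" "D \<in> Cell0 X"
      and f: "f \<in> Cell1 X A B" "f' \<in> Cell1 X A B" and g: "g \<in> Cell1 X B C" "g' \<in> Cell1 X B C"
      and k: "h \<in> Cell1 X C D" "h' \<in> Cell1 X C D"
      and \<alpha>: "\<alpha> \<in> Cell2 X A B f f'" and \<beta>: "\<beta> \<in> Cell2 X B C g g'" and \<gamma>: "\<gamma> \<in> Cell2 X C D h h'"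
    have b: "\<alpha> \<in> Cell2 Y (Fun0 F A) (Fun0 F B) (Fun1 F A B f) (Fun1 F A B f')"
      "\<beta> \<in> Cell2 Y (Fun0 F B) (Fun0 F C) (Fun1 F B C g) (Fun1 F B C g')"
      "\<gamma> \<in> Cell2 Y (Fun0 F C) (Fun0 F D) (Fun1 F C D h) (Fun1 F C D h')"
      using a f g k \<alpha> \<beta> \<gamma> by (simp_all add: c2)
    note c = hc[OF a(1,3,4) c1c[OF a(1-3) f(1) g(1)] c1c[OF a(1-3) f(2) g(2)] k h[OF a(1-3) f g \<alpha> \<beta>] \<gamma>]
      hc[OF a(1,2,4) f c1c[OF a(2-4) g(1) k(1)] c1c[OF a(2-4) g(2) k(2)] \<alpha> h[OF a(2-4) g k \<beta> \<gamma>]]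
    show "HComp X A C D (Comp1 X A B C g f) (Comp1 X A B C g' f') h h' (HComp X A B C f f' g g' \<alpha> \<beta>) \<gamma>
        = HComp X A B D f f' (Comp1 X B C D h g) (Comp1 X B C D h' g') \<alpha> (HComp X B C D g g' h h' \<beta> \<gamma>)"
      unfolding c unfolding hc[OF a(1-3) f g \<alpha> \<beta>] hc[OF a(2-4) g k \<beta> \<gamma>]
      using a f g k by (simp add: cp c0 c1 Y.hcomp_assoc[OF _ _ _ _ _ _ _ _ _ _ b])
  next
    fix A B C f g
    assume a: "A \<in> Cell0 X" "B \<in> Cell0 X" "C \<in> Cell0 X" "f \<in> Cell1 X A B" "g \<in> Cell1 X B C"
    show "HComp X A B C f f g g (Id2 X A B f) (Id2 X B C g) = Id2 X A C (Comp1 X A B C g f)"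
      using a by (simp add: hc id2) (simp add: i2 c1c cp c0 c1 Y.hcomp_id2)
  next
    fix A B C f f' f'' g g' g'' \<alpha> \<alpha>' \<beta> \<beta>'
    assume a: "A \<in> Cell0 X" "B \<in> Cell0 X" "C \<in> Cell0 X"
      and f: "f \<in> Cell1 X A B" "f' \<in> Cell1 X A B" "f'' \<in> Cell1 X A B"
      and g: "g \<in> Cell1 X B C" "g' \<in> Cell1 X B C" "g'' \<in> Cell1 X B C"
      and \<alpha>: "\<alpha> \<in> Cell2 X A B f f'" "\<alpha>' \<in> Cell2 X A B f' f''"
      and \<beta>: "\<beta> \<in> Cell2 X B C g g'" "\<beta>' \<in> Cell2 X B C g' g''"
    have b: "\<alpha> \<in> Cell2 Y (Fun0 F A) (Fun0 F B) (Fun1 F A B f) (Fun1 F A B f')"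
      "\<alpha>' \<in> Cell2 Y (Fun0 F A) (Fun0 F B) (Fun1 F A B f') (Fun1 F A B f'')"
      "\<beta> \<in> Cell2 Y (Fun0 F B) (Fun0 F C) (Fun1 F B C g) (Fun1 F B C g')"
      "\<beta>' \<in> Cell2 Y (Fun0 F B) (Fun0 F C) (Fun1 F B C g') (Fun1 F B C g'')"
      using a f g \<alpha> \<beta> by (simp_all add: c2)
    note cs = c1c[OF a f(1) g(1)] c1c[OF a f(2) g(2)] c1c[OF a f(3) g(3)]
    note c = hc[OF a f(1,3) g(1,3) v[OF a(1,2) f \<alpha>] v[OF a(2,3) g \<beta>]]
      vc[OF a(1,3) cs h[OF a f(1,2) g(1,2) \<alpha>(1) \<beta>(1)] h[OF a f(2,3) g(2,3) \<alpha>(2) \<beta>(2)]]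
    show "HComp X A B C f f'' g g'' (VComp X A B f f' f'' \<alpha>' \<alpha>) (VComp X B C g g' g'' \<beta>' \<beta>)
      = VComp X A C (Comp1 X A B C g f) (Comp1 X A B C g' f') (Comp1 X A B C g'' f'')
          (HComp X A B C f' f'' g' g'' \<alpha>' \<beta>') (HComp X A B C f f' g g' \<alpha> \<beta>)"
      unfolding c unfolding vc[OF a(1,2) f \<alpha>] vc[OF a(2,3) g \<beta>] hc[OF a f(1,2) g(1,2) \<alpha>(1) \<beta>(1)]
        hc[OF a f(2,3) g(2,3) \<alpha>(2) \<beta>(2)]
      using a f g by (simp add: cp c0 c1 Y.hcomp_vcomp[OF _ _ _ _ _ _ _ _ _ b])
  qed (rule i1c c1c v h id2; assumption)+
  show ?thesis
    by unfold_locales (simp_all add: c0 c1 c2 i1 cp i2 vc hc)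
qed

text \<open>Only the 2-cells are turned around. The 1-cells of dual \<open>W\<close>-categories
  already have the direction of those over the opposite of \<open>W\<close>.\<close>

definition co_twocat :: "('c, 'f, 't) twocat \<Rightarrow> ('c, 'f, 't) twocat" where
  "co_twocat X = \<lparr>Cell0 = Cell0 X, Cell1 = Cell1 X, Cell2 = (\<lambda>A B f g. Cell2 X A B g f),
     Id1 = Id1 X, Comp1 = Comp1 X, Id2 = Id2 X,
     VComp = (\<lambda>A B f g h \<beta> \<alpha>. VComp X A B h g f \<alpha> \<beta>),
     HComp = (\<lambda>A B C f f' g g' \<alpha> \<beta>. HComp X A B C f' f g' g \<alpha> \<beta>)\<rparr>"

lemma co_twocat_simps [simp]:
  "Cell0 (co_twocat X) = Cell0 X" "Cell1 (co_twocat X) = Cell1 X"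
  "Cell2 (co_twocat X) = (\<lambda>A B f g. Cell2 X A B g f)" "Id1 (co_twocat X) = Id1 X"
  "Comp1 (co_twocat X) = Comp1 X" "Id2 (co_twocat X) = Id2 X"
  "VComp (co_twocat X) = (\<lambda>A B f g h \<beta> \<alpha>. VComp X A B h g f \<alpha> \<beta>)"
  "HComp (co_twocat X) = (\<lambda>A B C f f' g g' \<alpha> \<beta>. HComp X A B C f' f g' g \<alpha> \<beta>)"
  by (simp_all add: co_twocat_def)

lemma (in two_category) two_category_co: "two_category (co_twocat X)"
  by (unfold_locales, unfold co_twocat_simps;
      (rule id1_cell comp1_cell comp1_id_left comp1_id_right comp1_assoc id2_cell vcomp_cell
        vcomp_id_left vcomp_id_right vcomp_assoc[symmetric] hcomp_cell hcomp_id_left hcomp_id_right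
        hcomp_assoc hcomp_id2 hcomp_vcomp; assumption))


section \<open>The 2-category of dual \<open>W\<close>-categories\<close>

definition op_dwcat :: "('x, 'o, 'a) dwcat \<Rightarrow> ('x, 'o, 'a) wcat" where
  "op_dwcat C = \<lparr>vtx = dvtx C, hob = dhob C, mul = dcomul C, unt = dcounit C\<rparr>"

lemma op_dwcat_simps [simp]:
  "vtx (op_dwcat C) = dvtx C" "hob (op_dwcat C) = dhob C" "mul (op_dwcat C) = dcomul C"
  "unt (op_dwcat C) = dcounit C"
  by (simp_all add: op_dwcat_def)

lemma dwcats_op: "C \<in> dwcats W \<longleftrightarrow> op_dwcat C \<in> wcats (op_moncat W)"
  by (simp add: dwcats_def wcats_def)

lemma dwfuns_op: "dwfuns W C D = wfuns (op_moncat W) (op_dwcat C) (op_dwcat D)"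
  by (simp add: dwfuns_def wfuns_def)

lemma dwtrans_op: "dwtrans W C D f g = wtrans (op_moncat W) (op_dwcat C) (op_dwcat D) g f"
  by (simp add: dwtrans_def wtrans_def)

text \<open>\<open>op_dwcat\<close> only renames fields and changes neither 1-cells nor 2-cells, so
  reflection applies, with the reversed 2-category over the opposite of \<open>W\<close> as
  target.\<close>

lemma (in strict_monoidal_category) two_category_DWCat:
  "two_category (DWCat W :: (('x, 'o, 'a) dwcat, _, _) twocat)"
proof -
  interpret op: strict_monoidal_category "op_moncat W" by (rule strict_monoidal_op)
  interpret wcat: two_category "WCat (op_moncat W) :: (('x, 'o, 'a) wcat, _, _) twocat"
    by (rule op.two_category_WCat)
  have cells [simp]: "Cell0 (DWCat W) = dwcats W" "Cell1 (DWCat W) = dwfuns W"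
    "Cell2 (DWCat W) = dwtrans W"
    "Cell0 (WCat (op_moncat W)) = wcats (op_moncat W)" "Cell1 (WCat (op_moncat W)) = wfuns (op_moncat W)"
    "Cell2 (WCat (op_moncat W)) = wtrans (op_moncat W)"
    by (auto simp: DWCat_def WCat_def)
  have id1: "Id1 (DWCat W) C = Id1 (WCat (op_moncat W)) (op_dwcat C)" for C :: "('x, 'o, 'a) dwcat"
    by (simp add: DWCat_def WCat_def)
  have comp1: "Comp1 (DWCat W) C D E g f = Comp1 (WCat (op_moncat W)) (op_dwcat C) (op_dwcat D) (op_dwcat E) g f"
    for C D E :: "('x, 'o, 'a) dwcat" and f g
    by (simp add: DWCat_def WCat_def)
  text \<open>The two formulas for the horizontal composite differ by the naturality of \<open>\<beta>\<close>.\<close>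
  have hcomp: "HComp (DWCat W) C D E f f' g g' \<alpha> \<beta>
      = HComp (WCat (op_moncat W)) (op_dwcat C) (op_dwcat D) (op_dwcat E) f' f g' g \<alpha> \<beta>"
    if "C \<in> dwcats W" "D \<in> dwcats W" "E \<in> dwcats W" "f \<in> dwfuns W C D" "f' \<in> dwfuns W C D"
      "g \<in> dwfuns W D E" "g' \<in> dwfuns W D E" "\<alpha> \<in> dwtrans W C D f f'" "\<beta> \<in> dwtrans W D E g g'"
    for C D E :: "('x, 'o, 'a) dwcat" and f f' g g' \<alpha> \<beta>
  proof -
    note op = that[unfolded dwcats_op dwfuns_op dwtrans_op]
    have "HComp (DWCat W) C D E f f' g g' \<alpha> \<beta> x
      = HComp (WCat (op_moncat W)) (op_dwcat C) (op_dwcat D) (op_dwcat E) f' f g' g \<alpha> \<beta> x"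
      if x: "x \<in> dvtx C" for x
      using x op.wtrans_star[OF op(9,7,6,3) op.wtrans_elem[OF op(8,2,5,4)], of x]
      by (simp add: DWCat_def op.WCat_hcomp) (simp add: op.star_def)
    then show ?thesis
      by (intro extensionalityI[of _ "dvtx C"]) (auto simp: DWCat_def WCat_def)
  qed
  have "two_functor (DWCat W) (co_twocat (WCat (op_moncat W)))
    \<lparr>Fun0 = op_dwcat :: ('x, 'o, 'a) dwcat \<Rightarrow> _, Fun1 = (\<lambda>_ _ f. f), Fun2 = (\<lambda>_ _ _ _ \<alpha>. \<alpha>)\<rparr>"
  proof (rule two_functor_reflect[OF wcat.two_category_co])
    fix C D E :: "('x, 'o, 'a) dwcat" and f g
    show "C \<in> Cell0 (DWCat W) \<Longrightarrow> Id1 (DWCat W) C \<in> Cell1 (DWCat W) C C"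
      using wcat.id1_cell[of "op_dwcat C"] by (simp add: id1 dwcats_op dwfuns_op)
    show "Comp1 (DWCat W) C D E g f \<in> Cell1 (DWCat W) C E"
      if "C \<in> Cell0 (DWCat W)" "D \<in> Cell0 (DWCat W)" "E \<in> Cell0 (DWCat W)"
        "f \<in> Cell1 (DWCat W) C D" "g \<in> Cell1 (DWCat W) D E"
      using that wcat.comp1_cell[of "op_dwcat C" "op_dwcat D" "op_dwcat E" f g]
      by (simp add: comp1 dwcats_op dwfuns_op)
  qed (simp_all add: dwcats_op[symmetric] dwfuns_op[symmetric] dwtrans_op[symmetric] id1 comp1 hcomp,
      simp_all add: DWCat_def WCat_def)
  \<comment> \<open>A 2-functor carries the 2-category axioms of its source, and these are the
    goal.\<close>
  then show ?thesis by (rule two_functor.axioms(1))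
qed


section \<open>The 2-functors \<open>K\<close>\<close>

context group
begin

lemma ldiv_mult:
  "\<lbrakk>x \<in> carrier G; y \<in> carrier G; z \<in> carrier G\<rbrakk>
    \<Longrightarrow> (inv x \<otimes> y) \<otimes> (inv y \<otimes> z) = inv x \<otimes> z"
  by (simp add: m_assoc) (simp add: m_assoc[symmetric])

lemma inv_ldiv: "\<lbrakk>x \<in> carrier G; y \<in> carrier G\<rbrakk> \<Longrightarrow> inv (inv x \<otimes> y) = inv y \<otimes> x"
  by (simp add: inv_mult_group)

lemma ldiv_mult_right: "\<lbrakk>x \<in> carrier G; y \<in> carrier G\<rbrakk> \<Longrightarrow> inv x \<otimes> (x \<otimes> y) = y"
  by (simp add: m_assoc[symmetric])

lemma hom_ldiv:
  assumes "group H" "f \<in> hom G H" "x \<in> carrier G" "y \<in> carrier G"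
  shows "f (inv x \<otimes> y) = inv\<^bsub>H\<^esub> (f x) \<otimes>\<^bsub>H\<^esub> f y"
proof -
  interpret group_hom G H f
    using assms by (simp add: group_hom_def group_hom_axioms_def)
  show ?thesis using assms by simp
qed

end

lemma gralgs_group: "A \<in> gralgs W \<Longrightarrow> group (grp A)"
  by (simp add: gralgs_def ext_group_def Let_def)

lemma K_alg_simps [simp]:
  "vtx (Fun0 K_alg A) = carrier (grp A)"
  "hob (Fun0 K_alg A) = (\<lambda>\<sigma>\<in>carrier (grp A). \<lambda>\<tau>\<in>carrier (grp A). gob A (ldiv (grp A) \<sigma> \<tau>))"
  "mul (Fun0 K_alg A) = (\<lambda>\<sigma>\<in>carrier (grp A). \<lambda>\<rho>\<in>carrier (grp A). \<lambda>\<tau>\<in>carrier (grp A).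
     gmul A (ldiv (grp A) \<sigma> \<rho>) (ldiv (grp A) \<rho> \<tau>))"
  "unt (Fun0 K_alg A) = (\<lambda>\<sigma>\<in>carrier (grp A). gunt A)"
  "vmap (Fun1 K_alg A B f) = gmap f"
  "hmap (Fun1 K_alg A B f) = (\<lambda>\<sigma>\<in>carrier (grp A). \<lambda>\<tau>\<in>carrier (grp A). cmap f (ldiv (grp A) \<sigma> \<tau>))"
  "Fun2 K_alg A B f g \<alpha> = \<alpha>"
  by (simp_all add: K_alg_def Let_def)

lemma K_coalg_simps [simp]:
  "dvtx (Fun0 K_coalg C) = carrier (cgrp C)"
  "dhob (Fun0 K_coalg C) = (\<lambda>\<sigma>\<in>carrier (cgrp C). \<lambda>\<tau>\<in>carrier (cgrp C). cob C (ldiv (cgrp C) \<sigma> \<tau>))"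
  "dcomul (Fun0 K_coalg C) = (\<lambda>\<sigma>\<in>carrier (cgrp C). \<lambda>\<rho>\<in>carrier (cgrp C). \<lambda>\<tau>\<in>carrier (cgrp C).
     gcomul C (ldiv (cgrp C) \<sigma> \<rho>) (ldiv (cgrp C) \<rho> \<tau>))"
  "dcounit (Fun0 K_coalg C) = (\<lambda>\<sigma>\<in>carrier (cgrp C). gcounit C)"
  "vmap (Fun1 K_coalg C D f) = gmap f"
  "hmap (Fun1 K_coalg C D f) = (\<lambda>\<sigma>\<in>carrier (cgrp C). \<lambda>\<tau>\<in>carrier (cgrp C). cmap f (ldiv (cgrp C) \<sigma> \<tau>))"
  "Fun2 K_coalg C D f g \<alpha> = \<alpha>"
  by (simp_all add: K_coalg_def Let_def)

section \<open>K on graded algebras\<close>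

lemma K_alg_cell0:
  assumes A: "A \<in> gralgs W"
  shows "Fun0 K_alg A \<in> wcats W"
proof -
  interpret group "grp A" using A by (rule gralgs_group)
  have hom: "gmul A \<sigma> \<tau> \<in> Hom W (TenO W (gob A \<sigma>) (gob A \<tau>)) (gob A (\<sigma> \<otimes>\<^bsub>grp A\<^esub> \<tau>))"
    if "\<sigma> \<in> carrier (grp A)" "\<tau> \<in> carrier (grp A)" for \<sigma> \<tau>
    using A that by (auto simp: gralgs_def Let_def PiE_iff)
  have mul: "gmul A (ldiv (grp A) \<sigma> \<rho>) (ldiv (grp A) \<rho> \<tau>)
      \<in> Hom W (TenO W (gob A (ldiv (grp A) \<sigma> \<rho>)) (gob A (ldiv (grp A) \<rho> \<tau>))) (gob A (ldiv (grp A) \<sigma> \<tau>))"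
    if "\<sigma> \<in> carrier (grp A)" "\<rho> \<in> carrier (grp A)" "\<tau> \<in> carrier (grp A)" for \<sigma> \<rho> \<tau>
    using hom[of "ldiv (grp A) \<sigma> \<rho>" "ldiv (grp A) \<rho> \<tau>"] that by (simp add: ldiv_mult)
  have assoc: "Cmp W (gmul A (ldiv (grp A) x z) (ldiv (grp A) z u))
        (TenM W (gmul A (ldiv (grp A) x y) (ldiv (grp A) y z)) (Idn W (gob A (ldiv (grp A) z u))))
      = Cmp W (gmul A (ldiv (grp A) x y) (ldiv (grp A) y u))
        (TenM W (Idn W (gob A (ldiv (grp A) x y))) (gmul A (ldiv (grp A) y z) (ldiv (grp A) z u)))"
    if x: "x \<in> carrier (grp A)" and y: "y \<in> carrier (grp A)" and z: "z \<in> carrier (grp A)"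
      and u: "u \<in> carrier (grp A)" for x y z u
  proof -
    have "Cmp W (gmul A (\<sigma> \<otimes>\<^bsub>grp A\<^esub> \<tau>) \<rho>) (TenM W (gmul A \<sigma> \<tau>) (Idn W (gob A \<rho>)))
        = Cmp W (gmul A \<sigma> (\<tau> \<otimes>\<^bsub>grp A\<^esub> \<rho>)) (TenM W (Idn W (gob A \<sigma>)) (gmul A \<tau> \<rho>))"
      if "\<sigma> \<in> carrier (grp A)" "\<tau> \<in> carrier (grp A)" "\<rho> \<in> carrier (grp A)" for \<sigma> \<tau> \<rho>
      using A that by (auto simp: gralgs_def Let_def)
    from this[of "ldiv (grp A) x y" "ldiv (grp A) y z" "ldiv (grp A) z u"]
    show ?thesis using x y z u by (simp add: ldiv_mult)
  qed
  show ?thesis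
    using A mul assoc by (auto simp: wcats_def gralgs_def Let_def PiE_iff)
qed

text \<open>The morphism \<open>f\<^sub>\<sigma>\<close> is recovered from \<open>K(f)\<close> as \<open>K(f)\<close> at \<open>(e, \<sigma>)\<close>; this makes \<open>K\<close> locally
  injective and lets it reflect the axioms of 1-cells.\<close>

lemma K_alg_cell1_iff:
  assumes A: "A \<in> gralgs W" and B: "B \<in> gralgs W"
    and f: "gmap f \<in> hom (grp A) (grp B) \<inter> extensional (carrier (grp A))"
      "cmap f \<in> extensional (carrier (grp A))"
  shows "f \<in> gralg_homs W A B \<longleftrightarrow> Fun1 K_alg A B f \<in> wfuns W (Fun0 K_alg A) (Fun0 K_alg B)"
proof -
  interpret A: group "grp A" using A by (rule gralgs_group)
  interpret B: group "grp B" using B by (rule gralgs_group)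
  have f': "gmap f \<in> hom (grp A) (grp B)" using f by simp
  have fc: "gmap f x \<in> carrier (grp B)" if "x \<in> carrier (grp A)" for x
    using f' that by (rule hom_in_carrier)
  have f1: "gmap f \<one>\<^bsub>grp A\<^esub> = \<one>\<^bsub>grp B\<^esub>"
    by (rule hom_one[OF f']) unfold_locales
  note fl = A.hom_ldiv[OF B.group_axioms f']
  show ?thesis
  proof
    assume a: "f \<in> gralg_homs W A B"
    have hom: "cmap f \<sigma> \<in> Hom W (gob A \<sigma>) (gob B (gmap f \<sigma>))" if "\<sigma> \<in> carrier (grp A)" for \<sigma>
      using a that by (auto simp: gralg_homs_def Let_def PiE_iff)
    have mul: "Cmp W (cmap f (\<sigma> \<otimes>\<^bsub>grp A\<^esub> \<tau>)) (gmul A \<sigma> \<tau>)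
        = Cmp W (gmul B (gmap f \<sigma>) (gmap f \<tau>)) (TenM W (cmap f \<sigma>) (cmap f \<tau>))"
      if "\<sigma> \<in> carrier (grp A)" "\<tau> \<in> carrier (grp A)" for \<sigma> \<tau>
      using a that by (auto simp: gralg_homs_def Let_def)
    have 1: "cmap f (ldiv (grp A) x y)
        \<in> Hom W (gob A (ldiv (grp A) x y)) (gob B (ldiv (grp B) (gmap f x) (gmap f y)))"
      if "x \<in> carrier (grp A)" "y \<in> carrier (grp A)" for x y
      using hom[of "ldiv (grp A) x y"] that by (simp add: fl)
    have 2: "Cmp W (cmap f (ldiv (grp A) x z)) (gmul A (ldiv (grp A) x y) (ldiv (grp A) y z))
        = Cmp W (gmul B (ldiv (grp B) (gmap f x) (gmap f y)) (ldiv (grp B) (gmap f y) (gmap f z)))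
            (TenM W (cmap f (ldiv (grp A) x y)) (cmap f (ldiv (grp A) y z)))"
      if "x \<in> carrier (grp A)" "y \<in> carrier (grp A)" "z \<in> carrier (grp A)" for x y z
      using mul[of "ldiv (grp A) x y" "ldiv (grp A) y z"] that by (simp add: A.ldiv_mult fl)
    show "Fun1 K_alg A B f \<in> wfuns W (Fun0 K_alg A) (Fun0 K_alg B)"
      using a f fc 1 2 by (auto simp: wfuns_def gralg_homs_def Let_def PiE_iff)
  next
    assume a: "Fun1 K_alg A B f \<in> wfuns W (Fun0 K_alg A) (Fun0 K_alg B)"
    have hom: "cmap f (ldiv (grp A) x y)
        \<in> Hom W (gob A (ldiv (grp A) x y)) (gob B (ldiv (grp B) (gmap f x) (gmap f y)))"
      if "x \<in> carrier (grp A)" "y \<in> carrier (grp A)" for x y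
      using a that fc by (auto simp: wfuns_def PiE_iff)
    have mul: "Cmp W (cmap f (ldiv (grp A) x z)) (gmul A (ldiv (grp A) x y) (ldiv (grp A) y z))
        = Cmp W (gmul B (ldiv (grp B) (gmap f x) (gmap f y)) (ldiv (grp B) (gmap f y) (gmap f z)))
            (TenM W (cmap f (ldiv (grp A) x y)) (cmap f (ldiv (grp A) y z)))"
      if "x \<in> carrier (grp A)" "y \<in> carrier (grp A)" "z \<in> carrier (grp A)" for x y z
      using a that fc by (auto simp: wfuns_def)
    have 1: "cmap f \<sigma> \<in> Hom W (gob A \<sigma>) (gob B (gmap f \<sigma>))" if "\<sigma> \<in> carrier (grp A)" for \<sigma>
      using hom[of "\<one>\<^bsub>grp A\<^esub>" \<sigma>] that fc by (simp add: f1)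
    \<comment> \<open>The vertices \<open>e, \<sigma>, \<sigma>\<tau>\<close> have successive
      quotients \<sigma> and \<tau>, so every pair of degrees is reached.\<close>
    have 2: "Cmp W (cmap f (\<sigma> \<otimes>\<^bsub>grp A\<^esub> \<tau>)) (gmul A \<sigma> \<tau>)
        = Cmp W (gmul B (gmap f \<sigma>) (gmap f \<tau>)) (TenM W (cmap f \<sigma>) (cmap f \<tau>))"
      if "\<sigma> \<in> carrier (grp A)" "\<tau> \<in> carrier (grp A)" for \<sigma> \<tau>
      using mul[of "\<one>\<^bsub>grp A\<^esub>" \<sigma> "\<sigma> \<otimes>\<^bsub>grp A\<^esub> \<tau>"] that fc
      by (simp add: f1 A.ldiv_mult_right hom_mult[OF f'] B.ldiv_mult_right)
    have 3: "Cmp W (cmap f \<one>\<^bsub>grp A\<^esub>) (gunt A) = gunt B"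
      using a fc by (auto simp: wfuns_def dest!: bspec[of _ _ "\<one>\<^bsub>grp A\<^esub>"])
    show "f \<in> gralg_homs W A B"
      using f 1 2 3 by (auto simp: gralg_homs_def Let_def PiE_iff)
  qed
qed

lemma gralg_homs_ext:
  assumes "f \<in> gralg_homs W A B"
  shows "gmap f \<in> hom (grp A) (grp B) \<inter> extensional (carrier (grp A))"
    "cmap f \<in> extensional (carrier (grp A))"
  using assms by (auto simp: gralg_homs_def Let_def PiE_iff)

lemma gralg_homs_carrier:
  "\<lbrakk>f \<in> gralg_homs W A B; x \<in> carrier (grp A)\<rbrakk> \<Longrightarrow> gmap f x \<in> carrier (grp B)"
  using gralg_homs_ext[of f W A B] by (auto intro: hom_in_carrier)

text \<open>Formulated for the bare families over a group, so that it serves graded algebras and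
  graded coalgebras alike.\<close>

lemma K_inj:
  fixes f g :: "('g, 'a) grfun"
  assumes G: "group G" and f: "gmap f \<in> extensional (carrier G)" "cmap f \<in> extensional (carrier G)"
    and g: "gmap g \<in> extensional (carrier G)" "cmap g \<in> extensional (carrier G)"
    and v: "gmap f = gmap g"
    and eq: "(\<lambda>\<sigma>\<in>carrier G. \<lambda>\<tau>\<in>carrier G. cmap f (ldiv G \<sigma> \<tau>))
      = (\<lambda>\<sigma>\<in>carrier G. \<lambda>\<tau>\<in>carrier G. cmap g (ldiv G \<sigma> \<tau>))"
  shows "f = g"
proof -
  interpret group G by (rule G)
  have "cmap f \<sigma> = cmap g \<sigma>" if "\<sigma> \<in> carrier G" for \<sigma>
    using fun_cong[OF fun_cong[OF eq], of "\<one>\<^bsub>G\<^esub>" \<sigma>] that by simp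
  then have "cmap f = cmap g" using f g by (intro extensionalityI[of _ "carrier G"])
  then show ?thesis using v by simp
qed

text \<open>The two naturality conditions are the same formula; since \<open>f\<close> and
  \<open>g\<close> map into the carrier, the restricted abstractions in the image of K
  evaluate.\<close>

lemma gralg_trans_K:
  assumes A: "A \<in> gralgs W" and B: "B \<in> gralgs W"
    and f: "f \<in> gralg_homs W A B" and g: "g \<in> gralg_homs W A B"
  shows "gralg_trans W A B f g
    = wtrans W (Fun0 K_alg A) (Fun0 K_alg B) (Fun1 K_alg A B f) (Fun1 K_alg A B g)"
proof -
  note c = gralg_homs_carrier[OF f] gralg_homs_carrier[OF g]
  show ?thesis
    by (auto simp: gralg_trans_def wtrans_def Let_def PiE_iff c)
qed

lemma K_alg_id1: "Fun1 K_alg A A (Id1 (GrAlg W) A) = Id1 (WCat W) (Fun0 K_alg A)"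
  if "A \<in> gralgs W"
proof -
  interpret group "grp A" using that by (rule gralgs_group)
  show ?thesis by (rule wfun.equality) (auto simp: GrAlg_def WCat_def intro!: restrict_ext)
qed

text \<open>One side uses \<open>g\<close> in degree f(\<sigma>^-1 \<tau>), the other in degree
  f(\<sigma>)^-1 f(\<tau>). They agree because the vertex map of a graded 1-cell is a group
  morphism.\<close>

lemma K_alg_comp1: "Fun1 K_alg A C (Comp1 (GrAlg W) A B C g f)
    = Comp1 (WCat W) (Fun0 K_alg A) (Fun0 K_alg B) (Fun0 K_alg C) (Fun1 K_alg B C g) (Fun1 K_alg A B f)"
  if "A \<in> gralgs W" "B \<in> gralgs W" "f \<in> gralg_homs W A B"
proof -
  interpret A: group "grp A" using that(1) by (rule gralgs_group)
  interpret B: group "grp B" using that(2) by (rule gralgs_group)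
  have f: "gmap f \<in> hom (grp A) (grp B)" using gralg_homs_ext[OF that(3)] by simp
  show ?thesis
    by (rule wfun.equality)
      (auto simp: GrAlg_def WCat_def gralg_homs_carrier[OF that(3)] A.hom_ldiv[OF B.group_axioms f]
        intro!: restrict_ext)
qed

context strict_monoidal_category
begin

text \<open>The group part is checked directly; the conditions on components are pulled back from
  the identity 1-cell of \<open>WCat\<close> along \<open>K_alg_cell1_iff\<close>. Composites are
  treated in the same way.\<close>

lemma gralg_id1:
  assumes A: "A \<in> gralgs W"
  shows "Id1 (GrAlg W) A \<in> gralg_homs W A A"
proof -
  interpret group "grp A" using A by (rule gralgs_group)
  have "gmap (Id1 (GrAlg W) A) \<in> hom (grp A) (grp A) \<inter> extensional (carrier (grp A))"
    "cmap (Id1 (GrAlg W) A) \<in> extensional (carrier (grp A))"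
    by (auto simp: GrAlg_def hom_def)
  then show ?thesis
    using WCat_id1[OF K_alg_cell0[OF A]] by (simp add: K_alg_cell1_iff A K_alg_id1)
qed

lemma gralg_comp1:
  assumes A: "A \<in> gralgs W" and B: "B \<in> gralgs W" and C: "C \<in> gralgs W"
    and f: "f \<in> gralg_homs W A B" and g: "g \<in> gralg_homs W B C"
  shows "Comp1 (GrAlg W) A B C g f \<in> gralg_homs W A C"
proof -
  interpret group "grp A" using A by (rule gralgs_group)
  have "gmap (Comp1 (GrAlg W) A B C g f) \<in> hom (grp A) (grp C) \<inter> extensional (carrier (grp A))"
    "cmap (Comp1 (GrAlg W) A B C g f) \<in> extensional (carrier (grp A))"
    using gralg_homs_ext[OF f] gralg_homs_ext[OF g] by (auto simp: GrAlg_def hom_def Pi_iff)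
  then show ?thesis
    using WCat_comp1[OF A[THEN K_alg_cell0] B[THEN K_alg_cell0] C[THEN K_alg_cell0]
        f[THEN K_alg_cell1_iff[OF A B gralg_homs_ext[OF f], THEN iffD1]]
        g[THEN K_alg_cell1_iff[OF B C gralg_homs_ext[OF g], THEN iffD1]]]
    by (simp add: K_alg_cell1_iff A C K_alg_comp1[OF A B f])
qed

theorem two_functor_K_alg:
  "two_functor (GrAlg W) (WCat W) (K_alg :: (('g, 'o, 'a) gralg, _, _, _, _, _) twofun)"
proof (rule two_functor_reflect)
  show "two_category (WCat W :: (('g, 'o, 'a) wcat, _, _) twocat)" by (rule two_category_WCat)
  have [simp]: "Cell0 (GrAlg W) = gralgs W" "Cell1 (GrAlg W) = gralg_homs W" "Cell2 (GrAlg W) = gralg_trans W"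
    "Cell0 (WCat W) = wcats W" "Cell1 (WCat W) = wfuns W" "Cell2 (WCat W) = wtrans W"
    by (auto simp: GrAlg_def WCat_def)
  fix A B C :: "('g, 'o, 'a) gralg" and f f' f'' g g' \<alpha> \<alpha>' \<beta>
  show "Fun2 K_alg A B f g \<alpha> = \<alpha>" by simp
  assume "A \<in> Cell0 (GrAlg W)" then have A: "A \<in> gralgs W" by simp
  show "Fun0 K_alg A \<in> Cell0 (WCat W)" using A by (simp add: K_alg_cell0)
  show "Id1 (GrAlg W) A \<in> Cell1 (GrAlg W) A A" using A by (simp add: gralg_id1)
  show "Fun1 K_alg A A (Id1 (GrAlg W) A) = Id1 (WCat W) (Fun0 K_alg A)" using A by (rule K_alg_id1)
  assume "B \<in> Cell0 (GrAlg W)" "f \<in> Cell1 (GrAlg W) A B"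
  then have B: "B \<in> gralgs W" and f: "f \<in> gralg_homs W A B" by simp_all
  note fc = gralg_homs_carrier[OF f]
  show "Fun1 K_alg A B f \<in> Cell1 (WCat W) (Fun0 K_alg A) (Fun0 K_alg B)"
    using f K_alg_cell1_iff[OF A B gralg_homs_ext[OF f]] by simp
  show "Id2 (GrAlg W) A B f = Id2 (WCat W) (Fun0 K_alg A) (Fun0 K_alg B) (Fun1 K_alg A B f)"
    by (auto simp: GrAlg_def WCat_def fc intro!: restrict_ext)
  { assume "f' \<in> Cell1 (GrAlg W) A B"
    then have f': "f' \<in> gralg_homs W A B" by simp
    note f'c = gralg_homs_carrier[OF f']
    show "f = f'" if "Fun1 K_alg A B f = Fun1 K_alg A B f'"
      using gralg_homs_ext[OF f] gralg_homs_ext[OF f']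
        arg_cong[OF that, of vmap] arg_cong[OF that, of hmap] unfolding K_alg_simps
      by (intro K_inj[OF gralgs_group[OF A]]) simp_all
    show "Cell2 (GrAlg W) A B f f'
      = Cell2 (WCat W) (Fun0 K_alg A) (Fun0 K_alg B) (Fun1 K_alg A B f) (Fun1 K_alg A B f')"
      using gralg_trans_K[OF A B f f'] by simp
    { assume "f'' \<in> Cell1 (GrAlg W) A B"
      then have "f'' \<in> gralg_homs W A B" by simp
      note f''c = gralg_homs_carrier[OF this]
      show "VComp (GrAlg W) A B f f' f'' \<alpha>' \<alpha>
        = VComp (WCat W) (Fun0 K_alg A) (Fun0 K_alg B) (Fun1 K_alg A B f) (Fun1 K_alg A B f')
            (Fun1 K_alg A B f'') \<alpha>' \<alpha>"
        by (auto simp: GrAlg_def WCat_def fc f'c f''c intro!: restrict_ext) }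
    assume "C \<in> Cell0 (GrAlg W)" "g \<in> Cell1 (GrAlg W) B C" "g' \<in> Cell1 (GrAlg W) B C"
    then have gc: "x \<in> carrier (grp B) \<Longrightarrow> gmap g x \<in> carrier (grp C)"
      "x \<in> carrier (grp B) \<Longrightarrow> gmap g' x \<in> carrier (grp C)" for x
      by (auto intro: gralg_homs_carrier)
    show "HComp (GrAlg W) A B C f f' g g' \<alpha> \<beta>
      = HComp (WCat W) (Fun0 K_alg A) (Fun0 K_alg B) (Fun0 K_alg C) (Fun1 K_alg A B f)
          (Fun1 K_alg A B f') (Fun1 K_alg B C g) (Fun1 K_alg B C g') \<alpha> \<beta>"
      by (auto simp: GrAlg_def WCat_def fc f'c gc intro!: restrict_ext) }
  assume "C \<in> Cell0 (GrAlg W)" "g \<in> Cell1 (GrAlg W) B C"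
  then have C: "C \<in> gralgs W" and g: "g \<in> gralg_homs W B C" by simp_all
  show "Comp1 (GrAlg W) A B C g f \<in> Cell1 (GrAlg W) A C" using gralg_comp1[OF A B C f g] by simp
  show "Fun1 K_alg A C (Comp1 (GrAlg W) A B C g f)
    = Comp1 (WCat W) (Fun0 K_alg A) (Fun0 K_alg B) (Fun0 K_alg C) (Fun1 K_alg B C g) (Fun1 K_alg A B f)"
    by (rule K_alg_comp1[OF A B f])
qed

end

section \<open>K on graded coalgebras\<close>

definition op_grcoalg :: "('g, 'o, 'a) grcoalg \<Rightarrow> ('g, 'o, 'a) gralg" where
  "op_grcoalg C = \<lparr>grp = cgrp C, gob = cob C, gmul = gcomul C, gunt = gcounit C\<rparr>"

lemma op_grcoalg_simps [simp]:
  "grp (op_grcoalg C) = cgrp C" "gob (op_grcoalg C) = cob C" "gmul (op_grcoalg C) = gcomul C"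
  "gunt (op_grcoalg C) = gcounit C"
  by (simp_all add: op_grcoalg_def)

lemma grcoalgs_op: "C \<in> grcoalgs W \<longleftrightarrow> op_grcoalg C \<in> gralgs (op_moncat W)"
  by (simp add: grcoalgs_def gralgs_def)

lemma grcoalg_homs_op: "grcoalg_homs W C D = gralg_homs (op_moncat W) (op_grcoalg C) (op_grcoalg D)"
  by (simp add: grcoalg_homs_def gralg_homs_def)

lemma grcoalg_trans_op:
  "grcoalg_trans W C D f g = gralg_trans (op_moncat W) (op_grcoalg C) (op_grcoalg D) g f"
  by (simp add: grcoalg_trans_def gralg_trans_def)

lemma K_coalg_op:
  "op_dwcat (Fun0 K_coalg C) = Fun0 K_alg (op_grcoalg C)"
  "Fun1 K_coalg C D f = Fun1 K_alg (op_grcoalg C) (op_grcoalg D) f"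
  by (simp_all add: K_alg_def K_coalg_def op_dwcat_def op_grcoalg_def Let_def)

text \<open>Facts about 0-cells and 1-cells are dualised from graded algebras. Composites of 2-cells
  are compared with \<open>DWCat\<close> directly: its formulas have the same shape as those of
  \<open>GrCoalg\<close>, so naturality is not invoked again.\<close>

theorem (in strict_monoidal_category) two_functor_K_coalg:
  "two_functor (GrCoalg W) (DWCat W) (K_coalg :: (('g, 'o, 'a) grcoalg, _, _, _, _, _) twofun)"
proof (rule two_functor_reflect)
  interpret op: strict_monoidal_category "op_moncat W" by (rule strict_monoidal_op)
  interpret K: two_functor "GrAlg (op_moncat W)" "WCat (op_moncat W)"
    "K_alg :: (('g, 'o, 'a) gralg, _, _, _, _, _) twofun"
    by (rule op.two_functor_K_alg)
  show "two_category (DWCat W :: (('g, 'o, 'a) dwcat, _, _) twocat)" by (rule two_category_DWCat)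
  have cells [simp]: "Cell0 (GrCoalg W) = grcoalgs W" "Cell1 (GrCoalg W) = grcoalg_homs W"
    "Cell2 (GrCoalg W) = grcoalg_trans W"
    "Cell0 (DWCat W) = dwcats W" "Cell1 (DWCat W) = dwfuns W" "Cell2 (DWCat W) = dwtrans W"
    "Cell0 (GrAlg (op_moncat W)) = gralgs (op_moncat W)" "Cell1 (GrAlg (op_moncat W)) = gralg_homs (op_moncat W)"
    "Cell0 (WCat (op_moncat W)) = wcats (op_moncat W)" "Cell1 (WCat (op_moncat W)) = wfuns (op_moncat W)"
    by (auto simp: GrCoalg_def DWCat_def GrAlg_def WCat_def)
  note op = grcoalgs_op grcoalg_homs_op dwcats_op dwfuns_op K_coalg_op
  fix A B C :: "('g, 'o, 'a) grcoalg" and f f' f'' g g' \<alpha> \<alpha>' \<beta>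
  show "Fun2 K_coalg A B f g \<alpha> = \<alpha>" by simp
  assume "A \<in> Cell0 (GrCoalg W)" then have A: "A \<in> grcoalgs W" by simp
  interpret A: group "cgrp A" using gralgs_group[OF A[unfolded op]] by simp
  show "Fun0 K_coalg A \<in> Cell0 (DWCat W)" using A K.fun0_cell by (simp add: op)
  have id1: "Id1 (GrCoalg W) A = Id1 (GrAlg (op_moncat W)) (op_grcoalg A)"
    "Id1 (DWCat W) (Fun0 K_coalg A) = Id1 (WCat (op_moncat W)) (op_dwcat (Fun0 K_coalg A))"
    by (simp_all add: GrCoalg_def GrAlg_def DWCat_def WCat_def)
  show "Id1 (GrCoalg W) A \<in> Cell1 (GrCoalg W) A A"
    using A by (simp add: op id1 op.gralg_id1)
  show "Fun1 K_coalg A A (Id1 (GrCoalg W) A) = Id1 (DWCat W) (Fun0 K_coalg A)"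
    using A by (simp add: op id1 K_alg_id1)
  assume "B \<in> Cell0 (GrCoalg W)" "f \<in> Cell1 (GrCoalg W) A B"
  then have B: "B \<in> grcoalgs W" and f: "f \<in> grcoalg_homs W A B" by simp_all
  note fc = gralg_homs_carrier[OF f[unfolded op], simplified]
  show "Fun1 K_coalg A B f \<in> Cell1 (DWCat W) (Fun0 K_coalg A) (Fun0 K_coalg B)"
    using A B f K.fun1_cell[of "op_grcoalg A" "op_grcoalg B" f] by (simp add: op)
  show "Id2 (GrCoalg W) A B f = Id2 (DWCat W) (Fun0 K_coalg A) (Fun0 K_coalg B) (Fun1 K_coalg A B f)"
    by (auto simp: GrCoalg_def DWCat_def fc intro!: restrict_ext)
  { assume "f' \<in> Cell1 (GrCoalg W) A B"
    then have f': "f' \<in> grcoalg_homs W A B" by simp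
    note f'c = gralg_homs_carrier[OF f'[unfolded op], simplified]
    show "f = f'" if "Fun1 K_coalg A B f = Fun1 K_coalg A B f'"
      using gralg_homs_ext[OF f[unfolded op]] gralg_homs_ext[OF f'[unfolded op]]
        arg_cong[OF that, of vmap] arg_cong[OF that, of hmap] unfolding K_coalg_simps
      by (intro K_inj[OF A.group_axioms]) simp_all
    \<comment> \<open>Duality reverses 2-cells, hence \<open>gralg_trans_K\<close> is used with
      \<open>f'\<close> before \<open>f\<close>.\<close>
    show "Cell2 (GrCoalg W) A B f f'
      = Cell2 (DWCat W) (Fun0 K_coalg A) (Fun0 K_coalg B) (Fun1 K_coalg A B f) (Fun1 K_coalg A B f')"
      using gralg_trans_K[OF A[unfolded op] B[unfolded op] f'[unfolded op] f[unfolded op]]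
      by (simp add: grcoalg_trans_op dwtrans_op K_coalg_op)
    { assume "f'' \<in> Cell1 (GrCoalg W) A B"
      then have f'': "f'' \<in> grcoalg_homs W A B" by simp
      note f''c = gralg_homs_carrier[OF f''[unfolded op], simplified]
      show "VComp (GrCoalg W) A B f f' f'' \<alpha>' \<alpha>
        = VComp (DWCat W) (Fun0 K_coalg A) (Fun0 K_coalg B) (Fun1 K_coalg A B f) (Fun1 K_coalg A B f')
            (Fun1 K_coalg A B f'') \<alpha>' \<alpha>"
        by (auto simp: GrCoalg_def DWCat_def fc f'c f''c intro!: restrict_ext) }
    assume "C \<in> Cell0 (GrCoalg W)" "g \<in> Cell1 (GrCoalg W) B C" "g' \<in> Cell1 (GrCoalg W) B C"
    then have g: "g \<in> grcoalg_homs W B C" "g' \<in> grcoalg_homs W B C" by simp_all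
    note gc = gralg_homs_carrier[OF g(1)[unfolded op], simplified]
      gralg_homs_carrier[OF g(2)[unfolded op], simplified]
    show "HComp (GrCoalg W) A B C f f' g g' \<alpha> \<beta>
      = HComp (DWCat W) (Fun0 K_coalg A) (Fun0 K_coalg B) (Fun0 K_coalg C) (Fun1 K_coalg A B f)
          (Fun1 K_coalg A B f') (Fun1 K_coalg B C g) (Fun1 K_coalg B C g') \<alpha> \<beta>"
      by (auto simp: GrCoalg_def DWCat_def fc f'c gc intro!: restrict_ext) }
  assume "C \<in> Cell0 (GrCoalg W)" "g \<in> Cell1 (GrCoalg W) B C"
  then have C: "C \<in> grcoalgs W" and g: "g \<in> grcoalg_homs W B C" by simp_all
  have comp1: "Comp1 (GrCoalg W) A B C g f
      = Comp1 (GrAlg (op_moncat W)) (op_grcoalg A) (op_grcoalg B) (op_grcoalg C) g f"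
    "Comp1 (DWCat W) (Fun0 K_coalg A) (Fun0 K_coalg B) (Fun0 K_coalg C) h k
      = Comp1 (WCat (op_moncat W)) (op_dwcat (Fun0 K_coalg A)) (op_dwcat (Fun0 K_coalg B))
          (op_dwcat (Fun0 K_coalg C)) h k" for h k
    by (simp_all add: GrCoalg_def GrAlg_def DWCat_def WCat_def)
  show "Comp1 (GrCoalg W) A B C g f \<in> Cell1 (GrCoalg W) A C"
    using op.gralg_comp1[OF A[unfolded op] B[unfolded op] C[unfolded op] f[unfolded op] g[unfolded op]]
    by (simp add: op comp1)
  show "Fun1 K_coalg A C (Comp1 (GrCoalg W) A B C g f)
    = Comp1 (DWCat W) (Fun0 K_coalg A) (Fun0 K_coalg B) (Fun0 K_coalg C) (Fun1 K_coalg B C g) (Fun1 K_coalg A B f)"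
    using K_alg_comp1[OF A[unfolded op] B[unfolded op] f[unfolded op]] by (simp add: op comp1)
qed


section \<open>Hopf structures\<close>

text \<open>In degree x^-1 y the antipode takes values in degree (x^-1 y)^-1 = y^-1 x, which is the
  hom-object from y to x. Both antipode laws at (x, y) are then the graded laws in degree x^-1
  y.\<close>

lemma Hopf_category_K_alg:
  assumes "Hopf_group_algebra V A"
  shows "Hopf_category V (Fun0 K_alg A)"
proof -
  have A: "A \<in> gralgs (Coalg V)"
    using assms by (simp add: Hopf_group_algebra_def GrAlg_def)
  interpret group "grp A" using A by (rule gralgs_group)
  obtain S where S: "\<And>\<sigma>. \<sigma> \<in> carrier (grp A) \<Longrightarrow>
        S \<sigma> \<in> Hom V (cca (gob A \<sigma>)) (cca (gob A (inv\<^bsub>grp A\<^esub> \<sigma>))) \<and>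
        Cmp V (Cmp V (gmul A \<sigma> (inv\<^bsub>grp A\<^esub> \<sigma>)) (TenM V (Idn V (cca (gob A \<sigma>))) (S \<sigma>))) (cmul (gob A \<sigma>))
          = Cmp V (gunt A) (ceps (gob A \<sigma>)) \<and>
        Cmp V (Cmp V (gmul A (inv\<^bsub>grp A\<^esub> \<sigma>) \<sigma>) (TenM V (S \<sigma>) (Idn V (cca (gob A \<sigma>))))) (cmul (gob A \<sigma>))
          = Cmp V (gunt A) (ceps (gob A \<sigma>))"
    using assms by (auto simp: Hopf_group_algebra_def Let_def)
  have "Fun0 K_alg A \<in> Cell0 (WCat (Coalg V))"
    using K_alg_cell0[OF A] by (simp add: WCat_def)
  moreover have "\<forall>x\<in>vtx (Fun0 K_alg A). \<forall>y\<in>vtx (Fun0 K_alg A).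
    S (ldiv (grp A) x y) \<in> Hom V (cca (hob (Fun0 K_alg A) x y)) (cca (hob (Fun0 K_alg A) y x)) \<and>
    Cmp V (Cmp V (mul (Fun0 K_alg A) x y x) (TenM V (Idn V (cca (hob (Fun0 K_alg A) x y))) (S (ldiv (grp A) x y))))
      (cmul (hob (Fun0 K_alg A) x y)) = Cmp V (unt (Fun0 K_alg A) x) (ceps (hob (Fun0 K_alg A) x y)) \<and>
    Cmp V (Cmp V (mul (Fun0 K_alg A) y x y) (TenM V (S (ldiv (grp A) x y)) (Idn V (cca (hob (Fun0 K_alg A) x y)))))
      (cmul (hob (Fun0 K_alg A) x y)) = Cmp V (unt (Fun0 K_alg A) y) (ceps (hob (Fun0 K_alg A) x y))"
    (is "\<forall>x\<in>_. \<forall>y\<in>_. ?P x y")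
  proof (intro ballI)
    fix x y assume "x \<in> vtx (Fun0 K_alg A)" "y \<in> vtx (Fun0 K_alg A)"
    then have xy: "x \<in> carrier (grp A)" "y \<in> carrier (grp A)" by simp_all
    show "?P x y"
      using S[of "ldiv (grp A) x y"] xy unfolding inv_ldiv[OF xy] by simp
  qed
  ultimately show ?thesis unfolding Hopf_category_def
    by (intro conjI exI[of _ "\<lambda>x y. S (ldiv (grp A) x y)"])
qed

text \<open>The laws at (x, y) share the comultiplication with indices x, y, x but live in different
  algebras. The first is the graded law in degree x^-1 y; the second involves \<open>S y x\<close>
  and is the graded law in degree y^-1 x, so the antipode is used in two mutually inverse
  degrees.\<close>

lemma dual_Hopf_category_K_coalg:
  assumes "Hopf_group_coalgebra V C"
  shows "dual_Hopf_category V (Fun0 K_coalg C)"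
proof -
  have C: "op_grcoalg C \<in> gralgs (op_moncat (Alg V))"
    using assms by (simp add: Hopf_group_coalgebra_def GrCoalg_def grcoalgs_op)
  interpret group "cgrp C" using gralgs_group[OF C] by simp
  obtain S where S: "\<And>\<sigma>. \<sigma> \<in> carrier (cgrp C) \<Longrightarrow>
        S \<sigma> \<in> Hom V (aca (cob C (inv\<^bsub>cgrp C\<^esub> \<sigma>))) (aca (cob C \<sigma>)) \<and>
        Cmp V (Cmp V (amul (cob C \<sigma>)) (TenM V (Idn V (aca (cob C \<sigma>))) (S \<sigma>))) (gcomul C \<sigma> (inv\<^bsub>cgrp C\<^esub> \<sigma>))
          = Cmp V (aeta (cob C \<sigma>)) (gcounit C) \<and>
        Cmp V (Cmp V (amul (cob C \<sigma>)) (TenM V (S \<sigma>) (Idn V (aca (cob C \<sigma>))))) (gcomul C (inv\<^bsub>cgrp C\<^esub> \<sigma>) \<sigma>)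
          = Cmp V (aeta (cob C \<sigma>)) (gcounit C)"
    using assms by (auto simp: Hopf_group_coalgebra_def Let_def)
  let ?K = "Fun0 K_coalg C"
  have "?K \<in> Cell0 (DWCat (Alg V))"
    using K_alg_cell0[OF C] by (simp add: DWCat_def dwcats_op K_coalg_op)
  moreover have "\<forall>x\<in>dvtx ?K. \<forall>y\<in>dvtx ?K.
    S (ldiv (cgrp C) x y) \<in> Hom V (aca (dhob ?K y x)) (aca (dhob ?K x y)) \<and>
    Cmp V (Cmp V (amul (dhob ?K x y)) (TenM V (Idn V (aca (dhob ?K x y))) (S (ldiv (cgrp C) x y))))
      (dcomul ?K x y x) = Cmp V (aeta (dhob ?K x y)) (dcounit ?K x) \<and>
    Cmp V (Cmp V (amul (dhob ?K y x)) (TenM V (S (ldiv (cgrp C) y x)) (Idn V (aca (dhob ?K y x)))))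
      (dcomul ?K x y x) = Cmp V (aeta (dhob ?K y x)) (dcounit ?K x)"
    (is "\<forall>x\<in>_. \<forall>y\<in>_. ?P x y")
  proof (intro ballI)
    fix x y assume "x \<in> dvtx ?K" "y \<in> dvtx ?K"
    then have xy: "x \<in> carrier (cgrp C)" "y \<in> carrier (cgrp C)" by simp_all
    show "?P x y"
      using S[of "ldiv (cgrp C) x y"] S[of "ldiv (cgrp C) y x"] xy
      unfolding inv_ldiv[OF xy] inv_ldiv[OF xy(2,1)] by simp
  qed
  ultimately show ?thesis unfolding dual_Hopf_category_def
    by (intro conjI exI[of _ "\<lambda>x y. S (ldiv (cgrp C) x y)"])
qed

theorem proposition5p3:
  fixes V :: "('o, 'a) brmoncat"
  assumes "braided_strict_monoidal_category V"
  shows "two_functor (GrAlg (Coalg V)) (WCat (Coalg V))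
           (K_alg :: (('g, ('o, 'a) coalg, 'a) gralg, _, _, _, _, _) twofun) \<and>
         two_functor (GrCoalg (Alg V)) (DWCat (Alg V))
           (K_coalg :: (('g, ('o, 'a) alg, 'a) grcoalg, _, _, _, _, _) twofun) \<and>
         (\<forall>A :: ('g, ('o, 'a) coalg, 'a) gralg.
           Hopf_group_algebra V A \<longrightarrow> Hopf_category V (Fun0 K_alg A)) \<and>
         (\<forall>C :: ('g, ('o, 'a) alg, 'a) grcoalg.
           Hopf_group_coalgebra V C \<longrightarrow> dual_Hopf_category V (Fun0 K_coalg C))"
proof -
  interpret braided_strict_monoidal_category V by fact
  interpret coalg: strict_monoidal_category "Coalg V" by (rule strict_monoidal_Coalg)
  interpret alg: strict_monoidal_category "Alg V" by (rule strict_monoidal_Alg)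
  show ?thesis
    by (intro conjI allI impI coalg.two_functor_K_alg alg.two_functor_K_coalg
        Hopf_category_K_alg dual_Hopf_category_K_coalg)
qed

end
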